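(* It is decidable whether a regular forest language is piecewise testable; i.e. there is an algorithm which, given a regular forest language $L$ over a finite alphabet $A$, decides whether $L$ is piecewise testable.
   Context: Forests over a finite alphabet $A$ are finite, ordered, unranked, $A$-labelled forests (finite sequences of trees, the empty forest allowed). Contexts over $A$ are forests over $A\cup\{\Box\}$ with exactly one node, a leaf, labelled $\Box$ (the hole). A forest $s$ is a piece of $t$ if $s$ is obtained from $t$ by deleting some nodes (children of a deleted node are attached, in order, in its place). A forest language $L$ is piecewise testable if there is $n\ge 0$ such that membership of $t$ in $L$ depends only on the set of pieces of $t$ with at most $n$ nodes. A forest algebra is a pair $(H,V)$ of monoids, $H$ additive (not necessarily commutative), $V$ multiplicative with identity $\Box$, with a faithful monoidal left action of $V$ on $H$ and elements $g+\Box,\Box+g\in V$ for each $g\in H$ acting by $h\mapsto g+h$, $h\mapsto h+g$. $A^\Delta$ is the free forest algebra of forests (under concatenation) and contexts (under substitution in the hole) over $A$; a morphism $A^\Delta\to(H,V)$ is determined by the images of the contexts $a\Box$, $a\in A$. A regular forest language is one of the form $\alpha^{-1}(X)$ with $\alpha:A^\Delta\to(H,V)$ a morphism to a finite forest algebra and $X\subseteq H$; as input it is given by such $(H,V)$, $\alpha$, $X$ (or any effectively equivalent representation). *)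

theory Defs
  imports "HOL-Algebra.Group" "HOL-Library.Nat_Bijection"
begin

section \<open>Forests and contexts\<close>

datatype 'a tree = Node 'a "'a tree list"

type_synonym 'a forest = "'a tree list"

fun nodes_tree :: "'a tree \<Rightarrow> nat" where
  "nodes_tree (Node a ts) = Suc (sum_list (map nodes_tree ts))"

definition nodes :: "'a forest \<Rightarrow> nat" where
  "nodes t = sum_list (map nodes_tree t)"

definition forests :: "'a set \<Rightarrow> 'a forest set" where
  "forests A = {t. \<forall>x\<in>set t. set_tree x \<subseteq> A}"

text \<open>
  A context is a forest with exactly one hole, the hole being a leaf. The datatype follows the path
  to the hole: either the hole is a root, giving \<open>l + \<box> + r\<close>, or it lies below a root labelled \<open>a\<close>,
  giving \<open>l + a(c) + r\<close> for a context \<open>c\<close>. Each context has exactly one such description.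
\<close>

datatype 'a ctxt =
    Hole "'a forest" "'a forest"
  | Nest "'a forest" 'a "'a ctxt" "'a forest"

definition contexts :: "'a set \<Rightarrow> 'a ctxt set" where
  "contexts A = {p. set_ctxt p \<subseteq> A}"

fun plug :: "'a ctxt \<Rightarrow> 'a forest \<Rightarrow> 'a forest" where
  "plug (Hole l r) t = l @ t @ r"
| "plug (Nest l a c r) t = l @ Node a (plug c t) # r"

fun ctxt_comp :: "'a ctxt \<Rightarrow> 'a ctxt \<Rightarrow> 'a ctxt" where
  "ctxt_comp (Hole l r) (Hole l' r') = Hole (l @ l') (r' @ r)"
| "ctxt_comp (Hole l r) (Nest l' a c r') = Nest (l @ l') a c (r' @ r)"
| "ctxt_comp (Nest l a c r) q = Nest l a (ctxt_comp c q) r"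

definition letter_ctxt :: "'a \<Rightarrow> 'a ctxt" where
  "letter_ctxt a = Nest [] a (Hole [] []) []"


section \<open>Piecewise testable forest languages\<close>

text \<open>Deletion of a single node, whose children take its place.\<close>

inductive delete_node :: "'a forest \<Rightarrow> 'a forest \<Rightarrow> bool" where
  "delete_node (l @ Node a ts # r) (l @ ts @ r)"
| "delete_node ts us \<Longrightarrow> delete_node (l @ Node a ts # r) (l @ Node a us # r)"

definition piece :: "'a forest \<Rightarrow> 'a forest \<Rightarrow> bool" where
  "piece s t \<longleftrightarrow> delete_node\<^sup>*\<^sup>* t s"

definition pieces :: "nat \<Rightarrow> 'a forest \<Rightarrow> 'a forest set" where
  "pieces n t = {s. piece s t \<and> nodes s \<le> n}"

definition piecewise_testable :: "'a set \<Rightarrow> 'a forest set \<Rightarrow> bool" where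
  "piecewise_testable A L \<longleftrightarrow>
     (\<exists>n. \<forall>s\<in>forests A. \<forall>t\<in>forests A. pieces n s = pieces n t \<longrightarrow> (s \<in> L \<longleftrightarrow> t \<in> L))"


section \<open>Forest algebras\<close>

text \<open>
  The monoid \<open>hor F\<close> is written additively in informal usage; it need not be commutative. The
  operations \<open>inl F g\<close> and \<open>inr F g\<close> stand for \<open>g + \<box>\<close> and \<open>\<box> + g\<close>.
\<close>

record ('h, 'v) forest_algebra =
  hor :: "'h monoid"
  ver :: "'v monoid"
  act :: "'v \<Rightarrow> 'h \<Rightarrow> 'h"
  inl :: "'h \<Rightarrow> 'v"
  inr :: "'h \<Rightarrow> 'v"

locale forest_algebra =
  fixes F :: "('h, 'v) forest_algebra"
  assumes hor_monoid: "monoid (hor F)"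
    and ver_monoid: "monoid (ver F)"
    and act_closed: "\<lbrakk>v \<in> carrier (ver F); h \<in> carrier (hor F)\<rbrakk> \<Longrightarrow> act F v h \<in> carrier (hor F)"
    and act_one: "h \<in> carrier (hor F) \<Longrightarrow> act F \<one>\<^bsub>ver F\<^esub> h = h"
    and act_mult: "\<lbrakk>v \<in> carrier (ver F); w \<in> carrier (ver F); h \<in> carrier (hor F)\<rbrakk>
      \<Longrightarrow> act F (v \<otimes>\<^bsub>ver F\<^esub> w) h = act F v (act F w h)"
    and faithful: "\<lbrakk>v \<in> carrier (ver F); w \<in> carrier (ver F);
        \<And>h. h \<in> carrier (hor F) \<Longrightarrow> act F v h = act F w h\<rbrakk> \<Longrightarrow> v = w"
    and inl_closed: "g \<in> carrier (hor F) \<Longrightarrow> inl F g \<in> carrier (ver F)"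
    and inr_closed: "g \<in> carrier (hor F) \<Longrightarrow> inr F g \<in> carrier (ver F)"
    and act_inl: "\<lbrakk>g \<in> carrier (hor F); h \<in> carrier (hor F)\<rbrakk>
      \<Longrightarrow> act F (inl F g) h = g \<otimes>\<^bsub>hor F\<^esub> h"
    and act_inr: "\<lbrakk>g \<in> carrier (hor F); h \<in> carrier (hor F)\<rbrakk>
      \<Longrightarrow> act F (inr F g) h = h \<otimes>\<^bsub>hor F\<^esub> g"

definition free_forest_algebra :: "'a set \<Rightarrow> ('a forest, 'a ctxt) forest_algebra" where
  "free_forest_algebra A =
     \<lparr>hor = \<lparr>carrier = forests A, mult = (@), one = []\<rparr>,
      ver = \<lparr>carrier = contexts A, mult = ctxt_comp, one = Hole [] []\<rparr>,
      act = plug,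
      inl = (\<lambda>g. Hole g []),
      inr = (\<lambda>g. Hole [] g)\<rparr>"

locale forest_algebra_morphism =
  source: forest_algebra F + target: forest_algebra G
  for F :: "('h, 'v) forest_algebra" and G :: "('k, 'w) forest_algebra" +
  fixes \<phi> :: "'h \<Rightarrow> 'k" and \<psi> :: "'v \<Rightarrow> 'w"
  assumes hor_hom: "\<phi> \<in> hom (hor F) (hor G)"
    and hor_one: "\<phi> \<one>\<^bsub>hor F\<^esub> = \<one>\<^bsub>hor G\<^esub>"
    and ver_hom: "\<psi> \<in> hom (ver F) (ver G)"
    and ver_one: "\<psi> \<one>\<^bsub>ver F\<^esub> = \<one>\<^bsub>ver G\<^esub>"
    and morph_act: "\<lbrakk>v \<in> carrier (ver F); h \<in> carrier (hor F)\<rbrakk>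
      \<Longrightarrow> \<phi> (act F v h) = act G (\<psi> v) (\<phi> h)"
    and morph_inl: "g \<in> carrier (hor F) \<Longrightarrow> \<psi> (inl F g) = inl G (\<phi> g)"
    and morph_inr: "g \<in> carrier (hor F) \<Longrightarrow> \<psi> (inr F g) = inr G (\<phi> g)"

lemma plug_ctxt_comp: "plug (ctxt_comp p q) t = plug p (plug q t)"
  by (induction p q rule: ctxt_comp.induct) auto

lemma ctxt_comp_assoc: "ctxt_comp (ctxt_comp p q) r = ctxt_comp p (ctxt_comp q r)"
proof (induction p)
  case (Hole l r')
  then show ?case by (cases q; cases r) auto
qed auto

lemma ctxt_comp_one: "ctxt_comp p (Hole [] []) = p"
  by (induction p) auto

lemma plug_forests: "p \<in> contexts A \<Longrightarrow> t \<in> forests A \<Longrightarrow> plug p t \<in> forests A"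
  by (induction p) (auto simp: contexts_def forests_def)

lemma ctxt_comp_contexts: "p \<in> contexts A \<Longrightarrow> q \<in> contexts A \<Longrightarrow> ctxt_comp p q \<in> contexts A"
  by (induction p q rule: ctxt_comp.induct) (auto simp: contexts_def)

lemma nodes_append: "nodes (s @ t) = nodes s + nodes t"
  by (simp add: nodes_def)

lemma nodes_Cons: "nodes (x # t) = nodes_tree x + nodes t"
  by (simp add: nodes_def)

lemma nodes_tree_Node: "nodes_tree (Node a t) = Suc (nodes t)"
  by (simp add: nodes_def)

lemma nodes_tree_le: "x \<in> set t \<Longrightarrow> nodes_tree x \<le> nodes t"
  by (induction t) (auto simp: nodes_Cons)

fun ctxt_nodes :: "'a ctxt \<Rightarrow> nat" where
  "ctxt_nodes (Hole l r) = nodes l + nodes r"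
| "ctxt_nodes (Nest l a c r) = nodes l + ctxt_nodes c + nodes r"

lemma nodes_plug_ge: "nodes t \<le> nodes (plug p t)"
  by (induction p) (auto simp: nodes_append nodes_Cons nodes_tree_Node simp del: nodes_tree.simps)

lemma big_tree_unique:
  assumes eq: "l @ x # r = l' @ x' # r'"
    and x: "N \<le> nodes_tree x" "N \<le> nodes_tree x'"
    and "nodes l < N" "nodes r < N" "nodes l' < N" "nodes r' < N"
  shows "l = l' \<and> x = x' \<and> r = r'"
proof -
  have small: "y \<notin> set u" if "nodes u < N" "N \<le> nodes_tree y" for y and u :: "'a forest"
    using nodes_tree_le[of y u] that by linarith
  have "x \<notin> set l" "x \<notin> set r" "x \<notin> set l'" "x \<notin> set r'"
    using small x assms(4-7) by blast+
  moreover have "x = x'"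
  proof -
    have "x \<in> set (l' @ x' # r')" by (simp flip: eq)
    with \<open>x \<notin> set l'\<close> \<open>x \<notin> set r'\<close> show ?thesis by simp
  qed
  ultimately show ?thesis using eq append_Cons_eq_iff[of x l r l' r'] by simp
qed

lemma plug_big_tree_inj:
  assumes "plug p [T] = plug q [T]" "ctxt_nodes p < nodes_tree T" "ctxt_nodes q < nodes_tree T"
  shows "p = q"
  using assms
proof (induction p arbitrary: q)
  case (Hole l r)
  show ?case
  proof (cases q)
    case (Hole l' r')
    then show ?thesis
      using big_tree_unique[of l T r l' T r' "nodes_tree T"] Hole.prems by auto
  next
    case (Nest l' a c r')
    have "nodes_tree T < nodes_tree (Node a (plug c [T]))"
      using nodes_plug_ge[of "[T]" c] by (simp add: nodes_tree_Node nodes_Cons del: nodes_tree.simps)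
    then show ?thesis
      using big_tree_unique[of l T r l' "Node a (plug c [T])" r' "nodes_tree T"] Hole.prems Nest
      by (auto simp del: nodes_tree.simps)
  qed
next
  case (Nest l a c r)
  have big: "nodes_tree T < nodes_tree (Node b (plug d [T]))" for b d
    using nodes_plug_ge[of "[T]" d] by (simp add: nodes_tree_Node nodes_Cons del: nodes_tree.simps)
  show ?case
  proof (cases q)
    case (Hole l' r')
    then show ?thesis
      using big_tree_unique[of l "Node a (plug c [T])" r l' T r' "nodes_tree T"] Nest.prems big[of a c]
      by (auto simp del: nodes_tree.simps)
  next
    case q: (Nest l' b d r')
    have "l = l' \<and> Node a (plug c [T]) = Node b (plug d [T]) \<and> r = r'"
      using big_tree_unique[of l "Node a (plug c [T])" r l' "Node b (plug d [T])" r' "nodes_tree T"]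
        Nest.prems big[of a c] big[of b d] q
      by (auto simp del: nodes_tree.simps)
    then show ?thesis
      using Nest.IH[of d] Nest.prems q by auto
  qed
qed

lemma big_tree_exists:
  assumes "a \<in> A" shows "\<exists>T. [T] \<in> forests A \<and> n < nodes_tree T"
proof -
  have "[Node a (replicate n (Node a []))] \<in> forests A"
    using assms by (auto simp: forests_def)
  moreover have "n < nodes_tree (Node a (replicate n (Node a [])))"
    by (simp add: sum_list_replicate)
  ultimately show ?thesis by blast
qed

lemma plug_faithful:
  assumes p: "p \<in> contexts A" and q: "q \<in> contexts A"
    and eq: "\<And>t. t \<in> forests A \<Longrightarrow> plug p t = plug q t"
  shows "p = q"
proof (cases "A = {}")
  case True
  have no_tree: "set_tree x \<noteq> {}" for x :: "'a tree" by (cases x) auto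
  have nil: "l = []" if l: "\<forall>x\<in>set l. set_tree x = {}" for l :: "'a forest"
  proof (rule ccontr)
    assume "l \<noteq> []"
    then have "hd l \<in> set l" by simp
    then show False using l no_tree by blast
  qed
  have trivial: "r = Hole [] []" if r: "r \<in> contexts A" for r
  proof (cases r)
    case (Hole l l')
    then have "\<forall>x\<in>set l. set_tree x = {}" "\<forall>x\<in>set l'. set_tree x = {}"
      using r True by (auto simp: contexts_def)
    then have "l = []" "l' = []" using nil by blast+
    then show ?thesis using Hole by simp
  next
    case (Nest l a c l')
    then show ?thesis using r True by (simp add: contexts_def)
  qed
  show ?thesis using trivial[OF p] trivial[OF q] by simp
next
  case False
  then obtain a where "a \<in> A" by blast
  then obtain T where "[T] \<in> forests A" and T: "ctxt_nodes p + ctxt_nodes q < nodes_tree T"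
    using big_tree_exists by meson
  show ?thesis
    using T by (intro plug_big_tree_inj[OF eq[OF \<open>[T] \<in> forests A\<close>]]) auto
qed

lemma forest_algebra_free: "forest_algebra (free_forest_algebra A)"
proof (rule forest_algebra.intro)
  show "monoid (hor (free_forest_algebra A))"
    by (rule monoidI) (auto simp: free_forest_algebra_def forests_def)
  show "monoid (ver (free_forest_algebra A))"
  proof (rule monoidI)
    show "\<one>\<^bsub>ver (free_forest_algebra A)\<^esub> \<otimes>\<^bsub>ver (free_forest_algebra A)\<^esub> p = p" for p
      by (cases p) (simp_all add: free_forest_algebra_def)
  qed (simp_all add: free_forest_algebra_def ctxt_comp_contexts ctxt_comp_assoc ctxt_comp_one,
      simp add: contexts_def)
next
  show "v = w" if "v \<in> carrier (ver (free_forest_algebra A))" "w \<in> carrier (ver (free_forest_algebra A))"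
    "\<And>h. h \<in> carrier (hor (free_forest_algebra A)) \<Longrightarrow>
       act (free_forest_algebra A) v h = act (free_forest_algebra A) w h" for v w
    using that plug_faithful[of v A w] by (simp add: free_forest_algebra_def)
qed (simp_all add: free_forest_algebra_def plug_ctxt_comp plug_forests,
    auto simp: forests_def contexts_def)

text \<open>A morphism from the free forest algebra is determined by the images of the contexts \<open>a\<box>\<close>.\<close>

lemma morphism_from_free_unique:
  assumes "forest_algebra_morphism (free_forest_algebra A) F \<phi> \<psi>"
    and "forest_algebra_morphism (free_forest_algebra A) F \<phi>' \<psi>'"
    and letters: "\<And>a. a \<in> A \<Longrightarrow> \<psi> (letter_ctxt a) = \<psi>' (letter_ctxt a)"
  shows "t \<in> forests A \<Longrightarrow> \<phi> t = \<phi>' t" and "p \<in> contexts A \<Longrightarrow> \<psi> p = \<psi>' p"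
proof -
  interpret m: forest_algebra_morphism "free_forest_algebra A" F \<phi> \<psi> by fact
  interpret m': forest_algebra_morphism "free_forest_algebra A" F \<phi>' \<psi>' by fact
  note free = free_forest_algebra_def
  have add: "\<phi> (s @ t) = \<phi> s \<otimes>\<^bsub>hor F\<^esub> \<phi> t" "\<phi>' (s @ t) = \<phi>' s \<otimes>\<^bsub>hor F\<^esub> \<phi>' t"
    if "s \<in> forests A" "t \<in> forests A" for s t
    using hom_mult[OF m.hor_hom, of s t] hom_mult[OF m'.hor_hom, of s t] that by (simp_all add: free)
  have mul: "\<psi> (ctxt_comp p q) = \<psi> p \<otimes>\<^bsub>ver F\<^esub> \<psi> q"
    "\<psi>' (ctxt_comp p q) = \<psi>' p \<otimes>\<^bsub>ver F\<^esub> \<psi>' q"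
    if "p \<in> contexts A" "q \<in> contexts A" for p q
    using hom_mult[OF m.ver_hom, of p q] hom_mult[OF m'.ver_hom, of p q] that by (simp_all add: free)
  have empty: "\<phi> [] = \<phi>' []"
    using m.hor_one m'.hor_one by (simp add: free)
  have tree: "\<phi> [x] = \<phi>' [x]" if "set_tree x \<subseteq> A" for x
    using that
  proof (induction x)
    case (Node a ts)
    have list: "us \<in> forests A \<Longrightarrow> (\<And>x. x \<in> set us \<Longrightarrow> \<phi> [x] = \<phi>' [x]) \<Longrightarrow> \<phi> us = \<phi>' us" for us
    proof (induction us)
      case (Cons u us)
      then have "[u] \<in> forests A" "us \<in> forests A" by (auto simp: forests_def)
      with Cons show ?case using add[of "[u]" us] by simp
    qed (simp add: empty)
    have "a \<in> A" "ts \<in> forests A" using Node.prems by (auto simp: forests_def)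
    moreover from this have "\<phi> ts = \<phi>' ts"
      using Node by - (rule list, auto)
    ultimately show ?case
      using m.morph_act[of "letter_ctxt a" ts] m'.morph_act[of "letter_ctxt a" ts] letters[of a]
      by (simp add: free letter_ctxt_def contexts_def)
  qed
  have forest: "\<phi> t = \<phi>' t" if "t \<in> forests A" for t
    using that
  proof (induction t)
    case (Cons u us)
    then have "[u] \<in> forests A" "us \<in> forests A" "set_tree u \<subseteq> A" by (auto simp: forests_def)
    with Cons show ?case using add[of "[u]" us] tree[of u] by simp
  qed (simp add: empty)
  then show "t \<in> forests A \<Longrightarrow> \<phi> t = \<phi>' t" .
  have hole_eq: "\<psi> (Hole l r) = \<psi>' (Hole l r)" if "l \<in> forests A" "r \<in> forests A" for l r
  proof -
    have "\<psi> (Hole l []) = \<psi>' (Hole l [])" "\<psi> (Hole [] r) = \<psi>' (Hole [] r)"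
      using that m.morph_inl[of l] m'.morph_inl[of l] m.morph_inr[of r] m'.morph_inr[of r] forest
      by (simp_all add: free)
    moreover have "Hole l [] \<in> contexts A" "Hole [] r \<in> contexts A"
      using that by (auto simp: forests_def contexts_def)
    ultimately show ?thesis using mul[of "Hole l []" "Hole [] r"] by simp
  qed
  show "p \<in> contexts A \<Longrightarrow> \<psi> p = \<psi>' p"
  proof (induction p)
    case (Hole l r)
    then show ?case by (intro hole_eq) (auto simp: forests_def contexts_def)
  next
    case (Nest l a c r)
    have split: "Nest l a c r = ctxt_comp (Hole l r) (ctxt_comp (letter_ctxt a) c)"
      by (cases c) (simp_all add: letter_ctxt_def)
    have in_A: "Hole l r \<in> contexts A" "letter_ctxt a \<in> contexts A" "c \<in> contexts A" "a \<in> A"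
      "l \<in> forests A" "r \<in> forests A"
      using Nest.prems by (auto simp: contexts_def forests_def letter_ctxt_def)
    then show ?case
      unfolding split using Nest.IH hole_eq[of l r] letters[of a]
      by (simp add: mul ctxt_comp_contexts del: ctxt_comp.simps)
  qed
qed

text \<open>Every choice of images of the contexts \<open>a\<box>\<close> extends to a morphism.\<close>

fun eval_tree :: "('h, 'v) forest_algebra \<Rightarrow> ('a \<Rightarrow> 'v) \<Rightarrow> 'a tree \<Rightarrow> 'h" where
  "eval_tree F \<alpha> (Node a ts) =
     act F (\<alpha> a) (foldr (\<lambda>x h. eval_tree F \<alpha> x \<otimes>\<^bsub>hor F\<^esub> h) ts \<one>\<^bsub>hor F\<^esub>)"

definition eval_forest :: "('h, 'v) forest_algebra \<Rightarrow> ('a \<Rightarrow> 'v) \<Rightarrow> 'a forest \<Rightarrow> 'h" where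
  "eval_forest F \<alpha> ts = foldr (\<lambda>x h. eval_tree F \<alpha> x \<otimes>\<^bsub>hor F\<^esub> h) ts \<one>\<^bsub>hor F\<^esub>"

fun eval_ctxt :: "('h, 'v) forest_algebra \<Rightarrow> ('a \<Rightarrow> 'v) \<Rightarrow> 'a ctxt \<Rightarrow> 'v" where
  "eval_ctxt F \<alpha> (Hole l r) =
     inl F (eval_forest F \<alpha> l) \<otimes>\<^bsub>ver F\<^esub> inr F (eval_forest F \<alpha> r)"
| "eval_ctxt F \<alpha> (Nest l a c r) =
     (inl F (eval_forest F \<alpha> l) \<otimes>\<^bsub>ver F\<^esub> inr F (eval_forest F \<alpha> r)) \<otimes>\<^bsub>ver F\<^esub>
       (\<alpha> a \<otimes>\<^bsub>ver F\<^esub> eval_ctxt F \<alpha> c)"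

lemma morphism_from_free_exists:
  assumes "forest_algebra F" and letters: "\<And>a. a \<in> A \<Longrightarrow> \<alpha> a \<in> carrier (ver F)"
  shows "forest_algebra_morphism (free_forest_algebra A) F (eval_forest F \<alpha>) (eval_ctxt F \<alpha>)"
    and "a \<in> A \<Longrightarrow> eval_ctxt F \<alpha> (letter_ctxt a) = \<alpha> a"
proof -
  interpret forest_algebra F by fact
  interpret H: monoid "hor F" by (rule hor_monoid)
  interpret V: monoid "ver F" by (rule ver_monoid)
  let ?\<phi> = "eval_forest F \<alpha>" and ?\<psi> = "eval_ctxt F \<alpha>"
  have eval_Nil: "?\<phi> [] = \<one>\<^bsub>hor F\<^esub>" and
    eval_Cons: "?\<phi> (x # t) = eval_tree F \<alpha> x \<otimes>\<^bsub>hor F\<^esub> ?\<phi> t" for x t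
    by (simp_all add: eval_forest_def)
  have eval_Node: "eval_tree F \<alpha> (Node a t) = act F (\<alpha> a) (?\<phi> t)" for a t
    by (simp add: eval_forest_def)
  have closed_list: "?\<phi> t \<in> carrier (hor F)"
    if "\<And>x. x \<in> set t \<Longrightarrow> eval_tree F \<alpha> x \<in> carrier (hor F)" for t
    using that by (induction t) (auto simp: eval_Nil eval_Cons)
  have closed_tree: "set_tree x \<subseteq> A \<Longrightarrow> eval_tree F \<alpha> x \<in> carrier (hor F)" for x
  proof (induction x)
    case (Node a ts)
    have "?\<phi> ts \<in> carrier (hor F)" by (rule closed_list, rule Node.IH) (use Node.prems in auto)
    then show ?case using Node.prems letters[of a] by (simp add: eval_Node act_closed del: eval_tree.simps)
  qed
  have closed: "?\<phi> t \<in> carrier (hor F)" if "t \<in> forests A" for t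
    using that closed_tree by (intro closed_list) (auto simp: forests_def)
  have append: "?\<phi> (s @ t) = ?\<phi> s \<otimes>\<^bsub>hor F\<^esub> ?\<phi> t" if "s \<in> forests A" "t \<in> forests A" for s t
    using that(1)
  proof (induction s)
    case (Cons x s)
    then have "set_tree x \<subseteq> A" "s \<in> forests A" by (auto simp: forests_def)
    then show ?case using Cons.IH closed_tree[of x] closed[of s] closed[OF that(2)]
      by (simp add: eval_Cons H.m_assoc)
  qed (simp add: eval_Nil closed[OF that(2)])
  have closed_ctxt: "p \<in> contexts A \<Longrightarrow> ?\<psi> p \<in> carrier (ver F)" for p
  proof (induction p)
    case (Hole l r)
    then have "l \<in> forests A" "r \<in> forests A" by (auto simp: contexts_def forests_def)
    then show ?case by (simp add: inl_closed inr_closed closed)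
  next
    case (Nest l a c r)
    then have "l \<in> forests A" "r \<in> forests A" "a \<in> A" "c \<in> contexts A"
      by (auto simp: contexts_def forests_def)
    then show ?case using Nest.IH by (simp add: inl_closed inr_closed closed letters)
  qed
  have around: "act F (inl F g \<otimes>\<^bsub>ver F\<^esub> inr F g') h = g \<otimes>\<^bsub>hor F\<^esub> h \<otimes>\<^bsub>hor F\<^esub> g'"
    if "g \<in> carrier (hor F)" "g' \<in> carrier (hor F)" "h \<in> carrier (hor F)" for g g' h
    using that by (simp add: act_mult act_inl act_inr inl_closed inr_closed H.m_assoc)
  have act_plug: "?\<phi> (plug p t) = act F (?\<psi> p) (?\<phi> t)" if "p \<in> contexts A" "t \<in> forests A" for p t
    using that(1)
  proof (induction p)
    case (Hole l r)
    then have lr: "l \<in> forests A" "r \<in> forests A" by (auto simp: contexts_def forests_def)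
    moreover from this that(2) have "t @ r \<in> forests A" by (auto simp: forests_def)
    ultimately show ?case using that(2) by (simp add: append around closed H.m_assoc)
  next
    case (Nest l a c r)
    then have in_A: "l \<in> forests A" "r \<in> forests A" "a \<in> A" "c \<in> contexts A"
      by (auto simp: contexts_def forests_def)
    then have pl: "plug c t \<in> forests A" using that(2) by (simp add: plug_forests)
    with in_A have "Node a (plug c t) # r \<in> forests A" by (auto simp: forests_def)
    then show ?case
      using in_A that(2) Nest.IH pl
      by (simp add: append eval_Cons eval_Node around closed closed_ctxt letters act_closed act_mult
          act_inl act_inr inl_closed inr_closed H.m_assoc del: eval_tree.simps)
  qed
  have ctxt_eqI: "v = w" if "v \<in> carrier (ver F)" "w \<in> carrier (ver F)"
    "\<And>h. h \<in> carrier (hor F) \<Longrightarrow> act F v h = act F w h" for v w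
    using that by (rule faithful)
  have inl_mult: "inl F (g \<otimes>\<^bsub>hor F\<^esub> h) = inl F g \<otimes>\<^bsub>ver F\<^esub> inl F h"
    and inr_mult: "inr F (g \<otimes>\<^bsub>hor F\<^esub> h) = inr F h \<otimes>\<^bsub>ver F\<^esub> inr F g"
    and inl_inr: "inl F g \<otimes>\<^bsub>ver F\<^esub> inr F h = inr F h \<otimes>\<^bsub>ver F\<^esub> inl F g"
    if "g \<in> carrier (hor F)" "h \<in> carrier (hor F)" for g h
    using that
    by (auto intro!: ctxt_eqI simp: act_mult act_inl act_inr inl_closed inr_closed H.m_assoc)
  have inl_one: "inl F \<one>\<^bsub>hor F\<^esub> = \<one>\<^bsub>ver F\<^esub>" and inr_one: "inr F \<one>\<^bsub>hor F\<^esub> = \<one>\<^bsub>ver F\<^esub>"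
    by (auto intro!: ctxt_eqI simp: act_one act_inl act_inr inl_closed inr_closed)
  have around_mult: "inl F (?\<phi> (l @ l')) \<otimes>\<^bsub>ver F\<^esub> inr F (?\<phi> (r' @ r)) =
      (inl F (?\<phi> l) \<otimes>\<^bsub>ver F\<^esub> inr F (?\<phi> r)) \<otimes>\<^bsub>ver F\<^esub> (inl F (?\<phi> l') \<otimes>\<^bsub>ver F\<^esub> inr F (?\<phi> r'))"
    if "l \<in> forests A" "l' \<in> forests A" "r \<in> forests A" "r' \<in> forests A" for l l' r r'
    using that
    by (intro ctxt_eqI)
      (simp_all add: append act_inl act_inr act_mult inl_closed inr_closed closed H.m_assoc)
  have comp: "?\<psi> (ctxt_comp p q) = ?\<psi> p \<otimes>\<^bsub>ver F\<^esub> ?\<psi> q" if "p \<in> contexts A" "q \<in> contexts A" for p q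
    using that
  proof (induction p)
    case (Hole l r)
    then have lr: "l \<in> forests A" "r \<in> forests A" by (auto simp: contexts_def forests_def)
    show ?case
    proof (cases q)
      case (Hole l' r')
      then have "l' \<in> forests A" "r' \<in> forests A" using that(2) by (auto simp: contexts_def forests_def)
      then show ?thesis using lr Hole by (simp add: around_mult)
    next
      case (Nest l' a c r')
      then have "l' \<in> forests A" "r' \<in> forests A" "a \<in> A" "c \<in> contexts A"
        using that(2) by (auto simp: contexts_def forests_def)
      then show ?thesis using lr Nest
        by (simp add: around_mult inl_closed inr_closed closed letters closed_ctxt V.m_assoc)
    qed
  next
    case (Nest l a c r)
    then have "l \<in> forests A" "r \<in> forests A" "a \<in> A" "c \<in> contexts A"
      by (auto simp: contexts_def forests_def)
    then show ?case using Nest.IH that(2)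
      by (simp add: inl_closed inr_closed closed letters closed_ctxt V.m_assoc)
  qed
  show "forest_algebra_morphism (free_forest_algebra A) F ?\<phi> ?\<psi>"
    by (intro forest_algebra_morphism.intro forest_algebra_free \<open>forest_algebra F\<close>
        forest_algebra_morphism_axioms.intro homI)
      (simp_all add: free_forest_algebra_def closed append eval_Nil closed_ctxt comp act_plug
        inl_one inr_one inl_closed inr_closed)
  show "a \<in> A \<Longrightarrow> ?\<psi> (letter_ctxt a) = \<alpha> a"
    by (simp add: letter_ctxt_def eval_Nil inl_one inr_one letters)
qed

text \<open>
  Up to renaming, finite forest algebras have carriers \<open>{..<m}\<close> and \<open>{..<n}\<close>: these recognise all
  languages that are recognised by finite forest algebras.
\<close>

lemma recognizer_on_nat:
  fixes F :: "('h, 'v) forest_algebra"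
  assumes "forest_algebra_morphism (free_forest_algebra A) F \<phi> \<psi>"
    and fin: "finite (carrier (hor F))" "finite (carrier (ver F))" and X: "X \<subseteq> carrier (hor F)"
  shows "\<exists>m n (G :: (nat, nat) forest_algebra) \<phi>' \<psi>' Y.
    carrier (hor G) = {..<m} \<and> carrier (ver G) = {..<n} \<and>
    forest_algebra_morphism (free_forest_algebra A) G \<phi>' \<psi>' \<and> Y \<subseteq> carrier (hor G) \<and>
    {t \<in> forests A. \<phi>' t \<in> Y} = {t \<in> forests A. \<phi> t \<in> X}"
proof -
  interpret mor: forest_algebra_morphism "free_forest_algebra A" F \<phi> \<psi> by fact
  interpret H: monoid "hor F" by (rule mor.target.hor_monoid)
  interpret V: monoid "ver F" by (rule mor.target.ver_monoid)
  define m n where "m = card (carrier (hor F))" and "n = card (carrier (ver F))"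
  obtain e where e: "bij_betw e (carrier (hor F)) {..<m}"
    using ex_bij_betw_finite_nat[OF fin(1)] by (auto simp: m_def atLeast0LessThan)
  obtain f where f: "bij_betw f (carrier (ver F)) {..<n}"
    using ex_bij_betw_finite_nat[OF fin(2)] by (auto simp: n_def atLeast0LessThan)
  define e' f' where "e' = inv_into (carrier (hor F)) e" and "f' = inv_into (carrier (ver F)) f"
  have [simp]: "e h < m" "e' (e h) = h" if "h \<in> carrier (hor F)" for h
    using e that by (auto simp: e'_def bij_betw_def)
  have [simp]: "f v < n" "f' (f v) = v" if "v \<in> carrier (ver F)" for v
    using f that by (auto simp: f'_def bij_betw_def)
  have [simp]: "e' i \<in> carrier (hor F)" "e (e' i) = i" if "i < m" for i
    using e that by (auto simp: e'_def bij_betw_def f_inv_into_f inv_into_into)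
  have [simp]: "f' i \<in> carrier (ver F)" "f (f' i) = i" if "i < n" for i
    using f that by (auto simp: f'_def bij_betw_def f_inv_into_f inv_into_into)
  define G :: "(nat, nat) forest_algebra" where "G =
    \<lparr>hor = \<lparr>carrier = {..<m}, mult = (\<lambda>i j. e (e' i \<otimes>\<^bsub>hor F\<^esub> e' j)), one = e \<one>\<^bsub>hor F\<^esub>\<rparr>,
     ver = \<lparr>carrier = {..<n}, mult = (\<lambda>i j. f (f' i \<otimes>\<^bsub>ver F\<^esub> f' j)), one = f \<one>\<^bsub>ver F\<^esub>\<rparr>,
     act = (\<lambda>i j. e (act F (f' i) (e' j))),
     inl = (\<lambda>i. f (inl F (e' i))),
     inr = (\<lambda>i. f (inr F (e' i)))\<rparr>"
  note F_simps = mor.target.act_closed mor.target.act_one mor.target.act_mult mor.target.inl_closed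
    mor.target.inr_closed mor.target.act_inl mor.target.act_inr
  have G: "forest_algebra G"
  proof (rule forest_algebra.intro)
    show "monoid (hor G)" by (rule monoidI) (auto simp: G_def H.m_assoc)
    show "monoid (ver G)" by (rule monoidI) (auto simp: G_def V.m_assoc)
    show "v = w" if vw: "v \<in> carrier (ver G)" "w \<in> carrier (ver G)"
      and eq: "\<And>h. h \<in> carrier (hor G) \<Longrightarrow> act G v h = act G w h" for v w
    proof -
      have "v < n" "w < n" using vw by (auto simp: G_def)
      have "f' v = f' w"
      proof (rule mor.target.faithful)
        fix h assume h: "h \<in> carrier (hor F)"
        then have "e (act F (f' v) h) = e (act F (f' w) h)"
          using eq[of "e h"] by (simp add: G_def)
        then have "e' (e (act F (f' v) h)) = e' (e (act F (f' w) h))" by simp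
        then show "act F (f' v) h = act F (f' w) h"
          using h \<open>v < n\<close> \<open>w < n\<close> by (simp add: F_simps)
      qed (use \<open>v < n\<close> \<open>w < n\<close> in simp_all)
      then have "f (f' v) = f (f' w)" by simp
      then show ?thesis using \<open>v < n\<close> \<open>w < n\<close> by simp
    qed
  qed (auto simp: G_def F_simps)
  have "forest_algebra_morphism (free_forest_algebra A) G (e \<circ> \<phi>) (f \<circ> \<psi>)"
    by (intro forest_algebra_morphism.intro forest_algebra_free G
        forest_algebra_morphism_axioms.intro homI)
      (auto simp: G_def mor.morph_act mor.morph_inl mor.morph_inr mor.hor_one mor.ver_one
        hom_in_carrier[OF mor.hor_hom] hom_in_carrier[OF mor.ver_hom]
        hom_mult[OF mor.hor_hom] hom_mult[OF mor.ver_hom])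
  moreover have "{t \<in> forests A. (e \<circ> \<phi>) t \<in> e ` X} = {t \<in> forests A. \<phi> t \<in> X}"
  proof -
    have "\<phi> t \<in> carrier (hor F)" if "t \<in> forests A" for t
      using hom_in_carrier[OF mor.hor_hom, of t] that by (simp add: free_forest_algebra_def)
    then have "e (\<phi> t) \<in> e ` X \<longleftrightarrow> \<phi> t \<in> X" if "t \<in> forests A" for t
      using inj_on_image_mem_iff[OF bij_betw_imp_inj_on[OF e] _ X] that by blast
    then show ?thesis by auto
  qed
  moreover have "carrier (hor G) = {..<m}" "carrier (ver G) = {..<n}" "e ` X \<subseteq> carrier (hor G)"
    using X by (auto simp: G_def)
  ultimately show ?thesis by blast
qed

section \<open>Recursive functions\<close>

text \<open>
  The total recursive functions in Kleene's sense: \<open>recursive n f\<close> says that \<open>f\<close>, read as a function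
  of argument lists of length \<open>n\<close>, is obtained from the initial functions by composition, primitive
  recursion (on the first argument) and minimisation of total functions that always have a zero.
  Values on lists of other lengths carry no meaning.
\<close>

inductive recursive :: "nat \<Rightarrow> (nat list \<Rightarrow> nat) \<Rightarrow> bool" where
  zero: "recursive n (\<lambda>xs. 0)"
| succ: "recursive 1 (\<lambda>xs. Suc (hd xs))"
| proj: "i < n \<Longrightarrow> recursive n (\<lambda>xs. xs ! i)"
| comp: "\<lbrakk>recursive (length gs) f; \<forall>g\<in>set gs. recursive n g\<rbrakk>
    \<Longrightarrow> recursive n (\<lambda>xs. f (map (\<lambda>g. g xs) gs))"
| prim_rec: "\<lbrakk>recursive n f; recursive (Suc (Suc n)) g\<rbrakk>
    \<Longrightarrow> recursive (Suc n) (\<lambda>xs. rec_nat (f (tl xs)) (\<lambda>y r. g (y # r # tl xs)) (hd xs))"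
| minimise: "\<lbrakk>recursive (Suc n) f; \<forall>xs. length xs = n \<longrightarrow> (\<exists>y. f (y # xs) = 0)\<rbrakk>
    \<Longrightarrow> recursive n (\<lambda>xs. LEAST y. f (y # xs) = 0)"


section \<open>Input format\<close>

text \<open>
  A forest algebra with carriers \<open>{..<m}\<close> and \<open>{..<n}\<close>, a morphism into it from the free forest algebra
  over \<open>{..<k}\<close>, and an accepting set \<open>X\<close> are presented by the tables of all operations, the values of
  the morphism on the contexts \<open>a\<box>\<close>, and the indicator table of \<open>X\<close>.
\<close>

definition table :: "nat \<Rightarrow> (nat \<Rightarrow> nat) \<Rightarrow> nat" where
  "table n f = list_encode (map f [0..<n])"

definition table2 :: "nat \<Rightarrow> nat \<Rightarrow> (nat \<Rightarrow> nat \<Rightarrow> nat) \<Rightarrow> nat" where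
  "table2 m n f = table m (\<lambda>i. table n (f i))"

definition recognizer_code ::
  "nat \<Rightarrow> nat \<Rightarrow> nat \<Rightarrow> (nat, nat) forest_algebra \<Rightarrow> (nat ctxt \<Rightarrow> nat) \<Rightarrow> nat set \<Rightarrow> nat" where
  "recognizer_code k m n F \<psi> X = list_encode
     [k, m, n,
      table2 m m (\<lambda>g h. g \<otimes>\<^bsub>hor F\<^esub> h), \<one>\<^bsub>hor F\<^esub>,
      table2 n n (\<lambda>v w. v \<otimes>\<^bsub>ver F\<^esub> w), \<one>\<^bsub>ver F\<^esub>,
      table2 n m (act F), table m (inl F), table m (inr F),
      table k (\<lambda>a. \<psi> (letter_ctxt a)),
      table m (\<lambda>h. if h \<in> X then 1 else 0)]"

end

theory Submission
  imports Defs "HOL-Library.Ramsey"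
begin

text \<open>
  On a well-quasi-order, a function is determined by finitely many tests \<open>z \<preceq> x\<close> as soon as it is
  constant on a nonempty upper part of every order ideal. By Kruskal's theorem this applies to the piece
  order on forests, so piecewise testability of \<open>L\<close> follows if the syntactic class is eventually constant
  on each ideal \<open>D\<close>. Suppose the syntactic algebra satisfies \<open>e u = e = u e\<close> for all idempotents \<open>e\<close> and
  pieces \<open>u\<close> of \<open>e\<close>. If \<open>D\<close> is closed under concatenation, these identities identify all sufficiently large
  elements of \<open>D\<close>. Otherwise some \<open>x \<in> D\<close> has \<open>xx \<notin> D\<close>; in a forest of \<open>D\<close>, the nodes whose subtrees contain
  \<open>x\<close> then form a path, so \<open>D\<close> is composed of contexts and forests whose parts off the path lie in the
  smaller set of forests in \<open>D\<close> that do not contain \<open>x\<close>, and well-founded induction applies (ideals of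
  contexts are treated alike). Conversely, for \<open>k\<close> large, \<open>p e\<^sup>k u t\<close> lies between \<open>p e\<^sup>k t\<close> and
  \<open>p e\<^sup>k\<^sup>+\<^sup>1 t\<close>, which have the same small pieces, so piecewise testable languages satisfy the identities.

  The identities hold iff they hold on some relation on \<open>V\<close> that is closed under the rules generating
  the piece order of contexts; such a relation is found by bounded search.
\<close>

section \<open>Well-quasi-orders and tame functions\<close>

text \<open>Two obstacles shape the details. First, the given algebra need not be the syntactic one
  and its morphism need not be onto. Each argument therefore carries two maps: \<open>\<phi>\<close>
  and \<open>\<psi>\<close>, which have finite images and in which idempotents are found, and the
  coarser syntactic classes, in which alone the identities hold. Second, an element of an ideal
  above a product \<open>q1 q2\<close> need not factor into something above \<open>q1\<close> and
  something above \<open>q2\<close>, since both factors may embed into one tree. The identities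
  become applicable only where such a factorization is forced: by a letter on the path for contexts,
  by a forest that fits into no single tree of the ideal for forests. This is why ideals closed
  under concatenation still fall into cases, according to the letters under which they are closed.
  The effective part does not compute the least closed relation on V: a bounded existential
  quantifier over codes of relations requires no program, only closure of the recursive functions
  under bounded quantification.\<close>

definition almost_full :: "('a \<Rightarrow> 'a \<Rightarrow> bool) \<Rightarrow> 'a set \<Rightarrow> bool" where
  "almost_full leq S \<longleftrightarrow> (\<forall>f :: nat \<Rightarrow> 'a. range f \<subseteq> S \<longrightarrow> (\<exists>i j. i < j \<and> leq (f i) (f j)))"

lemma almost_fullI:
  assumes "\<And>f :: nat \<Rightarrow> 'a. range f \<subseteq> S \<Longrightarrow> (\<And>i j. i < j \<Longrightarrow> \<not> leq (f i) (f j)) \<Longrightarrow> False"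
  shows "almost_full leq S"
  using assms unfolding almost_full_def by meson

lemma almost_full_subset: "almost_full leq S \<Longrightarrow> T \<subseteq> S \<Longrightarrow> almost_full leq T"
  unfolding almost_full_def by (meson order_trans)

lemma almost_full_ascending:
  assumes af: "almost_full leq S" and f: "range f \<subseteq> S"
  shows "\<exists>g :: nat \<Rightarrow> nat. strict_mono g \<and> (\<forall>i j. i < j \<longrightarrow> leq (f (g i)) (f (g j)))"
proof -
  \<comment> \<open>The colour of a pair of indices records whether the earlier value lies below the
    later one. Ramsey gives an infinite set with a single colour; almost fullness provides a good
    pair inside it, so that colour is 0.\<close>
  define c where "c X = (if leq (f (Min X)) (f (Max X)) then 0 else 1 :: nat)" for X
  have "\<forall>x\<in>UNIV. \<forall>y\<in>UNIV. x \<noteq> y \<longrightarrow> c {x, y} < 2" by (simp add: c_def)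
  then obtain Y t where Y: "infinite Y" "\<forall>x\<in>Y. \<forall>y\<in>Y. x \<noteq> y \<longrightarrow> c {x, y} = t"
    using Ramsey2[of "UNIV :: nat set" c 2] by blast
  define g where "g = enumerate Y"
  have g: "strict_mono g" "\<And>i. g i \<in> Y"
    using Y(1) by (simp_all add: g_def strict_mono_enumerate enumerate_in_set)
  have c: "c {g i, g j} = t" and *: "c {g i, g j} = (if leq (f (g i)) (f (g j)) then 0 else 1)"
    if "i < j" for i j
  proof -
    have "g i < g j" using g(1) that by (simp add: strict_mono_less)
    then show "c {g i, g j} = t" by (intro Y(2)[rule_format] g(2)) simp
    show "c {g i, g j} = (if leq (f (g i)) (f (g j)) then 0 else 1)"
      using \<open>g i < g j\<close> by (simp add: c_def)
  qed
  have "range (f \<circ> g) \<subseteq> S" using f by auto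
  then obtain i j where "i < j" "leq (f (g i)) (f (g j))"
    using af unfolding almost_full_def by (metis comp_apply)
  then have "t = 0" using c[of i j] *[of i j] by simp
  then have "leq (f (g i)) (f (g j))" if "i < j" for i j
    using c[OF that] *[OF that] by (simp split: if_splits)
  with g(1) show ?thesis by blast
qed

lemma almost_full_Times:
  assumes "almost_full le1 S" "almost_full le2 T"
  shows "almost_full (\<lambda>x y. le1 (fst x) (fst y) \<and> le2 (snd x) (snd y)) (S \<times> T)"
proof (rule almost_fullI)
  fix f :: "nat \<Rightarrow> 'a \<times> 'b"
  assume f: "range f \<subseteq> S \<times> T"
    and bad: "\<And>i j. i < j \<Longrightarrow> \<not> (le1 (fst (f i)) (fst (f j)) \<and> le2 (snd (f i)) (snd (f j)))"
  from f have ranges: "range (fst \<circ> f) \<subseteq> S" "range (snd \<circ> f) \<subseteq> T"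
    by (simp_all add: image_subset_iff mem_Times_iff)
  from almost_full_ascending[OF assms(1) ranges(1)] obtain g :: "nat \<Rightarrow> nat" where
    g: "strict_mono g \<and> (\<forall>i j. i < j \<longrightarrow> le1 ((fst \<circ> f) (g i)) ((fst \<circ> f) (g j)))" ..
  have "range (snd \<circ> f \<circ> g) \<subseteq> T" using ranges(2) by auto
  then obtain i j where "i < j" "le2 ((snd \<circ> f \<circ> g) i) ((snd \<circ> f \<circ> g) j)"
    using assms(2) unfolding almost_full_def by meson
  then show False using bad[of "g i" "g j"] g by (auto simp: strict_mono_less)
qed

lemma almost_full_Un:
  assumes "almost_full leq S" "almost_full leq T"
  shows "almost_full leq (S \<union> T)"
proof (rule almost_fullI)
  fix f :: "nat \<Rightarrow> 'a"
  assume f: "range f \<subseteq> S \<union> T" and bad: "\<And>i j. i < j \<Longrightarrow> \<not> leq (f i) (f j)"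
  have "f -` S \<union> f -` T = UNIV" using f by auto
  then have "infinite (f -` S) \<or> infinite (f -` T)"
    using finite_Un[of "f -` S" "f -` T"] by auto
  then obtain U where U: "U = S \<or> U = T" "infinite (f -` U)" by blast
  have "almost_full leq U" using U(1) assms by auto
  moreover have "range (f \<circ> enumerate (f -` U)) \<subseteq> U"
    using U(2) enumerate_in_set by fastforce
  ultimately obtain i j where "i < j" "leq (f (enumerate (f -` U) i)) (f (enumerate (f -` U) j))"
    unfolding almost_full_def by (metis comp_apply)
  then show False using bad U(2) by (meson enumerate_mono)
qed

lemma almost_full_finite:
  assumes "finite S" shows "almost_full (=) S"
proof (rule almost_fullI)
  fix f :: "nat \<Rightarrow> 'a"
  assume f: "range f \<subseteq> S" and bad: "\<And>i j. i < j \<Longrightarrow> f i \<noteq> f j"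
  then have "inj f" by (metis injI linorder_less_linear)
  then show False using f assms by (meson finite_imageD finite_subset infinite_UNIV_nat)
qed

text \<open>Nash-Williams' minimal bad sequence argument, kept apart from the data type because
  forests and contexts both use it. The parts \<open>y\<close> must lie below a member of the
  sequence and not only be smaller: transitivity through that member keeps the spliced sequence
  bad.\<close>

lemma almost_full_by_parts:
  fixes size_of :: "'a \<Rightarrow> nat"
  assumes trans: "\<And>x y z. leq x y \<Longrightarrow> leq y z \<Longrightarrow> leq x z"
    and step: "\<And>f :: nat \<Rightarrow> 'a. range f \<subseteq> S \<Longrightarrow>
      almost_full leq {y \<in> S. \<exists>i. size_of y < size_of (f i) \<and> leq y (f i)} \<Longrightarrow>
      \<exists>i j. i < j \<and> leq (f i) (f j)"
  shows "almost_full leq S"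
proof (rule ccontr)
  define bad where "bad f \<longleftrightarrow> range f \<subseteq> S \<and> (\<forall>i j. i < j \<longrightarrow> \<not> leq (f i) (f j))" for f :: "nat \<Rightarrow> 'a"
  assume "\<not> almost_full leq S"
  then obtain f0 where f0: "bad f0" unfolding almost_full_def bad_def by blast
  \<comment> \<open>\<open>F n\<close> is a bad sequence whose first \<open>n\<close> entries are
    final; \<open>F (Suc n)\<close> minimises the size of entry \<open>n\<close> among the bad
    sequences that share them. The diagonal is the minimal bad sequence.\<close>
  have "\<exists>F. \<forall>n. bad (F n) \<and> ((\<forall>i<n. F (Suc n) i = F n i) \<and>
      (\<forall>h. bad h \<longrightarrow> (\<forall>i<n. h i = F n i) \<longrightarrow> size_of (F (Suc n) n) \<le> size_of (h n)))"
  proof (rule dependent_nat_choice)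
    fix f n assume f: "bad f"
    define Q where "Q h \<longleftrightarrow> bad h \<and> (\<forall>i<n. h i = f i)" for h
    have "Q f" using f by (simp add: Q_def)
    then obtain h where "Q h" "\<forall>h'. Q h' \<longrightarrow> size_of (h n) \<le> size_of (h' n)"
      using ex_has_least_nat[of Q f "\<lambda>h. size_of (h n)"] by blast
    then show "\<exists>h. bad h \<and> ((\<forall>i<n. h i = f i) \<and>
        (\<forall>h'. bad h' \<longrightarrow> (\<forall>i<n. h' i = f i) \<longrightarrow> size_of (h n) \<le> size_of (h' n)))"
      unfolding Q_def by blast
  qed (use f0 in blast)
  then obtain F where F: "\<And>n. bad (F n)" "\<And>n i. i < n \<Longrightarrow> F (Suc n) i = F n i"
    "\<And>n h. bad h \<Longrightarrow> \<forall>i<n. h i = F n i \<Longrightarrow> size_of (F (Suc n) n) \<le> size_of (h n)"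
    by blast
  define f where "f i = F (Suc i) i" for i
  have F_f: "F n i = f i" if "i < n" for n i
    using that
  proof (induction n)
    case (Suc n)
    then show ?case by (cases "i = n") (auto simp: f_def F(2))
  qed simp
  have "bad f"
    unfolding bad_def
  proof (intro conjI allI impI)
    show "range f \<subseteq> S" using F(1) by (auto simp: f_def bad_def)
    fix i j :: nat assume "i < j"
    have "\<not> leq (F (Suc j) i) (F (Suc j) j)"
      using F(1)[of "Suc j", unfolded bad_def] \<open>i < j\<close> by blast
    with \<open>i < j\<close> show "\<not> leq (f i) (f j)" by (simp add: F_f)
  qed
  have min: "size_of (f n) \<le> size_of (h n)" if "bad h" "\<And>i. i < n \<Longrightarrow> h i = f i" for n h
  proof -
    have "\<forall>i<n. h i = F n i" using that(2) F_f by simp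
    from F(3)[OF that(1) this] show ?thesis unfolding f_def .
  qed
  let ?B = "{y \<in> S. \<exists>i. size_of y < size_of (f i) \<and> leq y (f i)}"
  have "almost_full leq ?B"
  proof (rule almost_fullI)
    fix g :: "nat \<Rightarrow> 'a"
    assume g: "range g \<subseteq> ?B" and g_bad: "\<And>i j. i < j \<Longrightarrow> \<not> leq (g i) (g j)"
    then have "\<forall>j. \<exists>i. size_of (g j) < size_of (f i) \<and> leq (g j) (f i)" by auto
    then obtain k where k: "\<And>j. size_of (g j) < size_of (f (k j)) \<and> leq (g j) (f (k j))"
      by metis
    \<comment> \<open>With \<open>k j0\<close> least, every later \<open>g j\<close> is a part of
      some \<open>f (k j)\<close> with \<open>k j0 \<le> k j\<close>, so no entry of
      \<open>f\<close> before position \<open>k j0\<close> lies below it. Prefixing these entries to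
      \<open>g\<close> from \<open>j0\<close> on gives a bad sequence with a smaller entry at
      \<open>k j0\<close>.\<close>
    obtain j0 where j0: "\<And>j. k j0 \<le> k j"
      using ex_has_least_nat[of "\<lambda>_. True" 0 k] by auto
    define h where "h i = (if i < k j0 then f i else g (j0 + (i - k j0)))" for i
    have "bad h"
      unfolding bad_def
    proof (intro conjI allI impI)
      show "range h \<subseteq> S" using \<open>bad f\<close> g by (auto simp: h_def bad_def)
      fix i j :: nat assume ij: "i < j"
      consider "j < k j0" | "i < k j0" "k j0 \<le> j" | "k j0 \<le> i" by linarith
      then show "\<not> leq (h i) (h j)"
      proof cases
        case 1
        then show ?thesis using ij \<open>bad f\<close> by (simp add: h_def bad_def)
      next
        case 2
        let ?m = "j0 + (j - k j0)"
        have "i < k ?m" using 2(1) j0[of ?m] by linarith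
        then have "\<not> leq (f i) (f (k ?m))" using \<open>bad f\<close> by (simp add: bad_def)
        then have "\<not> leq (f i) (g ?m)" using trans k[of ?m] by blast
        then show ?thesis using 2 by (simp add: h_def)
      next
        case 3
        then show ?thesis using ij g_bad by (simp add: h_def)
      qed
    qed
    then have "size_of (f (k j0)) \<le> size_of (h (k j0))" by (rule min) (simp add: h_def)
    then show False using k[of j0] by (simp add: h_def)
  qed
  then show False using step[of f] \<open>bad f\<close> unfolding bad_def by blast
qed

section \<open>Down-closed sets, ideals and eventual constancy\<close>

definition down_closed :: "('a \<Rightarrow> 'a \<Rightarrow> bool) \<Rightarrow> 'a set \<Rightarrow> bool" where
  "down_closed leq D \<longleftrightarrow> (\<forall>y\<in>D. \<forall>x. leq x y \<longrightarrow> x \<in> D)"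

lemma down_closedD: "down_closed leq D \<Longrightarrow> y \<in> D \<Longrightarrow> leq x y \<Longrightarrow> x \<in> D"
  unfolding down_closed_def by blast

definition order_ideal :: "('a \<Rightarrow> 'a \<Rightarrow> bool) \<Rightarrow> 'a set \<Rightarrow> bool" where
  "order_ideal leq D \<longleftrightarrow> D \<noteq> {} \<and> down_closed leq D \<and> (\<forall>x\<in>D. \<forall>y\<in>D. \<exists>z\<in>D. leq x z \<and> leq y z)"

lemma order_ideal_down_closed: "order_ideal leq D \<Longrightarrow> down_closed leq D"
  unfolding order_ideal_def by blast

definition eventually_constant :: "('a \<Rightarrow> 'a \<Rightarrow> bool) \<Rightarrow> ('a \<Rightarrow> 'b) \<Rightarrow> 'a set \<Rightarrow> bool" where
  "eventually_constant leq f D \<longleftrightarrow> (\<exists>x\<in>D. \<forall>y\<in>D. leq x y \<longrightarrow> f y = f x)"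

text \<open>
  On a well-quasi-order, a function is tame iff it is continuous on the compact space of order ideals;
  this is how piecewise testability enters without counting pieces.
\<close>

definition tame :: "('a \<Rightarrow> 'a \<Rightarrow> bool) \<Rightarrow> ('a \<Rightarrow> 'b) \<Rightarrow> 'a set \<Rightarrow> bool" where
  "tame leq f S \<longleftrightarrow> (\<forall>D\<subseteq>S. order_ideal leq D \<longrightarrow> eventually_constant leq f D)"

lemma tameI: "(\<And>D. D \<subseteq> S \<Longrightarrow> order_ideal leq D \<Longrightarrow> eventually_constant leq f D) \<Longrightarrow> tame leq f S"
  unfolding tame_def by blast

lemma tameD: "tame leq f S \<Longrightarrow> D \<subseteq> S \<Longrightarrow> order_ideal leq D \<Longrightarrow> eventually_constant leq f D"
  unfolding tame_def by blast

locale well_quasi_order =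
  fixes leq :: "'a \<Rightarrow> 'a \<Rightarrow> bool" and S :: "'a set"
  assumes refl: "x \<in> S \<Longrightarrow> leq x x"
    and trans: "leq x y \<Longrightarrow> leq y z \<Longrightarrow> leq x z"
    and down: "down_closed leq S"
    and almost_full: "almost_full leq S"
begin

lemma subset: "down_closed leq D \<Longrightarrow> D \<subseteq> S \<Longrightarrow> well_quasi_order leq D"
  using refl trans almost_full_subset[OF almost_full] by unfold_locales blast+

lemma down_closed_minus_above: "down_closed leq D \<Longrightarrow> down_closed leq {y \<in> D. \<not> leq x y}"
  using trans unfolding down_closed_def by blast

text \<open>In a strictly descending chain of down-closed sets, the elements \<open>x i\<close>
  dropped at stage \<open>i\<close> contain a pair \<open>x i\<close> below \<open>x j\<close> with
  \<open>i < j\<close>. Then \<open>x j\<close> still belongs to stage \<open>Suc i\<close>, which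
  is down-closed and so would contain \<open>x i\<close>.\<close>

lemma down_closed_induct [consumes 2, case_names less]:
  assumes "down_closed leq D" "D \<subseteq> S"
    and step: "\<And>D. down_closed leq D \<Longrightarrow> D \<subseteq> S \<Longrightarrow>
      (\<And>E. down_closed leq E \<Longrightarrow> E \<subset> D \<Longrightarrow> P E) \<Longrightarrow> P D"
  shows "P D"
proof -
  define R where "R = {(E, D). down_closed leq E \<and> down_closed leq D \<and> D \<subseteq> S \<and> E \<subset> D}"
  have "wf R"
    unfolding wf_iff_no_infinite_down_chain
  proof
    assume "\<exists>D. \<forall>i. (D (Suc i), D i) \<in> R"
    then obtain D where D: "\<And>i. (D (Suc i), D i) \<in> R" by blast
    then have "\<forall>i. \<exists>x. x \<in> D i - D (Suc i)" unfolding R_def by blast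
    then obtain x where x: "\<And>i. x i \<in> D i - D (Suc i)" by metis
    have "D i \<subseteq> S" for i using D[of i] by (auto simp: R_def)
    then have "range x \<subseteq> S" using x by blast
    then obtain i j where ij: "i < j" "leq (x i) (x j)"
      using almost_full unfolding almost_full_def by blast
    have "D (Suc n) \<subseteq> D n" for n using D[of n] by (auto simp: R_def)
    then have "D j \<subseteq> D (Suc i)" using lift_Suc_antimono_le[of D "Suc i" j] ij(1) by simp
    then have "x j \<in> D (Suc i)" using x by blast
    then have "x i \<in> D (Suc i)" using D[of i] ij(2) by (auto simp: R_def dest: down_closedD)
    then show False using x by blast
  qed
  then have "down_closed leq D \<longrightarrow> D \<subseteq> S \<longrightarrow> P D"
  proof (induction D)
    case (less D)
    then show ?case using step[of D] unfolding R_def by (auto intro: order_trans)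
  qed
  then show ?thesis using assms(1,2) by blast
qed

text \<open>In an ideal, testing the point \<open>x0\<close> of eventual constancy settles the upper
  part and leaves the smaller set of elements not above \<open>x0\<close>. A nonempty set that is
  not directed has \<open>u\<close>, \<open>v\<close> without a common upper bound, so each element
  avoids one of them, and testing both reduces to two smaller sets.\<close>

lemma tame_finite_test:
  assumes "tame leq f S"
  shows "\<exists>F. finite F \<and> F \<subseteq> S \<and> (\<forall>x\<in>S. \<forall>y\<in>S. (\<forall>z\<in>F. leq z x \<longleftrightarrow> leq z y) \<longrightarrow> f x = f y)"
  using down order_refl
proof (induction S rule: down_closed_induct)
  case (less D)
  show ?case
  proof (cases "order_ideal leq D")
    case True
    with assms less.hyps obtain x0 where x0: "x0 \<in> D" "\<And>y. y \<in> D \<Longrightarrow> leq x0 y \<Longrightarrow> f y = f x0"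
      unfolding tame_def eventually_constant_def by blast
    let ?E = "{y \<in> D. \<not> leq x0 y}"
    have "?E \<subset> D" using x0(1) refl less.hyps by blast
    from less.IH[OF down_closed_minus_above[OF less.hyps(1)] this] obtain F where
      "finite F \<and> F \<subseteq> ?E \<and>
        (\<forall>x\<in>?E. \<forall>y\<in>?E. (\<forall>z\<in>F. leq z x \<longleftrightarrow> leq z y) \<longrightarrow> f x = f y)" ..
    then have F: "finite F" "F \<subseteq> ?E"
      "\<forall>x\<in>?E. \<forall>y\<in>?E. (\<forall>z\<in>F. leq z x \<longleftrightarrow> leq z y) \<longrightarrow> f x = f y" by blast+
    have *: "f x = f y" if "x \<in> D" "y \<in> D" "\<forall>z\<in>insert x0 F. leq z x \<longleftrightarrow> leq z y" for x y
    proof (cases "leq x0 x")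
      case True
      then show ?thesis using that x0(2)[of x] x0(2)[of y] by simp
    next
      case False
      then show ?thesis using that F(3) by blast
    qed
    have "finite (insert x0 F)" "insert x0 F \<subseteq> D" using F(1,2) x0(1) by auto
    with * show ?thesis by (intro exI conjI ballI impI) assumption+
  next
    case False
    show ?thesis
    proof (cases "D = {}")
      case False
      with \<open>\<not> order_ideal leq D\<close> less.hyps obtain u v where uv: "u \<in> D" "v \<in> D"
        "\<And>z. z \<in> D \<Longrightarrow> \<not> (leq u z \<and> leq v z)"
        unfolding order_ideal_def by blast
      have small: "\<exists>F. finite F \<and> F \<subseteq> D \<and> (\<forall>x\<in>D. \<forall>y\<in>D. \<not> leq w x \<longrightarrow> \<not> leq w y \<longrightarrow>
          (\<forall>z\<in>F. leq z x \<longleftrightarrow> leq z y) \<longrightarrow> f x = f y)" if "w \<in> D" for w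
      proof -
        let ?E = "{y \<in> D. \<not> leq w y}"
        have "?E \<subset> D" using that refl less.hyps by blast
        from less.IH[OF down_closed_minus_above[OF less.hyps(1)] this] obtain F where
          "finite F \<and> F \<subseteq> ?E \<and>
            (\<forall>x\<in>?E. \<forall>y\<in>?E. (\<forall>z\<in>F. leq z x \<longleftrightarrow> leq z y) \<longrightarrow> f x = f y)" ..
        then have F: "finite F" "F \<subseteq> ?E"
          "\<forall>x\<in>?E. \<forall>y\<in>?E. (\<forall>z\<in>F. leq z x \<longleftrightarrow> leq z y) \<longrightarrow> f x = f y" by blast+
        then show ?thesis by (intro exI[of _ F]) blast
      qed
      obtain F where F: "finite F" "F \<subseteq> D" "\<And>x y. x \<in> D \<Longrightarrow> y \<in> D \<Longrightarrow> \<not> leq u x \<Longrightarrow> \<not> leq u y \<Longrightarrow>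
          (\<forall>z\<in>F. leq z x \<longleftrightarrow> leq z y) \<Longrightarrow> f x = f y"
        using small[OF uv(1)] by blast
      obtain G where G: "finite G" "G \<subseteq> D" "\<And>x y. x \<in> D \<Longrightarrow> y \<in> D \<Longrightarrow> \<not> leq v x \<Longrightarrow> \<not> leq v y \<Longrightarrow>
          (\<forall>z\<in>G. leq z x \<longleftrightarrow> leq z y) \<Longrightarrow> f x = f y"
        using small[OF uv(2)] by blast
      have *: "f x = f y" if "x \<in> D" "y \<in> D" "\<forall>z\<in>insert u (insert v (F \<union> G)). leq z x \<longleftrightarrow> leq z y" for x y
        using that uv(3)[of x] F(3)[of x y] G(3)[of x y] by blast
      have "finite (insert u (insert v (F \<union> G)))" "insert u (insert v (F \<union> G)) \<subseteq> D"
        using F(1,2) G(1,2) uv(1,2) by auto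
      with * show ?thesis by (intro exI conjI ballI impI) assumption+
    qed auto
  qed
qed

end

text \<open>Ideals are irreducible: a point outside \<open>E\<close> and a point outside
  \<open>D\<close> would have a common upper bound in one of the two sets, which by down-closure
  would contain both points.\<close>

lemma order_ideal_Un:
  assumes "order_ideal leq (D \<union> E)" "down_closed leq D" "down_closed leq E"
  shows "D \<union> E = D \<or> D \<union> E = E"
proof (rule ccontr)
  assume "\<not> ?thesis"
  then obtain x y where "x \<in> D" "x \<notin> E" "y \<in> E" "y \<notin> D" by blast
  moreover from this assms(1) obtain z where "z \<in> D \<union> E" "leq x z" "leq y z"
    unfolding order_ideal_def by blast
  ultimately show False using assms(2,3) by (auto dest: down_closedD)
qed

lemma order_ideal_finite_bound:
  assumes "order_ideal leq P" "finite F" "F \<subseteq> P" and trans: "\<And>x y z. leq x y \<Longrightarrow> leq y z \<Longrightarrow> leq x z"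
  shows "\<exists>z\<in>P. \<forall>x\<in>F. leq x z"
  using assms(2,3)
proof (induction F)
  case empty
  then show ?case using assms(1) unfolding order_ideal_def by blast
next
  case (insert x F)
  then obtain z where "z \<in> P" "\<forall>x\<in>F. leq x z" by blast
  moreover from this insert.prems obtain z' where "z' \<in> P" "leq x z'" "leq z z'"
    using assms(1) unfolding order_ideal_def by blast
  ultimately show ?case using trans by blast
qed

text \<open>
  A least down-closed set of pairs with image \<open>D\<close> is directed, hence a product of two ideals.
\<close>

lemma tame_image2:
  fixes le1 :: "'a \<Rightarrow> 'a \<Rightarrow> bool" and le2 :: "'b \<Rightarrow> 'b \<Rightarrow> bool" and le3 :: "'c \<Rightarrow> 'c \<Rightarrow> bool"
  assumes Y: "well_quasi_order le1 Y" and Z: "well_quasi_order le2 Z"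
    and mono: "\<And>y y' z z'. y' \<in> Y \<Longrightarrow> z' \<in> Z \<Longrightarrow> le1 y y' \<Longrightarrow> le2 z z' \<Longrightarrow> le3 (f y z) (f y' z')"
    and split: "\<And>s y z. y \<in> Y \<Longrightarrow> z \<in> Z \<Longrightarrow> le3 s (f y z) \<Longrightarrow> \<exists>y' z'. s = f y' z' \<and> le1 y' y \<and> le2 z' z"
    and val: "\<And>y y' z z'. \<lbrakk>y \<in> Y; y' \<in> Y; z \<in> Z; z' \<in> Z; \<alpha> y = \<alpha> y'; \<beta> z = \<beta> z'\<rbrakk> \<Longrightarrow>
      \<gamma> (f y z) = \<gamma> (f y' z')"
    and tame: "tame le1 \<alpha> Y" "tame le2 \<beta> Z"
    and sub: "T \<subseteq> (\<lambda>(y, z). f y z) ` (Y \<times> Z)"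
  shows "tame le3 \<gamma> T"
proof (rule tameI)
  interpret Y: well_quasi_order le1 Y by fact
  interpret Z: well_quasi_order le2 Z by fact
  define leq where "leq = (\<lambda>p q. le1 (fst p) (fst q) \<and> le2 (snd p) (snd q))"
  interpret P: well_quasi_order leq "Y \<times> Z"
  proof
    show "almost_full leq (Y \<times> Z)"
      using almost_full_Times[OF Y.almost_full Z.almost_full] by (simp add: leq_def)
    show "down_closed leq (Y \<times> Z)"
      using Y.down Z.down unfolding down_closed_def leq_def by (simp add: mem_Times_iff)
  qed (auto simp: leq_def Y.refl Z.refl intro: Y.trans Z.trans)
  fix D assume D: "D \<subseteq> T" "order_ideal le3 D"
  define F where "F M = (\<lambda>(y, z). f y z) ` M" for M
  \<comment> \<open>Shrink \<open>M0\<close> until no proper down-closed subset has image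
    \<open>D\<close>. Were the result not directed, it would split into the pairs not above
    \<open>u\<close> and those not above \<open>v\<close>; their images are down-closed with union
    \<open>D\<close>, so by irreducibility one of them is already \<open>D\<close>.\<close>
  have ideal_pair: "\<exists>M \<subseteq> Y \<times> Z. order_ideal leq M \<and> F M = D \<and> (\<forall>E. down_closed leq E \<longrightarrow> E \<subset> M \<longrightarrow> F E \<noteq> D)"
    if "down_closed leq M0" "M0 \<subseteq> Y \<times> Z" "F M0 = D" for M0
    using that
  proof (induction M0 rule: P.down_closed_induct)
    case (less M)
    show ?case
    proof (cases "\<exists>E. down_closed leq E \<and> E \<subset> M \<and> F E = D")
      case True
      then show ?thesis using less.IH by blast
    next
      case False
      have "order_ideal leq M"
      proof (rule ccontr)
        assume "\<not> order_ideal leq M"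
        have "M \<noteq> {}" using less.prems D(2) by (auto simp: order_ideal_def F_def)
        with \<open>\<not> order_ideal leq M\<close> less.hyps obtain u v where uv: "u \<in> M" "v \<in> M"
          "\<And>z. z \<in> M \<Longrightarrow> \<not> (leq u z \<and> leq v z)"
          unfolding order_ideal_def by blast
        let ?M = "\<lambda>w. {z \<in> M. \<not> leq w z}"
        have dc: "down_closed le3 (F (?M w))" for w
          unfolding down_closed_def[of le3]
        proof (intro ballI allI impI)
          fix t s assume "t \<in> F (?M w)" "le3 s t"
          then obtain y z where yz: "(y, z) \<in> ?M w" "t = f y z" by (auto simp: F_def)
          then obtain y' z' where "s = f y' z'" "le1 y' y" "le2 z' z"
            using split \<open>le3 s t\<close> less.hyps(2) by blast
          moreover from this yz have "(y', z') \<in> ?M w"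
            by (intro down_closedD[OF P.down_closed_minus_above[OF less.hyps(1)] yz(1)]) (simp add: leq_def)
          ultimately show "s \<in> F (?M w)" by (force simp: F_def)
        qed
        have "M = ?M u \<union> ?M v" using uv(3) by blast
        then have union: "D = F (?M u) \<union> F (?M v)" using less.prems unfolding F_def by blast
        then have "D = F (?M u) \<or> D = F (?M v)" using order_ideal_Un[OF _ dc dc, of u v] D(2) by simp
        moreover have "?M u \<subset> M" "?M v \<subset> M" using uv(1,2) P.refl less.hyps by blast+
        ultimately show False
          using False P.down_closed_minus_above[OF less.hyps(1), of u]
            P.down_closed_minus_above[OF less.hyps(1), of v] by blast
      qed
      then show ?thesis using less False by blast
    qed
  qed
  define M0 where "M0 = {p \<in> Y \<times> Z. f (fst p) (snd p) \<in> D}"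
  have "down_closed leq M0"
    unfolding down_closed_def
  proof (intro ballI allI impI)
    fix p q assume p: "p \<in> M0" and q: "leq q p"
    then have "q \<in> Y \<times> Z" using P.down by (auto simp: M0_def dest: down_closedD)
    moreover have "le3 (f (fst q) (snd q)) (f (fst p) (snd p))"
      using p q by (auto simp: M0_def leq_def mono)
    ultimately show "q \<in> M0"
      using p order_ideal_down_closed[OF D(2)] by (auto simp: M0_def dest: down_closedD)
  qed
  moreover have "F M0 = D" using sub D(1) unfolding F_def M0_def by force
  ultimately obtain M where M: "M \<subseteq> Y \<times> Z" "order_ideal leq M" "F M = D"
    and least: "\<And>E. down_closed leq E \<Longrightarrow> E \<subset> M \<Longrightarrow> F E \<noteq> D"
    using ideal_pair[of M0] by (auto simp: M0_def)
  have dcM: "down_closed leq M" using M(2) by (rule order_ideal_down_closed)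
  \<comment> \<open>With its projections as factors, a directed down-closed set of pairs is a
    product.\<close>
  have prod: "(y, z') \<in> M" if mem: "(y, z) \<in> M" "(y', z') \<in> M" for y z y' z'
  proof -
    obtain w where "w \<in> M" "leq (y, z) w" "leq (y', z') w"
      using M(2)[unfolded order_ideal_def] mem by meson
    then show ?thesis using down_closedD[OF dcM, of w "(y, z')"] by (simp add: leq_def)
  qed
  have leq_pair: "leq (y, z) (y', z') \<longleftrightarrow> le1 y y' \<and> le2 z z'" for y z y' z' by (simp add: leq_def)
  have bound: "\<exists>w\<in>M. le1 (fst u) (fst w) \<and> le1 (fst v) (fst w) \<and> le2 (snd u) (snd w) \<and> le2 (snd v) (snd w)"
    if "u \<in> M" "v \<in> M" for u v
    using M(2)[unfolded order_ideal_def leq_def] that by meson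
  have "order_ideal le1 (fst ` M)"
    unfolding order_ideal_def
  proof (intro conjI ballI)
    show "down_closed le1 (fst ` M)"
      unfolding down_closed_def
    proof (intro ballI allI impI)
      fix y x assume "y \<in> fst ` M" "le1 x y"
      then obtain z where "(y, z) \<in> M" by force
      moreover from this have "leq (x, z) (y, z)" using M(1) \<open>le1 x y\<close> Z.refl by (auto simp: leq_def)
      ultimately show "x \<in> fst ` M" using down_closedD[OF dcM] by force
    qed
    fix x y assume "x \<in> fst ` M" "y \<in> fst ` M"
    then obtain u v where "u \<in> M" "v \<in> M" "x = fst u" "y = fst v" by auto
    then show "\<exists>z\<in>fst ` M. le1 x z \<and> le1 y z" using bound[of u v] by auto
  qed (use M(2) in \<open>auto simp: order_ideal_def\<close>)
  moreover have "fst ` M \<subseteq> Y" using M(1) by auto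
  ultimately have "eventually_constant le1 \<alpha> (fst ` M)" using tameD[OF tame(1)] by blast
  then obtain y0 where y0: "y0 \<in> fst ` M" "\<And>y. y \<in> fst ` M \<Longrightarrow> le1 y0 y \<Longrightarrow> \<alpha> y = \<alpha> y0"
    unfolding eventually_constant_def by blast
  have "order_ideal le2 (snd ` M)"
    unfolding order_ideal_def
  proof (intro conjI ballI)
    show "down_closed le2 (snd ` M)"
      unfolding down_closed_def
    proof (intro ballI allI impI)
      fix z x assume "z \<in> snd ` M" "le2 x z"
      then obtain y where "(y, z) \<in> M" by force
      moreover from this have "leq (y, x) (y, z)" using M(1) \<open>le2 x z\<close> Y.refl by (auto simp: leq_def)
      ultimately show "x \<in> snd ` M" using down_closedD[OF dcM] by force
    qed
    fix x y assume "x \<in> snd ` M" "y \<in> snd ` M"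
    then obtain u v where "u \<in> M" "v \<in> M" "x = snd u" "y = snd v" by auto
    then show "\<exists>z\<in>snd ` M. le2 x z \<and> le2 y z" using bound[of u v] by auto
  qed (use M(2) in \<open>auto simp: order_ideal_def\<close>)
  moreover have "snd ` M \<subseteq> Z" using M(1) by auto
  ultimately have "eventually_constant le2 \<beta> (snd ` M)" using tameD[OF tame(2)] by blast
  then obtain z0 where z0: "z0 \<in> snd ` M" "\<And>z. z \<in> snd ` M \<Longrightarrow> le2 z0 z \<Longrightarrow> \<beta> z = \<beta> z0"
    unfolding eventually_constant_def by blast
  obtain y z where "(y0, z) \<in> M" "(y, z0) \<in> M"
    using y0(1) z0(1) by (metis imageE prod.collapse)
  then have "(y0, z0) \<in> M" by (rule prod)
  let ?M = "{p \<in> M. \<not> leq (y0, z0) p}"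
  have val0: "\<gamma> (f y z) = \<gamma> (f y0 z0)" if yz: "(y, z) \<in> M" "leq (y0, z0) (y, z)" for y z
  proof (rule val)
    have "y \<in> fst ` M" "z \<in> snd ` M" using yz(1) by force+
    then show "\<alpha> y = \<alpha> y0" "\<beta> z = \<beta> z0"
      using yz(2) by (auto simp only: leq_pair intro: y0(2) z0(2))
    show "y \<in> Y" "y0 \<in> Y" "z \<in> Z" "z0 \<in> Z" using yz(1) \<open>(y0, z0) \<in> M\<close> M(1) by auto
  qed
  \<comment> \<open>An element of \<open>D\<close> may have several factorizations. By minimality of
    \<open>M\<close>, the pairs not above \<open>(y0, z0)\<close> miss some \<open>s\<close> in
    \<open>D\<close>; hence every factorization in \<open>M\<close> of any \<open>t\<close> above
    \<open>s\<close> lies above \<open>(y0, z0)\<close>.\<close>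
  have "?M \<subset> M" using \<open>(y0, z0) \<in> M\<close> P.refl M(1) by blast
  then have "F ?M \<noteq> D" using least P.down_closed_minus_above[OF dcM] by blast
  moreover have "F ?M \<subseteq> D" unfolding M(3)[symmetric] F_def by blast
  ultimately obtain s where s: "s \<in> D" "s \<notin> F ?M" by blast
  have const: "\<gamma> t = \<gamma> (f y0 z0)" if t: "t \<in> D" "le3 s t" for t
  proof -
    obtain y z where yz: "(y, z) \<in> M" "t = f y z"
      using t(1) unfolding M(3)[symmetric] F_def by auto
    then obtain y' z' where y'z': "s = f y' z'" "le1 y' y" "le2 z' z"
      using split[of y z s] M(1) t(2) by blast
    then have "(y', z') \<in> M" using down_closedD[OF dcM yz(1)] by (simp add: leq_pair)
    have "leq (y0, z0) (y', z')"
    proof (rule ccontr)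
      assume "\<not> leq (y0, z0) (y', z')"
      with \<open>(y', z') \<in> M\<close> have "(y', z') \<in> ?M" by simp
      then have "s \<in> F ?M" unfolding F_def y'z'(1) by (rule rev_image_eqI) simp
      then show False using s(2) by blast
    qed
    moreover have "leq (y', z') (y, z)" using y'z'(2,3) by (simp add: leq_pair)
    ultimately have "leq (y0, z0) (y, z)" by (rule P.trans)
    then show ?thesis unfolding yz(2) by (rule val0[OF yz(1)])
  qed
  have "s \<in> T" using s(1) D(1) by blast
  then obtain p where p: "p \<in> Y \<times> Z" "s = (case p of (y, z) \<Rightarrow> f y z)" using sub by blast
  then have "le3 s s"
    using mono[of "fst p" "snd p" "fst p" "snd p"] Y.refl Z.refl by (simp add: split_beta mem_Times_iff)
  then have "\<gamma> s = \<gamma> (f y0 z0)" using const s(1) by blast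
  then show "eventually_constant le3 \<gamma> D"
    unfolding eventually_constant_def using s(1) const by (intro bexI[of _ s]) simp_all
qed

text \<open>
  In a finite \<open>\<J>\<close>-trivial quotient, a long product of factors above an idempotent \<open>e\<close> has two prefixes of
  equal value; the block between them can be iterated up to an idempotent, which then equals \<open>e\<close>. The
  element \<open>w\<close> makes an element above a product \<open>q\<^sub>1 w q\<^sub>2\<close> split between \<open>q\<^sub>1\<close> and \<open>q\<^sub>2\<close>.
\<close>

lemma eventually_constant_if_absorbing:
  fixes mult :: "'m \<Rightarrow> 'm \<Rightarrow> 'm" (infixl "\<cdot>" 70) and leq :: "'m \<Rightarrow> 'm \<Rightarrow> bool" (infix "\<preceq>" 50)
    and \<gamma> :: "'m \<Rightarrow> 'v" and \<beta> :: "'m \<Rightarrow> 'w"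
  assumes assoc: "\<And>x y z. (x \<cdot> y) \<cdot> z = x \<cdot> (y \<cdot> z)"
    and ideal: "order_ideal (\<preceq>) P"
    and refl: "\<And>x. x \<in> P \<Longrightarrow> x \<preceq> x"
    and trans: "\<And>x y z. x \<preceq> y \<Longrightarrow> y \<preceq> z \<Longrightarrow> x \<preceq> z"
    and closed: "\<And>x y. x \<in> P \<Longrightarrow> y \<in> P \<Longrightarrow> x \<cdot> y \<in> P"
    and above: "\<And>x y. x \<in> P \<Longrightarrow> y \<in> P \<Longrightarrow> x \<preceq> x \<cdot> y"
    and fin: "finite (\<gamma> ` P)"
    and \<gamma>_cong: "\<And>x x' y y'. \<lbrakk>x \<in> P; x' \<in> P; y \<in> P; y' \<in> P; \<gamma> x = \<gamma> x'; \<gamma> y = \<gamma> y'\<rbrakk> \<Longrightarrow>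
      \<gamma> (x \<cdot> y) = \<gamma> (x' \<cdot> y')"
    and \<beta>_cong: "\<And>x x' y y'. \<lbrakk>x \<in> P; x' \<in> P; y \<in> P; y' \<in> P; \<beta> x = \<beta> x'; \<beta> y = \<beta> y'\<rbrakk> \<Longrightarrow>
      \<beta> (x \<cdot> y) = \<beta> (x' \<cdot> y')"
    and \<gamma>_\<beta>: "\<And>x y. x \<in> P \<Longrightarrow> y \<in> P \<Longrightarrow> \<gamma> x = \<gamma> y \<Longrightarrow> \<beta> x = \<beta> y"
    and absorb: "\<And>u e. \<lbrakk>u \<in> P; e \<in> P; u \<preceq> e; \<gamma> (e \<cdot> e) = \<gamma> e\<rbrakk> \<Longrightarrow>
      \<beta> (e \<cdot> u) = \<beta> e \<and> \<beta> (u \<cdot> e) = \<beta> e"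
    and w: "w \<in> P"
    and sep: "\<And>q1 q2 s. \<lbrakk>q1 \<in> P; q2 \<in> P; s \<in> P; q1 \<cdot> w \<cdot> q2 \<preceq> s\<rbrakk> \<Longrightarrow>
      \<exists>s1 s2. s = s1 \<cdot> s2 \<and> s1 \<in> P \<and> s2 \<in> P \<and> q1 \<preceq> s1 \<and> q2 \<preceq> s2"
  shows "eventually_constant (\<preceq>) \<beta> P"
proof -
  \<comment> \<open>Exponents are shifted by one, since no unit is assumed: \<open>pw x n\<close> is
    the power with exponent \<open>n + 1\<close>.\<close>
  define pw where "pw x = rec_nat x (\<lambda>_ y. x \<cdot> y)" for x
  have pw_simps: "pw x 0 = x" "pw x (Suc n) = x \<cdot> pw x n" for x n by (simp_all add: pw_def)
  have pw_P: "pw x n \<in> P" if "x \<in> P" for x n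
    using that closed by (induction n) (simp_all add: pw_simps)
  have pw_add: "pw x i \<cdot> pw x j = pw x (Suc (i + j))" for x i j
    by (induction i) (simp_all add: pw_simps assoc)
  have le_pw: "x \<preceq> pw x n" if "x \<in> P" for x n
    using that refl above pw_P by (cases n) (simp_all add: pw_simps)
  have \<beta>_mult: "\<beta> (x \<cdot> y) = \<beta> (x' \<cdot> y)" if "x \<in> P" "x' \<in> P" "y \<in> P" "\<beta> x = \<beta> x'" for x x' y
    using that \<beta>_cong by blast
  have \<beta>_mult': "\<beta> (y \<cdot> x) = \<beta> (y \<cdot> x')" if "x \<in> P" "x' \<in> P" "y \<in> P" "\<beta> x = \<beta> x'" for x x' y
    using that \<beta>_cong by blast
  have idem: "\<exists>n. \<gamma> (pw x n \<cdot> pw x n) = \<gamma> (pw x n)" if x: "x \<in> P" for x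
  proof -
    have "range (\<lambda>n. \<gamma> (pw x n)) \<subseteq> \<gamma> ` P" using pw_P[OF x] by auto
    then have "\<not> inj (\<lambda>n. \<gamma> (pw x n))"
      using fin finite_subset finite_imageD infinite_UNIV_nat by metis
    then obtain i j where ij: "i < j" "\<gamma> (pw x i) = \<gamma> (pw x j)"
      unfolding inj_def by (metis linorder_less_linear)
    define p where "p = j - i"
    have p: "p > 0" "j = i + p" using ij(1) by (simp_all add: p_def)
    have period: "\<gamma> (pw x (i + t)) = \<gamma> (pw x (i + t + p))" for t
    proof (induction t)
      case 0
      then show ?case using ij(2) p(2) by simp
    next
      case (Suc t)
      have "\<gamma> (x \<cdot> pw x (i + t)) = \<gamma> (x \<cdot> pw x (i + t + p))"
        by (intro \<gamma>_cong x pw_P refl Suc) simp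
      then show ?case by (simp add: pw_simps)
    qed
    have period': "\<gamma> (pw x k) = \<gamma> (pw x (k + q * p))" if "i \<le> k" for k q
    proof (induction q)
      case (Suc q)
      obtain t where t: "k + q * p = i + t" using \<open>i \<le> k\<close> le_Suc_ex trans_le_add1 by blast
      then have "k + Suc q * p = i + t + p" by simp
      then show ?case using Suc period[of t] t by (simp only:)
    qed simp
    \<comment> \<open>The exponent \<open>Suc k\<close> is a multiple of the period \<open>p\<close>
      and larger than \<open>i\<close>, so squaring shifts the power by whole periods inside the
      periodic range.\<close>
    define k where "k = p * Suc i - 1"
    have k: "Suc k = p * Suc i" using p(1) by (simp add: k_def)
    have "1 * Suc i \<le> p * Suc i" using p(1) by (intro mult_right_mono) auto
    then have "Suc i \<le> Suc k" unfolding k by simp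
    then have "i \<le> k" by simp
    have "Suc (k + k) = k + Suc i * p" using k by (simp add: mult.commute)
    then have "pw x k \<cdot> pw x k = pw x (k + Suc i * p)" by (simp only: pw_add)
    then show ?thesis using period'[OF \<open>i \<le> k\<close>, of "Suc i"] by metis
  qed
  \<comment> \<open>\<open>F\<close> represents every \<open>\<gamma>\<close>-class, and
    \<open>e\<close> is a power, idempotent under \<open>\<gamma>\<close>, of an upper bound of
    \<open>F\<close>. Hence every element of \<open>P\<close> is equivalent to one below
    \<open>e\<close>, and \<open>e\<close> acts as a zero on the
    \<open>\<beta>\<close>-classes.\<close>
  obtain F where F: "finite F" "F \<subseteq> P" "\<gamma> ` P = \<gamma> ` F"
    using finite_subset_image[OF fin subset_refl] by blast
  obtain z where z: "z \<in> P" "\<And>x. x \<in> F \<Longrightarrow> x \<preceq> z"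
    using order_ideal_finite_bound[OF ideal F(1,2)] trans by blast
  obtain n where n: "\<gamma> (pw z n \<cdot> pw z n) = \<gamma> (pw z n)" using idem[OF z(1)] by blast
  define e where "e = pw z n"
  have e: "e \<in> P" "\<gamma> (e \<cdot> e) = \<gamma> e" "z \<preceq> e" using n pw_P le_pw z(1) by (simp_all add: e_def)
  have e_absorb: "\<beta> (e \<cdot> s) = \<beta> e \<and> \<beta> (s \<cdot> e) = \<beta> e" if s: "s \<in> P" for s
  proof -
    have "\<gamma> s \<in> \<gamma> ` F" using s F(3) by blast
    then obtain r where r: "r \<in> F" "\<gamma> s = \<gamma> r" by blast
    then have "r \<in> P" "r \<preceq> e" using F(2) z(2) e(3) trans by blast+
    moreover have "\<beta> s = \<beta> r" using \<gamma>_\<beta> s r \<open>r \<in> P\<close> by blast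
    ultimately show ?thesis
      using absorb[OF \<open>r \<in> P\<close> e(1) \<open>r \<preceq> e\<close> e(2)] \<beta>_mult \<beta>_mult' s e(1) by metis
  qed
  \<comment> \<open>A power of \<open>b\<close> that is idempotent under \<open>\<gamma>\<close>
    lies above \<open>e\<close> and so absorbs \<open>e\<close>; as \<open>e\<close> absorbs it too,
    both have the same \<open>\<beta>\<close>-value.\<close>
  have block: "\<exists>k. \<beta> (pw b k) = \<beta> e" if b: "b \<in> P" "e \<preceq> b" for b
  proof -
    obtain k where k: "\<gamma> (pw b k \<cdot> pw b k) = \<gamma> (pw b k)" using idem[OF b(1)] by blast
    have "e \<preceq> pw b k" using b le_pw trans by blast
    then have "\<beta> (pw b k \<cdot> e) = \<beta> (pw b k)" using absorb e(1) pw_P[OF b(1)] k by blast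
    then show ?thesis using e_absorb pw_P[OF b(1)] by metis
  qed
  define tower where "tower = rec_nat e (\<lambda>_ x. e \<cdot> w \<cdot> x)"
  have tower_simps: "tower 0 = e" "tower (Suc k) = e \<cdot> w \<cdot> tower k" for k
    by (simp_all add: tower_def)
  have tower_P: "tower k \<in> P" for k
    by (induction k) (simp_all add: tower_simps closed e(1) w)
  \<comment> \<open>The \<open>c i\<close> are successive prefixes of \<open>s\<close> whose
    increments are all above \<open>e\<close>. A remainder in \<open>P\<close> is demanded only for
    \<open>i < k\<close>, because the last prefix may be \<open>s\<close> itself.\<close>
  define chain where "chain k s c \<longleftrightarrow> (\<forall>i\<le>k. c i \<in> P \<and> e \<preceq> c i) \<and>
      (\<forall>j\<le>k. \<forall>i<j. \<exists>b\<in>P. e \<preceq> b \<and> c j = c i \<cdot> b) \<and> (\<forall>i<k. \<exists>r\<in>P. s = c i \<cdot> r)" for k :: nat and s c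
  have prefixes: "\<exists>c. chain k s c"
    if "s \<in> P" "tower k \<preceq> s" for k s
    using that
  proof (induction k arbitrary: s)
    case 0
    then have "chain 0 s (\<lambda>_. s)" by (simp add: chain_def tower_simps)
    then show ?case by (rule exI[of "chain 0 s"])
  next
    case (Suc k)
    have "e \<cdot> w \<cdot> tower k \<preceq> s" using Suc.prems(2) by (simp add: tower_simps)
    from sep[OF e(1) tower_P Suc.prems(1) this] obtain s1 s2 where
      s: "s = s1 \<cdot> s2" "s1 \<in> P" "s2 \<in> P" "e \<preceq> s1" "tower k \<preceq> s2" by blast
    from Suc.IH[OF s(3,5)] obtain c where "chain k s2 c" ..
    then have c: "\<And>i. i \<le> k \<Longrightarrow> c i \<in> P \<and> e \<preceq> c i"
      "\<And>j i. j \<le> k \<Longrightarrow> i < j \<Longrightarrow> \<exists>b\<in>P. e \<preceq> b \<and> c j = c i \<cdot> b"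
      "\<And>i. i < k \<Longrightarrow> \<exists>r\<in>P. s2 = c i \<cdot> r" by (simp_all add: chain_def)
    define d where "d = case_nat s1 (\<lambda>i. s1 \<cdot> c i)"
    have d_simps: "d 0 = s1" "d (Suc i) = s1 \<cdot> c i" for i by (simp_all add: d_def)
    have "d i \<in> P \<and> e \<preceq> d i" if "i \<le> Suc k" for i
    proof (cases i)
      case (Suc i')
      then have "c i' \<in> P" using c(1) that by simp
      then show ?thesis using Suc s closed above trans by (metis d_simps(2))
    qed (simp add: d_simps s)
    moreover have "\<exists>b\<in>P. e \<preceq> b \<and> d j = d i \<cdot> b" if j: "j \<le> Suc k" and i: "i < j" for i j
    proof -
      obtain j' where j': "j = Suc j'" using i by (cases j) auto
      show ?thesis
      proof (cases i)
        case 0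
        then show ?thesis using c(1)[of j'] j j' by (auto simp: d_simps)
      next
        case (Suc i')
        then show ?thesis using c(2)[of j' i'] i j j' by (auto simp: d_simps assoc)
      qed
    qed
    moreover have "\<exists>r\<in>P. s = d i \<cdot> r" if "i < Suc k" for i
    proof (cases i)
      case 0
      then show ?thesis using s by (auto simp: d_simps)
    next
      case (Suc i')
      then show ?thesis using c(3)[of i'] that s(1) by (auto simp: d_simps assoc)
    qed
    ultimately have "chain (Suc k) s d" unfolding chain_def by blast
    then show ?case by (rule exI[of "chain (Suc k) s"])
  qed
  \<comment> \<open>Among \<open>N + 2\<close> prefixes two agree under \<open>\<gamma>\<close>,
    with an increment \<open>b\<close> above \<open>e\<close> between them. Then \<open>c i\<close>
    is equivalent to \<open>c i\<close> times any power of \<open>b\<close>, one of which has the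
    \<open>\<beta>\<close>-value of \<open>e\<close>; so \<open>c i\<close>, and with it
    \<open>s\<close>, has that value.\<close>
  define N where "N = card (\<gamma> ` P)"
  have const: "\<beta> s = \<beta> e" if s: "s \<in> P" "tower (Suc N) \<preceq> s" for s
  proof -
    from prefixes[OF s] obtain c where "chain (Suc N) s c" ..
    then have c: "\<And>i. i \<le> Suc N \<Longrightarrow> c i \<in> P \<and> e \<preceq> c i"
      "\<And>j i. j \<le> Suc N \<Longrightarrow> i < j \<Longrightarrow> \<exists>b\<in>P. e \<preceq> b \<and> c j = c i \<cdot> b"
      "\<And>i. i < Suc N \<Longrightarrow> \<exists>r\<in>P. s = c i \<cdot> r" by (simp_all add: chain_def)
    have "(\<lambda>i. \<gamma> (c i)) ` {..Suc N} \<subseteq> \<gamma> ` P" using c(1) by auto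
    then have "card ((\<lambda>i. \<gamma> (c i)) ` {..Suc N}) \<le> N" unfolding N_def using fin card_mono by blast
    then have "\<not> inj_on (\<lambda>i. \<gamma> (c i)) {..Suc N}" using card_image by fastforce
    then obtain i j where ij: "i < j" "j \<le> Suc N" "\<gamma> (c i) = \<gamma> (c j)"
      unfolding inj_on_def by (metis atMost_iff linorder_less_linear)
    obtain b where b: "b \<in> P" "e \<preceq> b" "c j = c i \<cdot> b" using c(2) ij by blast
    have ci: "c i \<in> P" using c(1) ij by simp
    have "\<gamma> (c i \<cdot> pw b k) = \<gamma> (c i)" for k
    proof (induction k)
      case 0
      then show ?case using ij(3) b(3) by (simp add: pw_simps)
    next
      case (Suc k)
      have "\<gamma> (c i \<cdot> b \<cdot> pw b k) = \<gamma> (c i \<cdot> pw b k)"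
        using ij(3) b(3) by (intro \<gamma>_cong ci pw_P closed b(1)) simp_all
      then show ?case using Suc by (simp add: pw_simps assoc)
    qed
    moreover obtain k where k: "\<beta> (pw b k) = \<beta> e" using block[OF b(1,2)] by blast
    ultimately have "\<beta> (c i) = \<beta> (c i \<cdot> pw b k)" using \<gamma>_\<beta> ci closed pw_P[OF b(1)] by metis
    also have "\<dots> = \<beta> (c i \<cdot> e)" using \<beta>_mult' ci pw_P[OF b(1)] e(1) k by blast
    also have "\<dots> = \<beta> e" using e_absorb ci by blast
    finally have "\<beta> (c i) = \<beta> e" .
    moreover obtain r where "r \<in> P" "s = c i \<cdot> r" using c(3)[of i] ij by auto
    ultimately have "\<beta> s = \<beta> (e \<cdot> r)" using \<beta>_mult ci e(1) by blast
    then show ?thesis using e_absorb \<open>r \<in> P\<close> by simp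
  qed
  show ?thesis
    unfolding eventually_constant_def
    using tower_P const refl by (intro bexI[of _ "tower (Suc N)"]) simp_all
qed

section \<open>The piece order on forests and contexts\<close>

text \<open>The relation follows the larger forest: the root of its first tree is deleted or kept.
  Case analysis on this shape yields the splitting lemmas, which are awkward to extract from
  sequences of single deletions; \<open>piece_iff_fle\<close> identifies the two.\<close>

inductive fle :: "'a forest \<Rightarrow> 'a forest \<Rightarrow> bool" where
  Nil: "fle [] []"
| del: "fle s ts \<Longrightarrow> fle s' r \<Longrightarrow> fle (s @ s') (Node a ts # r)"
| keep: "fle s ts \<Longrightarrow> fle s' r \<Longrightarrow> fle (Node a s # s') (Node a ts # r)"

lemma fle_Nil_iff [simp]: "fle s [] \<longleftrightarrow> s = []"
  by (auto elim: fle.cases intro: fle.Nil)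

text \<open>A forest is read as a binary tree, by first child and next sibling.\<close>

lemma forest_induct [case_names Nil Cons]:
  assumes "P []" "\<And>a ts r. P ts \<Longrightarrow> P r \<Longrightarrow> P (Node a ts # r)"
  shows "P t"
proof (induction t rule: measure_induct_rule[of nodes])
  case (less t)
  show ?case
  proof (cases t)
    case (Cons x r)
    obtain a ts where "x = Node a ts" by (cases x)
    then show ?thesis using Cons assms(2) less by (simp add: nodes_Cons nodes_def)
  qed (simp add: assms(1))
qed

lemma fle_refl [simp]: "fle t t"
  by (induction t rule: forest_induct) (auto intro: fle.intros)

lemma fle_Nil [simp]: "fle [] t"
proof (induction t rule: forest_induct)
  case (Cons a ts r)
  then show ?case using fle.del[of "[]" ts "[]" r a] by simp
qed simp

lemma fle_append: "fle s t \<Longrightarrow> fle s' t' \<Longrightarrow> fle (s @ s') (t @ t')"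
proof (induction rule: fle.induct)
  case (del s ts u r a)
  then show ?case using fle.del[of s ts "u @ s'" "r @ t'" a] by simp
qed (auto intro: fle.intros)

lemma fle_append_split: "fle s (t @ t') \<Longrightarrow> \<exists>u u'. s = u @ u' \<and> fle u t \<and> fle u' t'"
proof (induction t arbitrary: s)
  case (Cons x t)
  obtain a ts where x: "x = Node a ts" by (cases x)
  from Cons.prems x have "fle s (Node a ts # t @ t')" by simp
  then show ?case
  proof cases
    case (del s1 s2)
    then obtain u u' where "s2 = u @ u'" "fle u t" "fle u' t'" using Cons.IH by blast
    then show ?thesis using del x fle.del[of s1 ts u t a] by (metis append.assoc)
  next
    case (keep s1 s2)
    then obtain u u' where "s2 = u @ u'" "fle u t" "fle u' t'" using Cons.IH by blast
    then show ?thesis using keep x fle.keep[of s1 ts u t a] by (metis append_Cons)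
  qed
qed auto

lemma fle_Node: "fle s t \<Longrightarrow> fle [Node a s] [Node a t]"
  using fle.keep[of s t "[]" "[]" a] by simp

lemma fle_under: "fle s t \<Longrightarrow> fle s [Node a t]"
  using fle.del[of s t "[]" "[]" a] by simp

lemma fle_Node_cases [consumes 1, case_names del keep]:
  assumes "fle s [Node a t]"
  obtains "fle s t" | u where "s = [Node a u]" "fle u t"
  using assms by (auto elim: fle.cases)

lemma fle_trans: "fle t u \<Longrightarrow> fle s t \<Longrightarrow> fle s u"
proof (induction arbitrary: s rule: fle.induct)
  case (del t ts t' r a)
  then obtain s1 s2 where "s = s1 @ s2" "fle s1 t" "fle s2 t'" using fle_append_split by blast
  then show ?case using del by (auto intro: fle.del)
next
  case (keep t ts t' r a)
  from keep.prems have "fle s ([Node a t] @ t')" by simp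
  then obtain s1 s2 where s: "s = s1 @ s2" "fle s1 [Node a t]" "fle s2 t'"
    using fle_append_split by blast
  from s(2) show ?case
  proof (cases rule: fle_Node_cases)
    case del
    then show ?thesis using keep s by (auto intro: fle.del)
  next
    case (keep u)
    then show ?thesis using keep.IH s by (auto intro: fle.keep)
  qed
qed simp

lemma forests_Nil [simp]: "[] \<in> forests A"
  and forests_append [simp]: "s @ t \<in> forests A \<longleftrightarrow> s \<in> forests A \<and> t \<in> forests A"
  and forests_Node [simp]: "Node a s # t \<in> forests A \<longleftrightarrow> a \<in> A \<and> s \<in> forests A \<and> t \<in> forests A"
  by (auto simp: forests_def)

lemma contexts_Hole [simp]: "Hole l r \<in> contexts A \<longleftrightarrow> l \<in> forests A \<and> r \<in> forests A"
  and contexts_Nest [simp]: "Nest l a c r \<in> contexts A \<longleftrightarrow>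
    l \<in> forests A \<and> a \<in> A \<and> c \<in> contexts A \<and> r \<in> forests A"
  by (auto simp: forests_def contexts_def)

lemma plug_in_forests_iff [simp]: "plug p t \<in> forests A \<longleftrightarrow> p \<in> contexts A \<and> t \<in> forests A"
  by (induction p) auto

lemma ctxt_comp_in_contexts_iff [simp]:
  "ctxt_comp p q \<in> contexts A \<longleftrightarrow> p \<in> contexts A \<and> q \<in> contexts A"
  by (induction p q rule: ctxt_comp.induct) auto

lemma fle_forests: "fle s t \<Longrightarrow> t \<in> forests A \<Longrightarrow> s \<in> forests A"
  by (induction rule: fle.induct) auto

lemma delete_node_append: "delete_node s t \<Longrightarrow> delete_node (l @ s @ r) (l @ t @ r)"
proof (induction rule: delete_node.induct)
  case (1 l' a ts r')
  show ?case using delete_node.intros(1)[of "l @ l'" a ts "r' @ r"] by simp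
next
  case (2 ts us l' a r')
  then show ?case using delete_node.intros(2)[OF 2(1), of "l @ l'" a "r' @ r"] by simp
qed

lemma delete_nodes_append: "delete_node\<^sup>*\<^sup>* s t \<Longrightarrow> delete_node\<^sup>*\<^sup>* (l @ s @ r) (l @ t @ r)"
  by (induction rule: rtranclp_induct) (auto intro: rtranclp.rtrancl_into_rtrancl delete_node_append)

lemma delete_nodes_append2:
  "delete_node\<^sup>*\<^sup>* s t \<Longrightarrow> delete_node\<^sup>*\<^sup>* s' t' \<Longrightarrow> delete_node\<^sup>*\<^sup>* (s @ s') (t @ t')"
  using delete_nodes_append[of s t "[]" s'] delete_nodes_append[of s' t' t "[]"] by simp

lemma delete_nodes_Node: "delete_node\<^sup>*\<^sup>* s t \<Longrightarrow> delete_node\<^sup>*\<^sup>* [Node a s] [Node a t]"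
proof (induction rule: rtranclp_induct)
  case (step t u)
  then show ?case
    using delete_node.intros(2)[OF step(2), of "[]" a "[]"] by (auto intro: rtranclp.rtrancl_into_rtrancl)
qed simp

lemma piece_iff_fle: "piece s t \<longleftrightarrow> fle s t"
proof
  have deleted: "fle u t" if "delete_node t u" for t u :: "'a forest"
    using that
  proof (induction rule: delete_node.induct)
    case (1 l a ts r)
    show ?case by (intro fle_append fle_refl fle.del)
  next
    case (2 ts us l a r)
    then show ?case by (intro fle_append fle_refl fle.keep)
  qed
  assume "piece s t"
  then have "delete_node\<^sup>*\<^sup>* t s" by (simp add: piece_def)
  then show "fle s t"
    by (induction rule: rtranclp_induct) (auto intro: fle_trans deleted)
next
  assume "fle s t"
  then show "piece s t"
    unfolding piece_def
  proof (induction rule: fle.induct)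
    case (del s ts s' r a)
    have "delete_node\<^sup>*\<^sup>* (Node a ts # r) (ts @ r)"
      using delete_node.intros(1)[of "[]" a ts r] by auto
    then show ?case using delete_nodes_append2[OF del.IH] by (rule rtranclp_trans)
  next
    case (keep s ts s' r a)
    then show ?case using delete_nodes_append2[OF delete_nodes_Node[of ts s a] keep.IH(2)] by simp
  qed simp
qed

text \<open>Splitting a nonempty forest into its first label, the children below it and the
  remaining siblings merges the arguments of Higman and Kruskal into one minimal bad sequence: both
  forests of the triple are smaller pieces, and \<open>keep\<close> is monotone in them.\<close>

lemma almost_full_fle:
  assumes "finite A" shows "almost_full fle (forests A)"
proof (rule almost_full_by_parts[where size_of = nodes])
  show "\<And>x y z. fle x y \<Longrightarrow> fle y z \<Longrightarrow> fle x z" using fle_trans by blast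
  fix f :: "nat \<Rightarrow> 'a forest"
  let ?B = "{y \<in> forests A. \<exists>i. nodes y < nodes (f i) \<and> fle y (f i)}"
  assume f: "range f \<subseteq> forests A" and B: "almost_full fle ?B"
  show "\<exists>i j. i < j \<and> fle (f i) (f j)"
  proof (cases "\<exists>i. f i = []")
    case True
    then obtain i where "f i = []" ..
    then show ?thesis by (intro exI[of _ i] exI[of _ "Suc i"]) simp
  next
    case False
    have "\<exists>p. f i = Node (fst p) (fst (snd p)) # snd (snd p)" for i
      using False by (metis fst_conv snd_conv neq_Nil_conv tree.exhaust)
    then obtain p where p: "\<And>i. f i = Node (fst (p i)) (fst (snd (p i))) # snd (snd (p i))" by metis
    have small: "fst (p i) \<in> A" "fst (snd (p i)) \<in> ?B" "snd (snd (p i)) \<in> ?B" for i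
    proof -
      have "f i \<in> forests A" using f by auto
      then have A: "fst (p i) \<in> A" "fst (snd (p i)) \<in> forests A" "snd (snd (p i)) \<in> forests A"
        by (simp_all add: p[of i])
      have "fle (fst (snd (p i))) (f i)" "fle (snd (snd (p i))) (f i)"
        using fle.del[of "fst (snd (p i))" "fst (snd (p i))" "[]" "snd (snd (p i))" "fst (p i)"]
          fle.del[of "[]" "fst (snd (p i))" "snd (snd (p i))" "snd (snd (p i))" "fst (p i)"]
        by (simp_all add: p[of i])
      moreover have "nodes (fst (snd (p i))) < nodes (f i)" "nodes (snd (snd (p i))) < nodes (f i)"
        by (simp_all add: p[of i] nodes_Cons nodes_tree_Node del: nodes_tree.simps)
      ultimately show "fst (p i) \<in> A" "fst (snd (p i)) \<in> ?B" "snd (snd (p i)) \<in> ?B"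
        using A by blast+
    qed
    have "almost_full (\<lambda>x y. fst x = fst y \<and> fle (fst (snd x)) (fst (snd y)) \<and>
        fle (snd (snd x)) (snd (snd y))) (A \<times> ?B \<times> ?B)"
      by (intro almost_full_Times almost_full_finite assms B)
    moreover have "range p \<subseteq> A \<times> ?B \<times> ?B"
      using small by (auto simp: image_subset_iff mem_Times_iff simp del: mem_Collect_eq)
    ultimately obtain i j where "i < j" "fst (p i) = fst (p j)"
      "fle (fst (snd (p i))) (fst (snd (p j)))" "fle (snd (snd (p i))) (snd (snd (p j)))"
      unfolding almost_full_def by blast
    then have "fle (f i) (f j)" unfolding p[of i] p[of j] by (simp add: fle.keep)
    with \<open>i < j\<close> show ?thesis by blast
  qed
qed

lemma down_closed_forests: "down_closed fle (forests A)"
  unfolding down_closed_def using fle_forests by blast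

lemma wqo_forests: "finite A \<Longrightarrow> well_quasi_order fle (forests A)"
  using fle_trans by unfold_locales (auto simp: almost_full_fle down_closed_forests)

text \<open>The piece order on contexts: the hole is never deleted.\<close>

inductive cle :: "'a ctxt \<Rightarrow> 'a ctxt \<Rightarrow> bool" where
  Hole: "fle l l' \<Longrightarrow> fle r r' \<Longrightarrow> cle (Hole l r) (Hole l' r')"
| del: "fle l l' \<Longrightarrow> cle c c' \<Longrightarrow> fle r r' \<Longrightarrow> cle (ctxt_comp (Hole l r) c) (Nest l' a c' r')"
| keep: "fle l l' \<Longrightarrow> cle c c' \<Longrightarrow> fle r r' \<Longrightarrow> cle (Nest l a c r) (Nest l' a c' r')"

abbreviation id_ctxt :: "'a ctxt" where "id_ctxt \<equiv> Hole [] []"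

lemma ctxt_comp_id [simp]: "ctxt_comp p id_ctxt = p" "ctxt_comp id_ctxt p = p"
  by (rule ctxt_comp_one, cases p) auto

lemma cle_refl [simp]: "cle p p"
  by (induction p) (auto intro: cle.intros)

lemma cle_id [simp]: "cle id_ctxt p"
proof (induction p)
  case (Nest l a c r)
  then show ?case using cle.del[of "[]" l id_ctxt c "[]" r a] by simp
qed (auto intro: cle.intros)

lemma cle_around: "fle l l' \<Longrightarrow> cle c c' \<Longrightarrow> fle r r' \<Longrightarrow>
    cle (ctxt_comp (Hole l r) c) (ctxt_comp (Hole l' r') c')"
proof (erule cle.cases, goal_cases)
  case (1 l1 l1' r1 r1')
  then show ?case by (auto intro: cle.Hole fle_append)
next
  case (2 l1 l1' c1 c1' r1 r1' a)
  then have "cle (ctxt_comp (Hole (l @ l1) (r1 @ r)) c1) (Nest (l' @ l1') a c1' (r1' @ r'))"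
    by (intro cle.del fle_append)
  then show ?case using 2 by (simp flip: ctxt_comp_assoc)
next
  case (3 l1 l1' c1 c1' r1 r1' a)
  then show ?case by (auto intro: cle.keep fle_append)
qed

lemma cle_comp: "cle p p' \<Longrightarrow> cle q q' \<Longrightarrow> cle (ctxt_comp p q) (ctxt_comp p' q')"
proof (induction rule: cle.induct)
  case (Hole l l' r r')
  then show ?case by (intro cle_around)
next
  case (del l l' c c' r r' a)
  then show ?case by (auto simp: ctxt_comp_assoc intro: cle.del)
next
  case (keep l l' c c' r r' a)
  then show ?case by (auto intro: cle.keep)
qed

lemma cle_Hole_split:
  "cle p (Hole l r) \<Longrightarrow> \<exists>l' r'. p = Hole l' r' \<and> fle l' l \<and> fle r' r"
  by (auto elim: cle.cases)

lemma cle_around_split: "cle p (ctxt_comp (Hole l r) q) \<Longrightarrow>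
    \<exists>l' r' q'. p = ctxt_comp (Hole l' r') q' \<and> fle l' l \<and> fle r' r \<and> cle q' q"
proof (cases q)
  case (Hole l1 r1)
  assume "cle p (ctxt_comp (Hole l r) q)"
  then obtain l' r' where p: "p = Hole l' r'" "fle l' (l @ l1)" "fle r' (r1 @ r)"
    using Hole cle_Hole_split by fastforce
  from fle_append_split[OF p(2)] fle_append_split[OF p(3)] obtain u u' v v' where
    "l' = u @ u'" "fle u l" "fle u' l1" "r' = v' @ v" "fle v r" "fle v' r1" by blast
  then show ?thesis
    using p Hole by (intro exI[of _ u] exI[of _ v] exI[of _ "Hole u' v'"]) (auto intro: cle.Hole)
next
  case (Nest l1 a c r1)
  assume "cle p (ctxt_comp (Hole l r) q)"
  then have "cle p (Nest (l @ l1) a c (r1 @ r))" using Nest by simp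
  then show ?thesis
  proof cases
    case (del l' c' r')
    from fle_append_split[OF del(2)] fle_append_split[OF del(4)] obtain u u' v v' where
      "l' = u @ u'" "fle u l" "fle u' l1" "r' = v' @ v" "fle v r" "fle v' r1" by blast
    then show ?thesis
      using del Nest
      by (intro exI[of _ u] exI[of _ v] exI[of _ "ctxt_comp (Hole u' v') c'"])
        (auto intro: cle.del simp flip: ctxt_comp_assoc)
  next
    case (keep l' c' r')
    from fle_append_split[OF keep(2)] fle_append_split[OF keep(4)] obtain u u' v v' where
      "l' = u @ u'" "fle u l" "fle u' l1" "r' = v' @ v" "fle v r" "fle v' r1" by blast
    then show ?thesis
      using keep Nest
      by (intro exI[of _ u] exI[of _ v] exI[of _ "Nest u' a c' v'"]) (auto intro: cle.keep)
  qed
qed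

lemma cle_comp_split:
  "cle r (ctxt_comp p q) \<Longrightarrow> \<exists>p' q'. r = ctxt_comp p' q' \<and> cle p' p \<and> cle q' q"
proof (induction p arbitrary: r)
  case (Hole l r0)
  then obtain l' r' q' where "r = ctxt_comp (Hole l' r') q'" "fle l' l" "fle r' r0" "cle q' q"
    using cle_around_split by blast
  then show ?case using cle.Hole by blast
next
  case (Nest l a c r0)
  from Nest.prems have "cle r (Nest l a (ctxt_comp c q) r0)" by simp
  then show ?case
  proof cases
    case (del l' c' r')
    then obtain p' q' where "c' = ctxt_comp p' q'" "cle p' c" "cle q' q" using Nest.IH by blast
    then show ?thesis
      using del by (intro exI[of _ "ctxt_comp (Hole l' r') p'"] exI[of _ q'])
        (auto intro: cle.del simp: ctxt_comp_assoc)
  next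
    case (keep l' c' r')
    then obtain p' q' where "c' = ctxt_comp p' q'" "cle p' c" "cle q' q" using Nest.IH by blast
    then show ?thesis
      using keep by (intro exI[of _ "Nest l' a p' r'"] exI[of _ q']) (auto intro: cle.keep)
  qed
qed

lemma cle_trans: "cle q r \<Longrightarrow> cle p q \<Longrightarrow> cle p r"
proof (induction arbitrary: p rule: cle.induct)
  case (Hole l l' r r')
  then show ?case by (auto dest!: cle_Hole_split intro: cle.Hole fle_trans)
next
  case (del l l' c c' r r' a)
  from cle_around_split[OF del.prems] del show ?case by (auto intro!: cle.del intro: fle_trans)
next
  case (keep l l' c c' r r' a)
  from keep.prems show ?case
    by cases (use keep in \<open>auto intro!: cle.del cle.keep intro: fle_trans\<close>)
qed

lemma fle_plug: "cle p q \<Longrightarrow> fle s t \<Longrightarrow> fle (plug p s) (plug q t)"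
proof (induction rule: cle.induct)
  case (Hole l l' r r')
  then show ?case by (simp add: fle_append)
next
  case (del l l' c c' r r' a)
  then have "fle (l @ plug c s @ r) (l' @ Node a (plug c' t) # r')"
    by (intro fle_append fle.del) auto
  then show ?case by (simp add: plug_ctxt_comp)
next
  case (keep l l' c c' r r' a)
  then show ?case by (simp add: fle_append fle.keep)
qed

lemma fle_plug_split: "fle s (plug p t) \<Longrightarrow> \<exists>p' t'. s = plug p' t' \<and> cle p' p \<and> fle t' t"
proof (induction p arbitrary: s)
  case (Hole l r)
  from fle_append_split[OF Hole.prems[unfolded plug.simps]] obtain u v where
    u: "s = u @ v" "fle u l" "fle v (t @ r)" by blast
  from fle_append_split[OF u(3)] obtain t' v' where "v = t' @ v'" "fle t' t" "fle v' r" by blast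
  then show ?case
    using u by (intro exI[of _ "Hole u v'"] exI[of _ t']) (auto intro: cle.Hole)
next
  case (Nest l a c r)
  from fle_append_split[OF Nest.prems[unfolded plug.simps]] obtain u v where
    u: "s = u @ v" "fle u l" "fle v (Node a (plug c t) # r)" by blast
  from u(3) show ?case
  proof cases
    case (del s1 s2)
    then obtain p' t' where "s1 = plug p' t'" "cle p' c" "fle t' t" using Nest.IH by blast
    then show ?thesis
      using u del by (intro exI[of _ "ctxt_comp (Hole u s2) p'"] exI[of _ t'])
        (auto intro: cle.del simp: plug_ctxt_comp)
  next
    case (keep s1 s2)
    then obtain p' t' where "s1 = plug p' t'" "cle p' c" "fle t' t" using Nest.IH by blast
    then show ?thesis
      using u keep by (intro exI[of _ "Nest u a p' s2"] exI[of _ t']) (auto intro: cle.keep)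
  qed
qed

lemma cle_contexts: "cle p q \<Longrightarrow> q \<in> contexts A \<Longrightarrow> p \<in> contexts A"
  by (induction rule: cle.induct) (auto intro: fle_forests)

text \<open>Unlike \<open>ctxt_nodes\<close>, this counts the nodes on the path to the hole, so that
  \<open>c\<close> is smaller than \<open>Nest l a c r\<close> even when \<open>l\<close> and
  \<open>r\<close> are empty.\<close>

fun ctxt_size :: "'a ctxt \<Rightarrow> nat" where
  "ctxt_size (Hole l r) = nodes l + nodes r"
| "ctxt_size (Nest l a c r) = Suc (nodes l + ctxt_size c + nodes r)"

lemma almost_full_cle:
  assumes "finite A" shows "almost_full cle (contexts A)"
proof (rule almost_full_by_parts[where size_of = ctxt_size])
  show "\<And>x y z. cle x y \<Longrightarrow> cle y z \<Longrightarrow> cle x z" using cle_trans by blast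
  fix f :: "nat \<Rightarrow> 'a ctxt"
  let ?B = "{y \<in> contexts A. \<exists>i. ctxt_size y < ctxt_size (f i) \<and> cle y (f i)}"
  assume f: "range f \<subseteq> contexts A" and B: "almost_full cle ?B"
  \<comment> \<open>Componentwise comparison of these four projections implies \<open>cle\<close>. A
    hole at the root gets the tag \<open>None\<close> and the default inner context
    \<open>id_ctxt\<close>, which may fail to be smaller; hence the extra set
    \<open>{id_ctxt}\<close> below.\<close>
  define tag where "tag p = (case p of Hole l r \<Rightarrow> None | Nest l a c r \<Rightarrow> Some a)" for p :: "'a ctxt"
  define sub where "sub p = (case p of Hole l r \<Rightarrow> id_ctxt | Nest l a c r \<Rightarrow> c)" for p :: "'a ctxt"
  define lft where "lft p = (case p of Hole l r \<Rightarrow> l | Nest l a c r \<Rightarrow> l)" for p :: "'a ctxt"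
  define rgt where "rgt p = (case p of Hole l r \<Rightarrow> r | Nest l a c r \<Rightarrow> r)" for p :: "'a ctxt"
  note defs = tag_def sub_def lft_def rgt_def
  have sub_le: "cle (sub p) p" for p
  proof (cases p)
    case (Nest l a c r)
    then show ?thesis using cle.del[of "[]" l c c "[]" r a] by (simp add: defs)
  qed (simp add: defs)
  have "almost_full cle {id_ctxt :: 'a ctxt}"
  proof (rule almost_fullI)
    fix h :: "nat \<Rightarrow> 'a ctxt"
    assume "range h \<subseteq> {id_ctxt}" and bad: "\<And>i j. i < j \<Longrightarrow> \<not> cle (h i) (h j)"
    then have "h 0 = id_ctxt" by auto
    then show False using bad[of 0 1] by simp
  qed
  then have "almost_full cle (?B \<union> {id_ctxt})" using B almost_full_Un by blast
  moreover have "almost_full (=) (insert None (Some ` A))"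
    using assms by (intro almost_full_finite) simp
  ultimately have "almost_full (\<lambda>x y. fst x = fst y \<and> fle (fst (snd x)) (fst (snd y)) \<and>
      fle (fst (snd (snd x))) (fst (snd (snd y))) \<and> cle (snd (snd (snd x))) (snd (snd (snd y))))
      (insert None (Some ` A) \<times> forests A \<times> forests A \<times> (?B \<union> {id_ctxt}))" (is "almost_full ?le ?S")
    by (intro almost_full_Times almost_full_fle assms)
  moreover define g where "g i = (tag (f i), lft (f i), rgt (f i), sub (f i))" for i
  have "g i \<in> ?S" for i
  proof -
    have fi: "f i \<in> contexts A" using f by auto
    have "sub (f i) \<in> ?B \<union> {id_ctxt}"
    proof (cases "f i")
      case (Nest l a c r)
      then have "sub (f i) = c" "c \<in> contexts A" "ctxt_size c < ctxt_size (f i)"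
        using fi by (simp_all add: defs)
      then show ?thesis using sub_le[of "f i"] by auto
    qed (simp add: defs)
    moreover have "tag (f i) \<in> insert None (Some ` A)" "lft (f i) \<in> forests A" "rgt (f i) \<in> forests A"
      using fi by (cases "f i"; simp add: defs)+
    ultimately show ?thesis unfolding g_def by (intro SigmaI)
  qed
  then have "range g \<subseteq> ?S" by blast
  ultimately obtain i j where "i < j" "?le (g i) (g j)" unfolding almost_full_def by meson
  then have "cle (f i) (f j)"
    by (cases "f i"; cases "f j") (auto simp: g_def defs intro: cle.Hole cle.keep)
  with \<open>i < j\<close> show "\<exists>i j. i < j \<and> cle (f i) (f j)" by blast
qed

lemma down_closed_contexts: "down_closed cle (contexts A)"
  unfolding down_closed_def using cle_contexts by blast

lemma wqo_contexts: "finite A \<Longrightarrow> well_quasi_order cle (contexts A)"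
  using cle_trans by unfold_locales (auto simp: almost_full_cle down_closed_contexts)

section \<open>The path of a context and the forests beside it\<close>

fun left_of :: "'a ctxt \<Rightarrow> 'a forest" where
  "left_of (Hole l r) = l"
| "left_of (Nest l a c r) = l @ left_of c"

fun right_of :: "'a ctxt \<Rightarrow> 'a forest" where
  "right_of (Hole l r) = r"
| "right_of (Nest l a c r) = right_of c @ r"

fun spine :: "'a ctxt \<Rightarrow> 'a set" where
  "spine (Hole l r) = {}"
| "spine (Nest l a c r) = insert a (spine c)"

lemma left_of_comp [simp]: "left_of (ctxt_comp p q) = left_of p @ left_of q"
  and right_of_comp [simp]: "right_of (ctxt_comp p q) = right_of q @ right_of p"
  and spine_comp [simp]: "spine (ctxt_comp p q) = spine p \<union> spine q"
  by (induction p q rule: ctxt_comp.induct) auto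

lemma left_of_mono: "cle p q \<Longrightarrow> fle (left_of p) (left_of q)"
  and right_of_mono: "cle p q \<Longrightarrow> fle (right_of p) (right_of q)"
  and spine_mono: "cle p q \<Longrightarrow> spine p \<subseteq> spine q"
  by (induction rule: cle.induct) (auto intro: fle_append)

lemma fle_sides_plug: "fle (left_of p @ t @ right_of p) (plug p t)"
proof (induction p)
  case (Nest l a c r)
  have "fle ((left_of c @ t @ right_of c) @ r) (Node a (plug c t) # r)"
    using Nest by (intro fle.del) simp_all
  then show ?case by (simp add: fle_append)
qed simp

text \<open>The conditions concern the concatenation of all parts on one side of the path. It is
  what remains after deleting the path and the opposite side, hence a piece of every
  \<open>plug p t\<close>.\<close>

definition side_ctxts :: "'a set \<Rightarrow> 'a set \<Rightarrow> 'a forest set \<Rightarrow> 'a ctxt set" where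
  "side_ctxts A B D = {p \<in> contexts A. spine p \<subseteq> B \<and> left_of p \<in> D \<and> right_of p \<in> D}"

lemma down_closed_side_ctxts: "down_closed fle D \<Longrightarrow> down_closed cle (side_ctxts A B D)"
  unfolding down_closed_def side_ctxts_def
  using cle_contexts left_of_mono right_of_mono spine_mono by blast

text \<open>The end of a shortest prefix in \<open>cut_ctxt\<close>: the path either passes a letter
  there or has reached the innermost \<open>Hole\<close>.\<close>

definition steps :: "'a set \<Rightarrow> 'a ctxt set" where
  "steps A = insert id_ctxt (letter_ctxt ` A)"

lemma cle_letter_ctxt: "cle p (letter_ctxt a) \<Longrightarrow> p = id_ctxt \<or> p = letter_ctxt a"
  unfolding letter_ctxt_def by (erule cle.cases) (auto dest!: cle_Hole_split)

lemma cle_letterD: "q \<in> steps A \<Longrightarrow> cle (letter_ctxt a) q \<Longrightarrow> q = letter_ctxt a"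
  unfolding steps_def using cle_Hole_split[of "letter_ctxt a" "[]" "[]"] cle_letter_ctxt[of "letter_ctxt a"]
  by (fastforce simp: letter_ctxt_def)

lemma down_closed_steps: "down_closed cle (steps A)"
  unfolding down_closed_def steps_def
proof (intro ballI allI impI)
  fix q p :: "'a ctxt" assume "q \<in> insert id_ctxt (letter_ctxt ` A)" "cle p q"
  then show "p \<in> insert id_ctxt (letter_ctxt ` A)"
    using cle_Hole_split[of p "[]" "[]"] cle_letter_ctxt[of p] by auto
qed

lemma steps_contexts: "steps A \<subseteq> contexts A"
  by (auto simp: steps_def letter_ctxt_def)

text \<open>Distinct letters are incomparable, so an ideal of steps has a greatest element: a letter
  or \<open>id_ctxt\<close>.\<close>

lemma tame_steps: "tame cle f (steps A)"
proof (rule tameI)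
  fix D assume D: "D \<subseteq> steps A" "order_ideal cle D"
  show "eventually_constant cle f D"
  proof (cases "\<exists>a. letter_ctxt a \<in> D")
    case True
    then obtain a where "letter_ctxt a \<in> D" ..
    then show ?thesis
      unfolding eventually_constant_def
    proof (intro bexI ballI impI)
      fix q assume "q \<in> D" "cle (letter_ctxt a) q"
      then have "q = letter_ctxt a" using D(1) by (intro cle_letterD[of q A]) auto
      then show "f q = f (letter_ctxt a)" by (rule arg_cong)
    qed
  next
    case False
    then have "D \<subseteq> {id_ctxt}" using D(1) by (auto simp: steps_def)
    moreover have "D \<noteq> {}" using D(2) by (simp add: order_ideal_def)
    ultimately have "D = {id_ctxt}" by blast
    then show ?thesis by (simp add: eventually_constant_def)
  qed
qed

text \<open>The cut is made where \<open>Q\<close> first holds along the path. The layer there, with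
  siblings \<open>Hole l r\<close> and step \<open>y\<close>, is kept apart: the part before it
  fails \<open>Q\<close>, and for \<open>Q\<close> of the form \<open>cle q1\<close> the part after
  it cannot be above \<open>q2\<close> unless the whole is above
  \<open>ctxt_comp q1 q2\<close>.\<close>

lemma cut_ctxt:
  assumes "p \<in> contexts A" "\<not> Q id_ctxt" "Q p"
  shows "\<exists>p' l r y p''. p = ctxt_comp p' (ctxt_comp (Hole l r) (ctxt_comp y p'')) \<and> y \<in> steps A \<and>
    \<not> Q p' \<and> Q (ctxt_comp p' (ctxt_comp (Hole l r) y))"
  using assms
proof (induction p arbitrary: Q)
  case (Hole l r)
  then show ?case
    by (intro exI[of _ id_ctxt] exI[of _ l] exI[of _ r]) (auto simp: steps_def)
next
  case (Nest l a c r)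
  have eq: "Nest l a c r = ctxt_comp (Hole l r) (ctxt_comp (letter_ctxt a) c)"
    by (cases c) (simp_all add: letter_ctxt_def)
  have a: "letter_ctxt a \<in> steps A" using Nest.prems(1) by (simp add: steps_def)
  let ?h = "ctxt_comp (Hole l r) (letter_ctxt a)"
  show ?case
  proof (cases "Q ?h")
    case True
    then show ?thesis
      using Nest.prems(2) a eq
      by (intro exI[of _ id_ctxt] exI[of _ l] exI[of _ r] exI[of _ "letter_ctxt a"] exI[of _ c])
        (simp add: letter_ctxt_def)
  next
    case False
    define R where "R q \<longleftrightarrow> Q (ctxt_comp ?h q)" for q
    have "\<not> R id_ctxt" "R c"
      using False Nest.prems(3) by (simp_all only: R_def ctxt_comp_id ctxt_comp_assoc eq) auto
    moreover have "c \<in> contexts A" using Nest.prems(1) by simp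
    ultimately obtain p' l' r' y p'' where "c = ctxt_comp p' (ctxt_comp (Hole l' r') (ctxt_comp y p''))"
      "y \<in> steps A" "\<not> R p'" "R (ctxt_comp p' (ctxt_comp (Hole l' r') y))"
      using Nest.IH[of R] by blast
    then show ?thesis
      unfolding eq R_def
      by (intro exI[of _ "ctxt_comp ?h p'"] exI[of _ l'] exI[of _ r'] exI[of _ y] exI[of _ p''])
        (simp only: ctxt_comp_assoc simp_thms)
  qed
qed

lemma Hole_comp_eq_letter:
  assumes "ctxt_comp q1 (ctxt_comp (letter_ctxt b) q2) = ctxt_comp (Hole l r) c"
  shows "\<exists>q. q1 = ctxt_comp (Hole l r) q \<and> c = ctxt_comp q (ctxt_comp (letter_ctxt b) q2)"
proof (cases q1)
  case (Hole l1 r1)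
  then show ?thesis
    using assms by (cases c) (auto simp: letter_ctxt_def intro: exI[of _ "Hole _ _"])
next
  case (Nest l1 x q r1)
  then show ?thesis
    using assms by (cases c) (auto intro: exI[of _ "Nest _ _ _ _"])
qed

text \<open>
  A factor \<open>a\<box>\<close> forces the path of a context above \<open>q\<^sub>1 a q\<^sub>2\<close> to split there; without it, as in
  \<open>(g + \<box>) (h + \<box>)\<close>, the two parts could lie in the same tree beside the path.
\<close>

lemma cle_separate:
  "cle (ctxt_comp q1 (ctxt_comp (letter_ctxt b) q2)) s \<Longrightarrow>
    \<exists>s1 s2. s = ctxt_comp s1 s2 \<and> cle q1 s1 \<and> cle q2 s2"
proof (induction s arbitrary: q1)
  case (Hole l r)
  then have "spine (ctxt_comp q1 (ctxt_comp (letter_ctxt b) q2)) \<subseteq> {}" using spine_mono by fastforce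
  then show ?case by (simp add: letter_ctxt_def)
next
  case (Nest l a c r)
  note IH = Nest.IH
  from Nest.prems show ?case
  proof cases
    case (del l' c' r')
    from Hole_comp_eq_letter[OF del(1)] obtain q where
      q: "q1 = ctxt_comp (Hole l' r') q" "c' = ctxt_comp q (ctxt_comp (letter_ctxt b) q2)" by blast
    from Nest.IH[OF del(3)[unfolded q(2)]] obtain s1 s2 where
      "c = ctxt_comp s1 s2" "cle q s1" "cle q2 s2" by blast
    then show ?thesis
      using q(1) del by (intro exI[of _ "Nest l a s1 r"] exI[of _ s2]) (auto intro: cle.del)
  next
    case (keep l' c' r')
    show ?thesis
    proof (cases q1)
      case (Hole l1 r1)
      then have "l1 = l'" "r1 = r'" "q2 = c'" using keep(1) by (simp_all add: letter_ctxt_def)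
      moreover have "cle (ctxt_comp (Hole l' r') id_ctxt) (Nest l a id_ctxt r)"
        using keep by (intro cle.del) simp_all
      ultimately show ?thesis
        using Hole keep by (intro exI[of _ "Nest l a id_ctxt r"] exI[of _ c]) simp
    next
      case (Nest l1 x q r1)
      then have q: "l1 = l'" "r1 = r'" "x = a" "c' = ctxt_comp q (ctxt_comp (letter_ctxt b) q2)"
        using keep(1) by simp_all
      from IH[OF keep(3)[unfolded q(4)]] obtain s1 s2 where
        "c = ctxt_comp s1 s2" "cle q s1" "cle q2 s2" by blast
      then show ?thesis
        using q Nest keep by (intro exI[of _ "Nest l a s1 r"] exI[of _ s2]) (auto intro: cle.keep)
    qed
  qed
qed

lemma append_Cons_eq_append:
  assumes "l @ y # r = s1 @ s2"
  shows "(\<exists>r1. s1 = l @ y # r1 \<and> r = r1 @ s2) \<or> (\<exists>l2. s2 = l2 @ y # r \<and> l = s1 @ l2)"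
  using assms by (auto simp: append_eq_append_conv2 Cons_eq_append_conv append_eq_Cons_conv)

lemma plug_eq_append:
  assumes "plug q [x] = s1 @ s2"
  shows "(\<exists>q1. s1 = plug q1 [x] \<and> q = ctxt_comp (Hole [] s2) q1) \<or>
    (\<exists>q2. s2 = plug q2 [x] \<and> q = ctxt_comp (Hole s1 []) q2)"
proof (cases q)
  case (Hole l r)
  with assms have "l @ x # r = s1 @ s2" by simp
  from append_Cons_eq_append[OF this] show ?thesis
  proof (elim disjE exE conjE)
    fix r1 assume "s1 = l @ x # r1" "r = r1 @ s2"
    then show ?thesis using Hole by (intro disjI1 exI[of _ "Hole l r1"]) simp
  next
    fix l2 assume "s2 = l2 @ x # r" "l = s1 @ l2"
    then show ?thesis using Hole by (intro disjI2 exI[of _ "Hole l2 r"]) simp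
  qed
next
  case (Nest l a c r)
  with assms have "l @ Node a (plug c [x]) # r = s1 @ s2" by simp
  from append_Cons_eq_append[OF this] show ?thesis
  proof (elim disjE exE conjE)
    fix r1 assume "s1 = l @ Node a (plug c [x]) # r1" "r = r1 @ s2"
    then show ?thesis using Nest by (intro disjI1 exI[of _ "Nest l a c r1"]) simp
  next
    fix l2 assume "s2 = l2 @ Node a (plug c [x]) # r" "l = s1 @ l2"
    then show ?thesis using Nest by (intro disjI2 exI[of _ "Nest l2 a c r"]) simp
  qed
qed

text \<open>In contrast to \<open>fle_plug_split\<close>, the larger forest is cut here. This is
  possible because the node \<open>b\<close> survives: it is matched with a node of
  \<open>s\<close>, and \<open>s\<close> is cut at that node.\<close>

lemma fle_plug_tree:
  "fle (plug q [Node b t]) s \<Longrightarrow> \<exists>p u. s = plug p [Node b u] \<and> cle q p \<and> fle t u"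
proof (induction s arbitrary: q rule: forest_induct)
  case Nil
  then have "plug q [Node b t] = []" by simp
  then show ?case by (cases q) simp_all
next
  case (Cons a ts r)
  have "fle (plug q [Node b t]) ([Node a ts] @ r)" using Cons.prems by simp
  from fle_append_split[OF this] obtain v v' where
    v: "plug q [Node b t] = v @ v'" "fle v [Node a ts]" "fle v' r" by blast
  from plug_eq_append[OF v(1)] show ?case
  proof (elim disjE exE conjE)
    fix q2 assume q2: "v' = plug q2 [Node b t]" "q = ctxt_comp (Hole v []) q2"
    then obtain p u where "r = plug p [Node b u]" "cle q2 p" "fle t u" using Cons.IH(2) v(3) by blast
    moreover have "cle (Hole v []) (Hole [Node a ts] [])" using v(2) by (intro cle.Hole) simp_all
    ultimately show ?thesis
      using q2 by (intro exI[of _ "ctxt_comp (Hole [Node a ts] []) p"] exI[of _ u])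
        (auto simp: plug_ctxt_comp intro: cle_comp)
  next
    fix q1 assume q1: "v = plug q1 [Node b t]" "q = ctxt_comp (Hole [] v') q1"
    from v(2) show ?thesis
    proof (cases rule: fle_Node_cases)
      case del
      then obtain p u where "ts = plug p [Node b u]" "cle q1 p" "fle t u" using Cons.IH(1) q1(1) by blast
      then show ?thesis
        using q1 v(3) by (intro exI[of _ "Nest [] a p r"] exI[of _ u]) (auto intro: cle.del)
    next
      case (keep w)
      show ?thesis
      proof (cases q1)
        case (Hole l1 r1)
        then have "l1 = []" "r1 = []" "b = a" "w = t" using q1(1) keep(1) by (cases l1; simp)+
        then show ?thesis
          using Hole q1 keep(2) v(3) by (intro exI[of _ "Hole [] r"] exI[of _ ts]) (auto intro: cle.Hole)
      next
        case (Nest l1 x c r1)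
        then have q1_eq: "l1 = []" "r1 = []" "x = a" "w = plug c [Node b t]"
          using q1(1) keep(1) by (cases l1; simp)+
        then obtain p u where "ts = plug p [Node b u]" "cle c p" "fle t u" using Cons.IH(1) keep(2) by blast
        then show ?thesis
          using q1(2) q1_eq(1-3) Nest v(3)
          by (intro exI[of _ "Nest [] a p r"] exI[of _ u]) (auto intro: cle.keep)
      qed
    qed
  qed
qed

text \<open>The counterpart of \<open>cle_separate\<close> for concatenation: as \<open>x\<close>
  fits into no tree of \<open>s\<close>, nothing of \<open>q1\<close> shares a tree with anything of
  \<open>q2\<close>, and \<open>s\<close> can be cut between two trees.\<close>

lemma fle_separate:
  assumes "fle (q1 @ x @ q2) s" "\<And>y. y \<in> set s \<Longrightarrow> \<not> fle x [y]"
  shows "\<exists>s1 s2. s = s1 @ s2 \<and> fle q1 s1 \<and> fle q2 s2"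
  using assms
proof (induction s arbitrary: q1 rule: list.induct)
  case (Cons y r)
  have "fle (q1 @ x @ q2) ([y] @ r)" using Cons.prems(1) by simp
  from fle_append_split[OF this] obtain v v' where
    v: "q1 @ x @ q2 = v @ v'" "fle v [y]" "fle v' r" by blast
  from v(1) consider q where "q1 = v @ q" "v' = q @ x @ q2"
    | w w' where "v = q1 @ w" "x = w @ w'" "v' = w' @ q2" | w where "v = q1 @ x @ w"
    by (auto simp: append_eq_append_conv2)
  then show ?case
  proof cases
    case 1
    then obtain s1 s2 where "r = s1 @ s2" "fle q s1" "fle q2 s2"
      using Cons.IH[of q] Cons.prems(2) v(3) by auto
    then show ?thesis
      using 1 v(2) fle_append[of v "[y]" q s1] by (intro exI[of _ "y # s1"] exI[of _ s2]) auto
  next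
    case 2
    have "fle q1 v" "fle q2 v'"
      using 2 fle_append[of q1 q1 "[]" w] fle_append[of "[]" w' q2 q2] by simp_all
    then show ?thesis using v fle_trans by (intro exI[of _ "[y]"] exI[of _ r]) auto
  next
    case 3
    have "fle x (x @ w)" using fle_append[of x x "[]" w] by simp
    then have "fle x v" using 3 fle_append[of "[]" q1 x "x @ w"] by simp
    then have "fle x [y]" using fle_trans[OF v(2)] by blast
    then show ?thesis using Cons.prems(2)[of y] by simp
  qed
qed auto

section \<open>Languages recognised by a finite forest algebra\<close>

locale recognized_language = forest_algebra_morphism "free_forest_algebra A" F \<phi> \<psi>
  for A :: "'a set" and F :: "('h, 'v) forest_algebra" and \<phi> \<psi> +
  fixes X :: "'h set"
  assumes finite_A: "finite A"
    and finite_hor: "finite (carrier (hor F))"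
    and finite_ver: "finite (carrier (ver F))"
begin

definition L where "L = {t \<in> forests A. \<phi> t \<in> X}"

sublocale H: monoid "hor F" by (rule target.hor_monoid)
sublocale V: monoid "ver F" by (rule target.ver_monoid)

lemma \<phi>_closed [simp]: "t \<in> forests A \<Longrightarrow> \<phi> t \<in> carrier (hor F)"
  using hom_in_carrier[OF hor_hom, of t] by (simp add: free_forest_algebra_def)

lemma \<psi>_closed [simp]: "p \<in> contexts A \<Longrightarrow> \<psi> p \<in> carrier (ver F)"
  using hom_in_carrier[OF ver_hom, of p] by (simp add: free_forest_algebra_def)

lemma \<phi>_Nil [simp]: "\<phi> [] = \<one>\<^bsub>hor F\<^esub>"
  using hor_one by (simp add: free_forest_algebra_def)

lemma \<psi>_id [simp]: "\<psi> id_ctxt = \<one>\<^bsub>ver F\<^esub>"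
  using ver_one by (simp add: free_forest_algebra_def)

lemma \<phi>_append: "s \<in> forests A \<Longrightarrow> t \<in> forests A \<Longrightarrow> \<phi> (s @ t) = \<phi> s \<otimes>\<^bsub>hor F\<^esub> \<phi> t"
  using hom_mult[OF hor_hom, of s t] by (simp add: free_forest_algebra_def)

lemma \<psi>_comp: "p \<in> contexts A \<Longrightarrow> q \<in> contexts A \<Longrightarrow> \<psi> (ctxt_comp p q) = \<psi> p \<otimes>\<^bsub>ver F\<^esub> \<psi> q"
  using hom_mult[OF ver_hom, of p q] by (simp add: free_forest_algebra_def)

lemma \<phi>_plug: "p \<in> contexts A \<Longrightarrow> t \<in> forests A \<Longrightarrow> \<phi> (plug p t) = act F (\<psi> p) (\<phi> t)"
  using morph_act[of p t] by (simp add: free_forest_algebra_def)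

lemma \<psi>_inl: "t \<in> forests A \<Longrightarrow> \<psi> (Hole t []) = inl F (\<phi> t)"
  and \<psi>_inr: "t \<in> forests A \<Longrightarrow> \<psi> (Hole [] t) = inr F (\<phi> t)"
  using morph_inl[of t] morph_inr[of t] by (simp_all add: free_forest_algebra_def)

text \<open>A syntactic class is represented by the surroundings that lead into \<open>L\<close>, so
  equality of these sets is the syntactic congruence and no quotient algebra has to be
  formed.\<close>

definition forest_class where
  "forest_class t = {p \<in> contexts A. plug p t \<in> L}"

definition ctxt_class where
  "ctxt_class q = {(p, t). p \<in> contexts A \<and> t \<in> forests A \<and> plug p (plug q t) \<in> L}"

lemma forest_class_if_\<phi>_eq:
  "s \<in> forests A \<Longrightarrow> t \<in> forests A \<Longrightarrow> \<phi> s = \<phi> t \<Longrightarrow> forest_class s = forest_class t"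
  unfolding forest_class_def L_def by (auto simp: \<phi>_plug)

lemma ctxt_class_if_\<psi>_eq:
  "p \<in> contexts A \<Longrightarrow> q \<in> contexts A \<Longrightarrow> \<psi> p = \<psi> q \<Longrightarrow> ctxt_class p = ctxt_class q"
  unfolding ctxt_class_def L_def by (auto simp: \<phi>_plug)

lemma mem_L_cong: "forest_class s = forest_class t \<Longrightarrow> p \<in> contexts A \<Longrightarrow> plug p s \<in> L \<longleftrightarrow> plug p t \<in> L"
  unfolding forest_class_def by blast

lemma plug_mem_L_cong: "ctxt_class q = ctxt_class q' \<Longrightarrow> p \<in> contexts A \<Longrightarrow> t \<in> forests A \<Longrightarrow>
    plug p (plug q t) \<in> L \<longleftrightarrow> plug p (plug q' t) \<in> L"
  unfolding ctxt_class_def by blast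

lemma forest_class_plug:
  assumes "q \<in> contexts A" "q' \<in> contexts A" "t \<in> forests A" "t' \<in> forests A"
    and "ctxt_class q = ctxt_class q'" "forest_class t = forest_class t'"
  shows "forest_class (plug q t) = forest_class (plug q' t')"
proof -
  have "plug p (plug q t) \<in> L \<longleftrightarrow> plug p (plug q' t') \<in> L" if "p \<in> contexts A" for p
    using plug_mem_L_cong[OF assms(5) that assms(3)] mem_L_cong[OF assms(6), of "ctxt_comp p q'"] that assms
    by (simp add: plug_ctxt_comp)
  then show ?thesis unfolding forest_class_def by blast
qed

lemma ctxt_class_comp:
  assumes "p \<in> contexts A" "p' \<in> contexts A" "q \<in> contexts A" "q' \<in> contexts A"
    and "ctxt_class p = ctxt_class p'" "ctxt_class q = ctxt_class q'"
  shows "ctxt_class (ctxt_comp p q) = ctxt_class (ctxt_comp p' q')"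
proof -
  have "plug c (plug (ctxt_comp p q) t) \<in> L \<longleftrightarrow> plug c (plug (ctxt_comp p' q') t) \<in> L"
    if "c \<in> contexts A" "t \<in> forests A" for c t
    using plug_mem_L_cong[OF assms(5) that(1), of "plug q t"]
      plug_mem_L_cong[OF assms(6), of "ctxt_comp c p'" t] that assms
    by (simp add: plug_ctxt_comp)
  then show ?thesis unfolding ctxt_class_def by blast
qed

lemma forest_class_append:
  assumes "s \<in> forests A" "s' \<in> forests A" "t \<in> forests A" "t' \<in> forests A"
    and "forest_class s = forest_class s'" "forest_class t = forest_class t'"
  shows "forest_class (s @ t) = forest_class (s' @ t')"
proof -
  have "plug c (s @ t) \<in> L \<longleftrightarrow> plug c (s' @ t') \<in> L" if "c \<in> contexts A" for c
    using mem_L_cong[OF assms(5), of "ctxt_comp c (Hole [] t)"]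
      mem_L_cong[OF assms(6), of "ctxt_comp c (Hole s' [])"] that assms
    by (simp add: plug_ctxt_comp)
  then show ?thesis unfolding forest_class_def by blast
qed

lemma ctxt_class_Hole:
  assumes "s \<in> forests A" "s' \<in> forests A" "t \<in> forests A" "t' \<in> forests A"
    and "forest_class s = forest_class s'" "forest_class t = forest_class t'"
  shows "ctxt_class (Hole s t) = ctxt_class (Hole s' t')"
proof -
  have "plug c (s @ u @ t) \<in> L \<longleftrightarrow> plug c (s' @ u @ t') \<in> L" if "c \<in> contexts A" "u \<in> forests A" for c u
    using mem_L_cong[OF assms(5), of "ctxt_comp c (Hole [] (u @ t))"]
      mem_L_cong[OF assms(6), of "ctxt_comp c (Hole (s' @ u) [])"] that assms
    by (simp add: plug_ctxt_comp)
  then show ?thesis unfolding ctxt_class_def by auto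
qed

section \<open>Tameness under composition, substitution and formation of holes\<close>

lemma wqo_sub_contexts: "down_closed cle P \<Longrightarrow> P \<subseteq> contexts A \<Longrightarrow> well_quasi_order cle P"
  using well_quasi_order.subset[OF wqo_contexts[OF finite_A]] .

lemma wqo_sub_forests: "down_closed fle D \<Longrightarrow> D \<subseteq> forests A \<Longrightarrow> well_quasi_order fle D"
  using well_quasi_order.subset[OF wqo_forests[OF finite_A]] .

lemma tame_comp:
  assumes "down_closed cle P" "P \<subseteq> contexts A" "down_closed cle Q" "Q \<subseteq> contexts A"
    and "tame cle ctxt_class P" "tame cle ctxt_class Q"
    and "T \<subseteq> (\<lambda>(p, q). ctxt_comp p q) ` (P \<times> Q)"
  shows "tame cle ctxt_class T"
proof (rule tame_image2[OF wqo_sub_contexts[OF assms(1,2)] wqo_sub_contexts[OF assms(3,4)] _ _ _ assms(5-7)])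
  fix p p' q q'
  assume "p \<in> P" "p' \<in> P" "q \<in> Q" "q' \<in> Q" "ctxt_class p = ctxt_class p'" "ctxt_class q = ctxt_class q'"
  then show "ctxt_class (ctxt_comp p q) = ctxt_class (ctxt_comp p' q')"
    using assms(2,4) by (intro ctxt_class_comp) (simp_all add: subset_iff)
qed (simp_all add: cle_comp cle_comp_split)

lemma tame_plug:
  assumes "down_closed cle P" "P \<subseteq> contexts A" "down_closed fle D" "D \<subseteq> forests A"
    and "tame cle ctxt_class P" "tame fle forest_class D"
    and "T \<subseteq> (\<lambda>(p, t). plug p t) ` (P \<times> D)"
  shows "tame fle forest_class T"
proof (rule tame_image2[OF wqo_sub_contexts[OF assms(1,2)] wqo_sub_forests[OF assms(3,4)] _ _ _ assms(5-7)])
  fix p p' t t'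
  assume "p \<in> P" "p' \<in> P" "t \<in> D" "t' \<in> D" "ctxt_class p = ctxt_class p'" "forest_class t = forest_class t'"
  then show "forest_class (plug p t) = forest_class (plug p' t')"
    using assms(2,4) by (intro forest_class_plug) (simp_all add: subset_iff)
qed (simp_all add: fle_plug fle_plug_split)

lemma tame_Hole:
  assumes "down_closed fle D" "D \<subseteq> forests A" "tame fle forest_class D"
    and "T \<subseteq> (\<lambda>(l, r). Hole l r) ` (D \<times> D)"
  shows "tame cle ctxt_class T"
proof (rule tame_image2[OF wqo_sub_forests[OF assms(1,2)] wqo_sub_forests[OF assms(1,2)] _ _ _ assms(3,3,4)])
  fix l l' r r'
  assume "l \<in> D" "l' \<in> D" "r \<in> D" "r' \<in> D" "forest_class l = forest_class l'" "forest_class r = forest_class r'"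
  then show "ctxt_class (Hole l r) = ctxt_class (Hole l' r')"
    using assms(2) by (intro ctxt_class_Hole) (simp_all add: subset_iff)
qed (simp_all add: cle.Hole cle_Hole_split)

text \<open>
  The identities \<open>v\<^sup>\<omega> u = v\<^sup>\<omega> = u v\<^sup>\<omega>\<close> of the syntactic algebra, for all pieces \<open>u\<close> of \<open>v\<close>. As \<open>u\<close> is also a
  piece of every power of \<open>v\<close>, idempotents \<open>e\<close> in place of \<open>v\<close> suffice.
\<close>

definition absorbing :: bool where
  "absorbing \<longleftrightarrow> (\<forall>u \<in> contexts A. \<forall>e \<in> contexts A. \<forall>p \<in> contexts A. \<forall>t \<in> forests A.
     cle u e \<longrightarrow> \<psi> (ctxt_comp e e) = \<psi> e \<longrightarrow>
     (plug p (plug e (plug u t)) \<in> L \<longleftrightarrow> plug p (plug e t) \<in> L) \<and>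
     (plug p (plug u (plug e t)) \<in> L \<longleftrightarrow> plug p (plug e t) \<in> L))"

lemma absorbing_ctxt:
  assumes "absorbing" "u \<in> contexts A" "e \<in> contexts A" "cle u e" "\<psi> (ctxt_comp e e) = \<psi> e"
  shows "ctxt_class (ctxt_comp e u) = ctxt_class e \<and> ctxt_class (ctxt_comp u e) = ctxt_class e"
proof -
  have *: "(plug p (plug e (plug u t)) \<in> L \<longleftrightarrow> plug p (plug e t) \<in> L) \<and>
     (plug p (plug u (plug e t)) \<in> L \<longleftrightarrow> plug p (plug e t) \<in> L)"
    if "p \<in> contexts A" "t \<in> forests A" for p t
    using assms(1)[unfolded absorbing_def] assms(2-5) that by blast
  then show ?thesis unfolding ctxt_class_def by (auto simp: plug_ctxt_comp)
qed

text \<open>Concatenation of forests is composition of contexts \<open>Hole e []\<close>; plugging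
  in the empty forest turns the context identities into forest identities.\<close>

lemma absorbing_forest:
  assumes "absorbing" "u \<in> forests A" "e \<in> forests A" "fle u e" "\<phi> (e @ e) = \<phi> e"
  shows "forest_class (e @ u) = forest_class e \<and> forest_class (u @ e) = forest_class e"
proof -
  have "\<psi> (ctxt_comp (Hole e []) (Hole e [])) = \<psi> (Hole e [])"
    using assms by (simp add: \<psi>_inl)
  moreover have "cle (Hole u []) (Hole e [])" using assms(4) by (intro cle.Hole) auto
  ultimately have *: "ctxt_class (Hole (e @ u) []) = ctxt_class (Hole e [])"
    "ctxt_class (Hole (u @ e) []) = ctxt_class (Hole e [])"
    using absorbing_ctxt[OF assms(1), of "Hole u []" "Hole e []"] assms by simp_all
  have "forest_class (plug (Hole s []) []) = forest_class (plug (Hole e []) [])"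
    if "s \<in> forests A" "ctxt_class (Hole s []) = ctxt_class (Hole e [])" for s
    using that assms(3) by (intro forest_class_plug) simp_all
  from this[OF _ *(1)] this[OF _ *(2)] show ?thesis using assms by simp
qed

lemma finite_\<psi>_image: "P \<subseteq> contexts A \<Longrightarrow> finite (\<psi> ` P)"
  by (rule finite_subset[OF _ finite_ver]) auto

lemma finite_\<phi>_image: "D \<subseteq> forests A \<Longrightarrow> finite (\<phi> ` D)"
  by (rule finite_subset[OF _ finite_hor]) auto

text \<open>The letter \<open>b\<close> is the separator that the product argument asks for;
  down-closure puts the two factors it produces back into \<open>P\<close>.\<close>

lemma eventually_constant_closed_ctxts:
  assumes "absorbing" and P: "order_ideal cle P" "P \<subseteq> contexts A"
    and closed: "\<And>p q. p \<in> P \<Longrightarrow> q \<in> P \<Longrightarrow> ctxt_comp p q \<in> P"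
    and b: "letter_ctxt b \<in> P"
  shows "eventually_constant cle ctxt_class P"
proof (rule eventually_constant_if_absorbing[where mult = ctxt_comp and \<gamma> = \<psi> and w = "letter_ctxt b"])
  fix q1 q2 s
  assume s: "s \<in> P" "cle (ctxt_comp (ctxt_comp q1 (letter_ctxt b)) q2) s"
  then obtain s1 s2 where s12: "s = ctxt_comp s1 s2" "cle q1 s1" "cle q2 s2"
    using cle_separate by (metis ctxt_comp_assoc)
  have "cle s1 s" "cle s2 s"
    using cle_comp[of s1 s1 id_ctxt s2] cle_comp[of id_ctxt s1 s2 s2] s12(1) by simp_all
  then have "s1 \<in> P" "s2 \<in> P" using s(1) order_ideal_down_closed[OF P(1)] down_closedD by metis+
  then show "\<exists>s1 s2. s = ctxt_comp s1 s2 \<and> s1 \<in> P \<and> s2 \<in> P \<and> cle q1 s1 \<and> cle q2 s2"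
    using s12 by blast
next
  fix p q assume "p \<in> P" "q \<in> P"
  then show "cle p (ctxt_comp p q)" using cle_comp[of p p id_ctxt q] by simp
next
  fix u e assume "u \<in> P" "e \<in> P" "cle u e" "\<psi> (ctxt_comp e e) = \<psi> e"
  then show "ctxt_class (ctxt_comp e u) = ctxt_class e \<and> ctxt_class (ctxt_comp u e) = ctxt_class e"
    using absorbing_ctxt[OF assms(1)] P(2) by blast
next
  fix p p' q q'
  assume "p \<in> P" "p' \<in> P" "q \<in> P" "q' \<in> P" "ctxt_class p = ctxt_class p'" "ctxt_class q = ctxt_class q'"
  then show "ctxt_class (ctxt_comp p q) = ctxt_class (ctxt_comp p' q')"
    using P(2) by (intro ctxt_class_comp) (simp_all add: subset_iff)
next
  fix p q assume "p \<in> P" "q \<in> P" "\<psi> p = \<psi> q"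
  then show "ctxt_class p = ctxt_class q" using P(2) by (intro ctxt_class_if_\<psi>_eq) auto
qed (use P b in \<open>auto simp: ctxt_comp_assoc finite_\<psi>_image \<psi>_comp subset_iff closed intro: cle_trans\<close>)

lemma eventually_constant_closed_forests:
  assumes "absorbing" and D: "order_ideal fle D" "D \<subseteq> forests A"
    and closed: "\<And>s t. s \<in> D \<Longrightarrow> t \<in> D \<Longrightarrow> s @ t \<in> D"
    and x: "x \<in> D" "\<And>y. [y] \<in> D \<Longrightarrow> \<not> fle x [y]"
  shows "eventually_constant fle forest_class D"
proof (rule eventually_constant_if_absorbing[where mult = "(@)" and \<gamma> = \<phi> and w = x])
  fix q1 q2 s
  assume s: "s \<in> D" "fle ((q1 @ x) @ q2) s"
  have "\<not> fle x [y]" if y: "y \<in> set s" for y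
  proof -
    obtain l r where "s = l @ [y] @ r" using split_list[OF y] by auto
    then have "fle [y] s" using fle_append[of "[]" l "[y]" "[y] @ r"] fle_append[of "[y]" "[y]" "[]" r] by simp
    then show ?thesis using x(2) s(1) order_ideal_down_closed[OF D(1)] down_closedD by metis
  qed
  then obtain s1 s2 where s12: "s = s1 @ s2" "fle q1 s1" "fle q2 s2"
    using fle_separate[of q1 x q2 s] s(2) by auto
  have "fle s1 s" "fle s2 s"
    using fle_append[of s1 s1 "[]" s2] fle_append[of "[]" s1 s2 s2] s12(1) by simp_all
  then have "s1 \<in> D" "s2 \<in> D" using s(1) order_ideal_down_closed[OF D(1)] down_closedD by metis+
  then show "\<exists>s1 s2. s = s1 @ s2 \<and> s1 \<in> D \<and> s2 \<in> D \<and> fle q1 s1 \<and> fle q2 s2"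
    using s12 by blast
next
  fix p q assume "p \<in> D" "q \<in> D"
  then show "fle p (p @ q)" using fle_append[of p p "[]" q] by simp
next
  fix u e assume "u \<in> D" "e \<in> D" "fle u e" "\<phi> (e @ e) = \<phi> e"
  then show "forest_class (e @ u) = forest_class e \<and> forest_class (u @ e) = forest_class e"
    using absorbing_forest[OF assms(1)] D(2) by blast
next
  fix s s' t t'
  assume "s \<in> D" "s' \<in> D" "t \<in> D" "t' \<in> D" "forest_class s = forest_class s'" "forest_class t = forest_class t'"
  then show "forest_class (s @ t) = forest_class (s' @ t')"
    using D(2) by (intro forest_class_append) (simp_all add: subset_iff)
next
  fix s t assume "s \<in> D" "t \<in> D" "\<phi> s = \<phi> t"
  then show "forest_class s = forest_class t" using D(2) by (intro forest_class_if_\<phi>_eq) auto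
qed (use D x in \<open>auto simp: finite_\<phi>_image \<phi>_append subset_iff closed intro: fle_trans\<close>)

end

section \<open>Path decompositions and the induction over ideals\<close>

lemma cle_comp_left: "cle p (ctxt_comp p q)" and cle_comp_right: "cle q (ctxt_comp p q)"
  using cle_comp[of p p id_ctxt q] cle_comp[of id_ctxt p q q] by simp_all

lemma fle_append_left: "fle s (s @ t)" and fle_append_right: "fle t (s @ t)"
  using fle_append[of s s "[]" t] fle_append[of "[]" s t t] by simp_all

lemma fle_plug_hole: "fle t (plug p t)"
  using fle_plug[of id_ctxt p t t] by simp

lemma fle_left_plug: "fle (left_of p @ t) (plug p t)" and fle_right_plug: "fle (t @ right_of p) (plug p t)"
  using fle_trans[OF fle_sides_plug[of p t], of "left_of p @ t"]
    fle_append_left[of "left_of p @ t" "right_of p"]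
    fle_trans[OF fle_sides_plug[of p t] fle_append_right] by simp_all

lemma fle_left_of: "fle (left_of p) (plug p t)" and fle_right_of: "fle (right_of p) (plug p t)"
  using fle_trans[OF fle_left_plug fle_append_left] fle_trans[OF fle_right_plug fle_append_right] .

lemma cle_letter_Nest: "cle (letter_ctxt a) (Nest l a c r)"
  unfolding letter_ctxt_def by (intro cle.keep) simp_all

lemma down_closed_comp:
  assumes "down_closed cle P" "down_closed cle Q"
  shows "down_closed cle ((\<lambda>(p, q). ctxt_comp p q) ` (P \<times> Q))"
  unfolding down_closed_def
proof (intro ballI allI impI)
  fix c r assume "c \<in> (\<lambda>(p, q). ctxt_comp p q) ` (P \<times> Q)" and r: "cle r c"
  then obtain p q where pq: "p \<in> P" "q \<in> Q" "c = ctxt_comp p q" by auto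
  obtain p' q' where "r = ctxt_comp p' q'" "cle p' p" "cle q' q"
    using cle_comp_split[OF r[unfolded pq(3)]] by blast
  then show "r \<in> (\<lambda>(p, q). ctxt_comp p q) ` (P \<times> Q)"
    using down_closedD[OF assms(1) pq(1)] down_closedD[OF assms(2) pq(2)]
    by (intro image_eqI[of _ _ "(p', q')"]) simp_all
qed

lemma down_closed_plug:
  assumes "down_closed cle P" "down_closed fle D"
  shows "down_closed fle ((\<lambda>(p, t). plug p t) ` (P \<times> D))"
  unfolding down_closed_def
proof (intro ballI allI impI)
  fix c r assume "c \<in> (\<lambda>(p, t). plug p t) ` (P \<times> D)" and r: "fle r c"
  then obtain p t where pt: "p \<in> P" "t \<in> D" "c = plug p t" by auto
  obtain p' t' where "r = plug p' t'" "cle p' p" "fle t' t"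
    using fle_plug_split[OF r[unfolded pt(3)]] by blast
  then show "r \<in> (\<lambda>(p, t). plug p t) ` (P \<times> D)"
    using down_closedD[OF assms(1) pt(1)] down_closedD[OF assms(2) pt(2)]
    by (intro image_eqI[of _ _ "(p', t')"]) simp_all
qed

lemma down_closed_Hole:
  assumes "down_closed fle D"
  shows "down_closed cle ((\<lambda>(l, r). Hole l r) ` (D \<times> D))"
  unfolding down_closed_def
proof (intro ballI allI impI)
  fix c p assume "c \<in> (\<lambda>(l, r). Hole l r) ` (D \<times> D)" and p: "cle p c"
  then obtain l r where lr: "l \<in> D" "r \<in> D" "c = Hole l r" by auto
  obtain l' r' where "p = Hole l' r'" "fle l' l" "fle r' r"
    using cle_Hole_split[OF p[unfolded lr(3)]] by blast
  then show "p \<in> (\<lambda>(l, r). Hole l r) ` (D \<times> D)"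
    using down_closedD[OF assms lr(1)] down_closedD[OF assms lr(2)]
    by (intro image_eqI[of _ _ "(l', r')"]) simp_all
qed

lemma least_prefix:
  assumes "fle x s" "x \<noteq> []"
  shows "\<exists>u y v. s = u @ y # v \<and> \<not> fle x u \<and> fle x (u @ [y])"
  using assms
proof (induction s rule: rev_induct)
  case (snoc y s)
  show ?case
  proof (cases "fle x s")
    case True
    then obtain u z v where "s = u @ z # v" "\<not> fle x u" "fle x (u @ [z])" using snoc by blast
    then show ?thesis by (intro exI[of _ u] exI[of _ z] exI[of _ "v @ [y]"]) simp
  next
    case False
    then show ?thesis using snoc.prems by (intro exI[of _ s] exI[of _ y] exI[of _ "[]"]) simp
  qed
qed simp

text \<open>
  If \<open>xx\<close> is not a piece of \<open>s\<close>, then the nodes whose subtrees contain \<open>x\<close> form a path; \<open>p\<close> follows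
  it to its end.
\<close>

lemma spine_decomposition:
  assumes "fle x s" "\<not> fle (x @ x) s" "x \<noteq> []"
  shows "\<exists>p q t. s = plug p (plug q t) \<and> fle x (plug q t) \<and> \<not> fle x t \<and>
    \<not> fle x (left_of q) \<and> \<not> fle x (right_of q)"
  using assms(1,2)
proof (induction s rule: measure_induct_rule[of nodes])
  case (less s)
  show ?case
  proof (cases "\<exists>y\<in>set s. fle x [y]")
    case True
    then obtain y where y: "y \<in> set s" "fle x [y]" by blast
    obtain l r where "s = l @ y # r" using split_list[OF y(1)] by blast
    moreover obtain b s' where "y = Node b s'" by (cases y)
    ultimately have s: "s = l @ Node b s' # r" by simp
    show ?thesis
    proof (cases "fle x s'")
      case True
      have "fle s' s" using fle_plug_hole[of s' "Nest l b id_ctxt r"] s by simp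
      then have "\<not> fle (x @ x) s'" using less.prems(2) fle_trans by blast
      moreover have "nodes s' < nodes s"
        by (simp add: s nodes_append nodes_Cons nodes_tree_Node del: nodes_tree.simps)
      ultimately obtain p q t where "s' = plug p (plug q t)" "fle x (plug q t)" "\<not> fle x t"
        "\<not> fle x (left_of q)" "\<not> fle x (right_of q)" using less.IH[OF _ True] by blast
      then show ?thesis
        by (intro exI[of _ "Nest l b p r"] exI[of _ q] exI[of _ t]) (simp add: s)
    next
      \<comment> \<open>The tree contains \<open>x\<close> but the forest of its children does not,
        so the path ends at the node \<open>b\<close>.\<close>
      case False
      then show ?thesis
        using y(2) \<open>y = Node b s'\<close> assms(3)
        by (intro exI[of _ "Hole l r"] exI[of _ "letter_ctxt b"] exI[of _ s'])
          (simp add: s letter_ctxt_def)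
    qed
  next
    case False
    \<comment> \<open>Here \<open>x\<close> is spread over several trees. The prefix ending in
      \<open>y\<close> is the shortest one containing \<open>x\<close>, so \<open>u\<close> avoids
      \<open>x\<close>; \<open>v\<close> avoids it because \<open>x @ x\<close> would otherwise be a
      piece, and \<open>[y]\<close> does so by the case assumption.\<close>
    obtain u y v where s: "s = u @ y # v" "\<not> fle x u" "fle x (u @ [y])"
      using least_prefix[OF less.prems(1) assms(3)] by blast
    have "\<not> fle x v" using fle_append[OF s(3), of x v] less.prems(2) s(1) by auto
    then show ?thesis
      using s less.prems(1) False
      by (intro exI[of _ id_ctxt] exI[of _ "Hole u v"] exI[of _ "[y]"]) simp
  qed
qed

context recognized_language
begin

text \<open>If \<open>P\<close> is closed under composition, it either contains a letter to separate
  factors or consists of root holes with sides in \<open>D\<close>. Otherwise some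
  \<open>q1\<close>, \<open>q2\<close> in \<open>P\<close> have their composite outside
  \<open>P\<close>, and cutting at the first prefix above \<open>q1\<close> leaves a rest not above
  \<open>q2\<close>. So \<open>P\<close> lies in a composite of two smaller sets with one layer
  between them, and tameness of the factors carries over.\<close>

lemma tame_side_ctxts:
  assumes absorbing and D: "down_closed fle D" "D \<subseteq> forests A" "tame fle forest_class D"
  shows "tame cle ctxt_class (side_ctxts A A D)"
proof -
  interpret C: well_quasi_order cle "contexts A" by (rule wqo_contexts[OF finite_A])
  have "P \<subseteq> side_ctxts A A D \<longrightarrow> order_ideal cle P \<longrightarrow> eventually_constant cle ctxt_class P"
    if "down_closed cle P" "P \<subseteq> contexts A" for P
    using that
  proof (induction P rule: C.down_closed_induct)
    case (less P)
    have smaller: "tame cle ctxt_class E" if "E \<subset> P" "P \<subseteq> side_ctxts A A D" for E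
    proof (rule tameI)
      fix I assume "I \<subseteq> E" "order_ideal cle I"
      then show "eventually_constant cle ctxt_class I"
        using less.IH[of I] order_ideal_down_closed[of cle I] that by blast
    qed
    show ?case
    proof (intro impI)
      assume sides: "P \<subseteq> side_ctxts A A D" and ideal: "order_ideal cle P"
      show "eventually_constant cle ctxt_class P"
      proof (cases "\<forall>p\<in>P. \<forall>q\<in>P. ctxt_comp p q \<in> P")
        case True
        show ?thesis
        proof (cases "\<exists>b. letter_ctxt b \<in> P")
          case True
          then obtain b where "letter_ctxt b \<in> P" ..
          then show ?thesis
            using \<open>\<forall>p\<in>P. \<forall>q\<in>P. ctxt_comp p q \<in> P\<close>
              eventually_constant_closed_ctxts[OF assms(1) ideal less.hyps(2)] by blast
        next
          case False
          have "p \<in> (\<lambda>(l, r). Hole l r) ` (D \<times> D)" if p: "p \<in> P" for p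
          proof (cases p)
            case (Hole l r)
            then have "l \<in> D" "r \<in> D" using p sides by (auto simp: side_ctxts_def)
            then show ?thesis using Hole by (intro image_eqI[of _ _ "(l, r)"]) simp_all
          next
            case (Nest l a c r)
            then have "letter_ctxt a \<in> P" using down_closedD[OF less.hyps(1) p] cle_letter_Nest[of a l c r] by simp
            then show ?thesis using False by blast
          qed
          then have "P \<subseteq> (\<lambda>(l, r). Hole l r) ` (D \<times> D)" by blast
          then have "tame cle ctxt_class P" by (rule tame_Hole[OF D])
          then show ?thesis using ideal by (rule tameD[OF _ subset_refl])
        qed
      next
        case False
        then obtain q1 q2 where q: "q1 \<in> P" "q2 \<in> P" "ctxt_comp q1 q2 \<notin> P" by blast
        have not_id: "\<not> cle q1 id_ctxt" "\<not> cle q2 id_ctxt"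
          using q cle_Hole_split[of q1 "[]" "[]"] cle_Hole_split[of q2 "[]" "[]"] by auto
        have id: "id_ctxt \<in> P" using down_closedD[OF less.hyps(1) q(1)] by simp
        then have "[] \<in> D" using sides by (auto simp: side_ctxts_def)
        define P' where "P' q = {p \<in> P. \<not> cle q p}" for q
        have P': "down_closed cle (P' q)" "P' q \<subseteq> contexts A" "tame cle ctxt_class (P' q)" if "q \<in> P" for q
        proof -
          show "down_closed cle (P' q)"
            unfolding P'_def by (rule C.down_closed_minus_above[OF less.hyps(1)])
          have "q \<notin> P' q" "P' q \<subseteq> P" by (auto simp: P'_def)
          then have "P' q \<subset> P" using that by blast
          then show "tame cle ctxt_class (P' q)" using smaller sides by blast
          show "P' q \<subseteq> contexts A" using \<open>P' q \<subset> P\<close> less.hyps(2) by blast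
        qed
        let ?c = "\<lambda>(p, q). ctxt_comp p q"
        define Hs where "Hs = (\<lambda>(l, r). Hole l r) ` (D \<times> D)"
        define T1 where "T1 = ?c ` (steps A \<times> P' q2)"
        define T2 where "T2 = ?c ` (Hs \<times> T1)"
        have Hs: "down_closed cle Hs" "Hs \<subseteq> contexts A" "tame cle ctxt_class Hs"
          using down_closed_Hole[OF D(1)] D(2) tame_Hole[OF D subset_refl] by (auto simp: Hs_def)
        have T1: "down_closed cle T1" "T1 \<subseteq> contexts A" "tame cle ctxt_class T1"
          using down_closed_comp[OF down_closed_steps P'(1)[OF q(2)]] P'(2)[OF q(2)] steps_contexts[of A]
            tame_comp[OF down_closed_steps steps_contexts P'(1,2)[OF q(2)] tame_steps P'(3)[OF q(2)] subset_refl]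
          by (auto simp: T1_def)
        have T2: "down_closed cle T2" "T2 \<subseteq> contexts A" "tame cle ctxt_class T2"
          using down_closed_comp[OF Hs(1) T1(1)] Hs(2) T1(2)
            tame_comp[OF Hs(1,2) T1(1,2) Hs(3) T1(3) subset_refl]
          by (auto simp: T2_def)
        have compI: "ctxt_comp p (ctxt_comp (Hole l r) (ctxt_comp y p')) \<in> ?c ` (P' q1 \<times> T2)"
          if "p \<in> P' q1" "l \<in> D" "r \<in> D" "y \<in> steps A" "p' \<in> P' q2" for p l r y p'
        proof -
          have "ctxt_comp y p' \<in> T1" unfolding T1_def using that by (intro image_eqI[of _ _ "(y, p')"]) simp_all
          moreover have "Hole l r \<in> Hs" unfolding Hs_def using that by (intro image_eqI[of _ _ "(l, r)"]) simp_all
          ultimately have "ctxt_comp (Hole l r) (ctxt_comp y p') \<in> T2"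
            unfolding T2_def by (intro image_eqI[of _ _ "(Hole l r, ctxt_comp y p')"]) simp_all
          then show ?thesis
            using that(1) by (intro image_eqI[of _ _ "(p, ctxt_comp (Hole l r) (ctxt_comp y p'))"]) simp_all
        qed
        have "p \<in> ?c ` (P' q1 \<times> T2)" if p: "p \<in> P" for p
        proof (cases "cle q1 p")
          case False
          \<comment> \<open>A context not above \<open>q1\<close> is itself the first factor, with
            trivial layer and rest.\<close>
          then have "p \<in> P' q1" "id_ctxt \<in> P' q2" using p id not_id by (simp_all add: P'_def)
          then show ?thesis using compI[of p "[]" "[]" id_ctxt id_ctxt] \<open>[] \<in> D\<close> by (simp add: steps_def)
        next
          case True
          have "p \<in> contexts A" using p less.hyps(2) by blast
          from cut_ctxt[OF this, of "cle q1", OF not_id(1) True] obtain p' l r y p'' where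
            cut: "p = ctxt_comp p' (ctxt_comp (Hole l r) (ctxt_comp y p''))" "y \<in> steps A"
              "\<not> cle q1 p'" "cle q1 (ctxt_comp p' (ctxt_comp (Hole l r) y))" by blast
          have "cle p' p" "cle (Hole l r) p" "cle p'' p"
            unfolding cut(1) using cle_comp_left cle_comp_right cle_trans by blast+
          then have in_P: "p' \<in> P" "Hole l r \<in> P" "p'' \<in> P" using p down_closedD[OF less.hyps(1)] by blast+
          have "\<not> cle q2 p''"
          proof
            assume "cle q2 p''"
            then have "cle (ctxt_comp q1 q2) p"
              using cle_comp[OF cut(4)] unfolding cut(1) by (simp add: ctxt_comp_assoc del: ctxt_comp.simps)
            then show False using q(3) p down_closedD[OF less.hyps(1)] by blast
          qed
          then show ?thesis
            unfolding cut(1) using in_P cut(2,3) sides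
            by (intro compI) (auto simp: P'_def side_ctxts_def)
        qed
        then have "P \<subseteq> ?c ` (P' q1 \<times> T2)" by blast
        then have "tame cle ctxt_class P"
          by (rule tame_comp[OF P'(1,2)[OF q(1)] T2(1,2) P'(3)[OF q(1)] T2(3)])
        then show ?thesis using ideal by (rule tameD[OF _ subset_refl])
      qed
    qed
  qed
  note * = this
  show ?thesis
  proof (rule tameI)
    fix P assume "P \<subseteq> side_ctxts A A D" "order_ideal cle P"
    moreover from this have "P \<subseteq> contexts A" by (auto simp: side_ctxts_def)
    ultimately show "eventually_constant cle ctxt_class P"
      using *[of P] order_ideal_down_closed by blast
  qed
qed

lemma eventually_constant_not_closed:
  assumes absorbing and D: "order_ideal fle D" "D \<subseteq> forests A"
    and not_closed: "s1 \<in> D" "s2 \<in> D" "s1 @ s2 \<notin> D"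
    and smaller: "\<And>E. down_closed fle E \<Longrightarrow> E \<subset> D \<Longrightarrow> tame fle forest_class E"
  shows "eventually_constant fle forest_class D"
proof -
  interpret W: well_quasi_order fle "forests A" by (rule wqo_forests[OF finite_A])
  have dcD: "down_closed fle D" using D(1) by (rule order_ideal_down_closed)
  \<comment> \<open>As an upper bound of \<open>s1\<close> and \<open>s2\<close> in
    \<open>D\<close>, \<open>x\<close> has the property that \<open>x @ x\<close> lies above
    \<open>s1 @ s2\<close>, hence outside \<open>D\<close>.\<close>
  obtain x where x: "x \<in> D" "fle s1 x" "fle s2 x" using D(1) not_closed unfolding order_ideal_def by meson
  have xx: "x @ x \<notin> D" using not_closed(3) down_closedD[OF dcD, of "x @ x" "s1 @ s2"] x fle_append by blast
  then have "x \<noteq> []" using x(1) by auto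
  define E where "E = {t \<in> D. \<not> fle x t}"
  have "x \<notin> E" "E \<subseteq> D" by (auto simp: E_def)
  then have "E \<subset> D" using x(1) by blast
  have E: "down_closed fle E" "E \<subseteq> forests A" "tame fle forest_class E"
    using W.down_closed_minus_above[OF dcD] \<open>E \<subset> D\<close> smaller D(2) by (auto simp: E_def)
  define Y where "Y = side_ctxts A A E"
  have Y: "down_closed cle Y" "Y \<subseteq> contexts A" "tame cle ctxt_class Y"
    using down_closed_side_ctxts[OF E(1)] tame_side_ctxts[OF assms(1) E]
    by (auto simp: Y_def side_ctxts_def)
  let ?p = "\<lambda>(p, t). plug p t"
  define Z where "Z = ?p ` (Y \<times> E)"
  have Z: "down_closed fle Z" "Z \<subseteq> forests A" "tame fle forest_class Z"
    using down_closed_plug[OF Y(1) E(1)] Y(2) E(2) tame_plug[OF Y(1,2) E(1,2) Y(3) E(3) subset_refl]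
    by (auto simp: Z_def)
  have "s \<in> ?p ` (Y \<times> Z)" if s: "s \<in> D" for s
  proof -
    \<comment> \<open>The decomposition needs \<open>x\<close> as a piece, so it is applied to some
      \<open>s'\<close> above \<open>s\<close> and \<open>x\<close>; \<open>s\<close> returns at the
      end because the set of composites is down-closed.\<close>
    obtain s' where s': "s' \<in> D" "fle s s'" "fle x s'" using D(1) s x(1) unfolding order_ideal_def by meson
    have piece_D: "t \<in> D" if "fle t s'" for t using down_closedD[OF dcD s'(1) that] .
    then have "\<not> fle (x @ x) s'" using xx by blast
    from spine_decomposition[OF s'(3) this \<open>x \<noteq> []\<close>] obtain p q t where
      dec: "s' = plug p (plug q t)" "fle x (plug q t)" "\<not> fle x t" "\<not> fle x (left_of q)" "\<not> fle x (right_of q)"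
      by blast
    have A: "p \<in> contexts A" "q \<in> contexts A" "t \<in> forests A" using s'(1) D(2) dec(1) by auto
    have le_s': "fle u s'" if "fle u (plug q t)" for u
      unfolding dec(1) using fle_trans[OF fle_plug_hole that] .
    have "t \<in> D" "left_of q \<in> D" "right_of q \<in> D"
      using piece_D le_s' fle_plug_hole[of t q] fle_left_of[of q t] fle_right_of[of q t] by blast+
    then have "t \<in> E" "left_of q \<in> E" "right_of q \<in> E" using dec(3-5) by (simp_all add: E_def)
    moreover have "left_of p \<in> E"
    proof -
      have "\<not> fle x (left_of p)"
      proof
        assume "fle x (left_of p)"
        then have "fle (x @ x) (left_of p @ plug q t)" using dec(2) by (rule fle_append)
        then have "fle (x @ x) s'" unfolding dec(1) using fle_trans[OF fle_left_plug] by blast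
        then show False using piece_D xx by blast
      qed
      moreover have "fle (left_of p) s'"
        unfolding dec(1) by (rule fle_left_of)
      ultimately show ?thesis using piece_D by (simp add: E_def)
    qed
    moreover have "right_of p \<in> E"
    proof -
      have "\<not> fle x (right_of p)"
      proof
        assume "fle x (right_of p)"
        with dec(2) have "fle (x @ x) (plug q t @ right_of p)" by (rule fle_append)
        then have "fle (x @ x) s'" unfolding dec(1) using fle_trans[OF fle_right_plug] by blast
        then show False using piece_D xx by blast
      qed
      moreover have "fle (right_of p) s'"
        unfolding dec(1) by (rule fle_right_of)
      ultimately show ?thesis using piece_D by (simp add: E_def)
    qed
    moreover have "spine c \<subseteq> A" if "c \<in> contexts A" for c
      using that by (induction c) auto
    ultimately have "p \<in> Y" "q \<in> Y" using A by (simp_all add: Y_def side_ctxts_def)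
    then have "plug q t \<in> Z" unfolding Z_def using \<open>t \<in> E\<close> by (intro image_eqI[of _ _ "(q, t)"]) simp_all
    then have "s' \<in> ?p ` (Y \<times> Z)"
      unfolding dec(1) using \<open>p \<in> Y\<close> by (intro image_eqI[of _ _ "(p, plug q t)"]) simp_all
    then show ?thesis using down_closedD[OF down_closed_plug[OF Y(1) Z(1)]] s'(2) by blast
  qed
  then have "D \<subseteq> ?p ` (Y \<times> Z)" by blast
  then have "tame fle forest_class D" by (rule tame_plug[OF Y(1,2) Z(1,2) Y(3) Z(3)])
  then show ?thesis using D(1) by (rule tameD[OF _ subset_refl])
qed

text \<open>\<open>B\<close> collects the letters under which \<open>D\<close> is closed. Each other
  letter fails for some \<open>f b\<close>, and a bound \<open>x\<close> of these witnesses keeps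
  such letters from standing above a forest that contains \<open>x\<close>. If \<open>B\<close> is
  empty, no tree of \<open>D\<close> contains \<open>y @ y\<close> for nonempty \<open>y\<close>
  above \<open>x\<close>, and \<open>y @ y\<close> separates. Otherwise a letter of \<open>B\<close>
  separates in the contexts with path in \<open>B\<close> and sides in \<open>D\<close>, whose class
  is eventually that of some \<open>c\<close>. A forest of \<open>D\<close> above
  \<open>plug c [Node b x]\<close> factors through such a context above \<open>c\<close>, so its
  class is that of \<open>plug c []\<close>.\<close>

lemma eventually_constant_closed:
  assumes absorbing and D: "order_ideal fle D" "D \<subseteq> forests A"
    and closed: "\<And>s t. s \<in> D \<Longrightarrow> t \<in> D \<Longrightarrow> s @ t \<in> D"
  shows "eventually_constant fle forest_class D"
proof -
  have dcD: "down_closed fle D" using D(1) by (rule order_ideal_down_closed)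
  have Nil: "[] \<in> D" using D(1) dcD unfolding order_ideal_def down_closed_def by fastforce
  define B where "B = {b \<in> A. \<forall>t\<in>D. [Node b t] \<in> D}"
  have "\<forall>b\<in>A - B. \<exists>t\<in>D. [Node b t] \<notin> D" by (auto simp: B_def)
  then obtain f where f: "\<And>b. b \<in> A - B \<Longrightarrow> f b \<in> D \<and> [Node b (f b)] \<notin> D" by metis
  have "finite (f ` (A - B))" "f ` (A - B) \<subseteq> D" using finite_A f by auto
  then have "\<exists>x\<in>D. \<forall>y\<in>f ` (A - B). fle y x"
    by (rule order_ideal_finite_bound[OF D(1)]) (blast intro: fle_trans)
  then obtain x where x: "x \<in> D" "\<And>b. b \<in> A - B \<Longrightarrow> fle (f b) x" by blast
  have no_Node: "[Node b t] \<notin> D" if "b \<in> A - B" "fle x t" for b t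
    using f[OF that(1)] fle_Node[OF fle_trans[OF that(2) x(2)[OF that(1)]], of b] down_closedD[OF dcD] by blast
  show ?thesis
  proof (cases "B = {}")
    case True
    show ?thesis
    proof (cases "D = {[]}")
      case True
      then show ?thesis by (simp add: eventually_constant_def)
    next
      case False
      then obtain t where "t \<in> D" "t \<noteq> []" using Nil by blast
      then obtain y where y: "y \<in> D" "fle x y" "fle t y" using D(1) x(1) unfolding order_ideal_def by meson
      have "y \<noteq> []" using y(3) \<open>t \<noteq> []\<close> by auto
      show ?thesis
      proof (rule eventually_constant_closed_forests[OF assms(1) D closed, of "y @ y"])
        fix z assume z: "[z] \<in> D"
        obtain b s where bs: "z = Node b s" by (cases z)
        then have "b \<in> A" using z D(2) by auto
        show "\<not> fle (y @ y) [z]"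
        proof
          assume "fle (y @ y) [z]"
          then have "fle (y @ y) [Node b s]" using bs by simp
          then show False
          proof (cases rule: fle_Node_cases)
            case del
            then have "fle x s" using fle_trans[OF del] fle_trans[OF fle_append_left y(2)] by blast
            then show ?thesis using no_Node[of b s] z bs \<open>b \<in> A\<close> True by simp
          next
            \<comment> \<open>\<open>y @ y\<close> has at least two trees, so it is not a single
              tree with a kept root.\<close>
            case (keep u)
            then show ?thesis using \<open>y \<noteq> []\<close> by (cases y) auto
          qed
        qed
      qed (use y(1) closed in auto)
    qed
  next
    case False
    then obtain b where b: "b \<in> B" by blast
    define C where "C = side_ctxts A B D"
    have C_A: "C \<subseteq> contexts A" by (auto simp: C_def side_ctxts_def)
    have C_comp: "ctxt_comp p q \<in> C" if "p \<in> C" "q \<in> C" for p q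
      using that closed by (simp add: C_def side_ctxts_def)
    have "id_ctxt \<in> C" using Nil by (simp add: C_def side_ctxts_def)
    moreover have "down_closed cle C" unfolding C_def using dcD by (rule down_closed_side_ctxts)
    ultimately have C_ideal: "order_ideal cle C"
      unfolding order_ideal_def using C_comp cle_comp_left cle_comp_right by blast
    have "letter_ctxt b \<in> C" using b Nil by (auto simp: C_def side_ctxts_def letter_ctxt_def B_def)
    from eventually_constant_closed_ctxts[OF assms(1) C_ideal C_A C_comp this] obtain c where
      c: "c \<in> C" "\<And>p. p \<in> C \<Longrightarrow> cle c p \<Longrightarrow> ctxt_class p = ctxt_class c"
      unfolding eventually_constant_def by blast
    have plug_D: "plug p t \<in> D" if "p \<in> C" "t \<in> D" for p t
      using that(1)
    proof (induction p)
      case (Hole l r)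
      then show ?case using that(2) closed by (simp add: C_def side_ctxts_def)
    next
      case (Nest l a p r)
      then have "l @ left_of p \<in> D" "right_of p @ r \<in> D" by (simp_all add: C_def side_ctxts_def)
      then have "l \<in> D" "left_of p \<in> D" "right_of p \<in> D" "r \<in> D"
        using down_closedD[OF dcD] fle_append_left fle_append_right by blast+
      moreover from this have "plug p t \<in> D" using Nest by (simp add: C_def side_ctxts_def)
      moreover have "a \<in> B" using Nest.prems by (simp add: C_def side_ctxts_def)
      ultimately have "l @ [Node a (plug p t)] @ r \<in> D" by (intro closed) (simp_all add: B_def)
      then show ?case by simp
    qed
    \<comment> \<open>Every node on the path has \<open>x\<close> below it, so its label cannot lie
      outside \<open>B\<close>.\<close>
    have spine_B: "spine p \<subseteq> B" if "plug p t \<in> D" "fle x t" for p t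
      using that(1)
    proof (induction p)
      case (Nest l a p r)
      have "fle [Node a (plug p t)] (plug (Nest l a p r) t)"
        using fle_plug_hole[of "[Node a (plug p t)]" "Hole l r"] by simp
      then have *: "[Node a (plug p t)] \<in> D" using Nest.prems down_closedD[OF dcD] by blast
      have "fle x (plug p t)" using fle_trans[OF fle_plug_hole that(2)] .
      moreover have "a \<in> A" using * D(2) by auto
      ultimately have "a \<in> B" using no_Node[of a "plug p t"] * by blast
      moreover have "plug p t \<in> D" using down_closedD[OF dcD * fle_under[OF fle_refl]] .
      ultimately show ?case using Nest.IH by simp
    qed simp
    \<comment> \<open>Composing \<open>c\<close> with \<open>Hole t []\<close> stays in
      \<open>C\<close> above \<open>c\<close> and keeps its class, so the class of
      \<open>plug c t\<close> is the same for all \<open>t\<close> in \<open>D\<close>.\<close>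
    have const: "forest_class (plug c t) = forest_class (plug c [])" if t: "t \<in> D" for t
    proof -
      have tC: "Hole t [] \<in> C" using t Nil D(2) by (auto simp: C_def side_ctxts_def)
      then have "ctxt_comp c (Hole t []) \<in> C" using C_comp c(1) by blast
      then have "ctxt_class (ctxt_comp c (Hole t [])) = ctxt_class c" using c(2) cle_comp_left by blast
      then have "forest_class (plug (ctxt_comp c (Hole t [])) []) = forest_class (plug c [])"
        using C_A c(1) tC by (intro forest_class_plug) auto
      then show ?thesis by (simp add: plug_ctxt_comp)
    qed
    have Node_b: "[Node b x] \<in> D" using b x(1) by (simp add: B_def)
    have "forest_class s = forest_class (plug c [])" if s: "s \<in> D" "fle (plug c [Node b x]) s" for s
    proof -
      from fle_plug_tree[OF s(2)] obtain p u where
        pu: "s = plug p [Node b u]" "cle c p" "fle x u" by blast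
      have "fle [Node b u] s" unfolding pu(1) by (rule fle_plug_hole)
      then have u: "[Node b u] \<in> D" using s(1) down_closedD[OF dcD] by blast
      have "fle (left_of p) s" "fle (right_of p) s"
        unfolding pu(1) by (rule fle_left_of fle_right_of)+
      then have "left_of p \<in> D" "right_of p \<in> D" using s(1) down_closedD[OF dcD] by blast+
      moreover have "spine p \<subseteq> B" using spine_B[of p "[Node b u]"] s(1) pu(1) fle_under[OF pu(3)] by simp
      moreover have p_A: "p \<in> contexts A" using s(1) pu(1) D(2) by auto
      ultimately have "p \<in> C" by (simp add: C_def side_ctxts_def)
      then have "ctxt_class p = ctxt_class c" using c(2) pu(2) by blast
      then have "forest_class s = forest_class (plug c [Node b u])"
        unfolding pu(1) using p_A C_A c(1) u D(2) by (intro forest_class_plug) auto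
      then show ?thesis using const[OF u] by simp
    qed
    moreover have "plug c [Node b x] \<in> D" using plug_D[OF c(1) Node_b] .
    ultimately show ?thesis
      unfolding eventually_constant_def using const[OF Node_b] by (intro bexI[of _ "plug c [Node b x]"]) auto
  qed
qed

theorem tame_forests:
  assumes absorbing
  shows "tame fle forest_class (forests A)"
proof -
  interpret W: well_quasi_order fle "forests A" by (rule wqo_forests[OF finite_A])
  have "order_ideal fle D \<longrightarrow> eventually_constant fle forest_class D"
    if "down_closed fle D" "D \<subseteq> forests A" for D
    using that
  proof (induction D rule: W.down_closed_induct)
    case (less D)
    have smaller: "tame fle forest_class E" if "E \<subset> D" for E
      using less.IH order_ideal_down_closed that unfolding tame_def by (meson order.strict_trans1)
    show ?case
      using eventually_constant_closed[OF assms _ less.hyps(2)]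
        eventually_constant_not_closed[OF assms _ less.hyps(2) _ _ _ smaller] by blast
  qed
  then show ?thesis unfolding tame_def using order_ideal_down_closed by blast
qed

end

section \<open>Equivalence of piecewise testability and the identities\<close>

lemma finite_bounded_forests:
  assumes "finite A" shows "finite {t \<in> forests A. nodes t \<le> n}"
proof (induction n)
  case 0
  have "t = []" if "nodes t \<le> 0" for t :: "'a forest"
    using that by (cases t; cases "hd t") (simp_all add: nodes_def)
  then have "{t \<in> forests A. nodes t \<le> 0} \<subseteq> {[]}" by blast
  then show ?case using finite_subset by blast
next
  case (Suc n)
  let ?S = "{t \<in> forests A. nodes t \<le> n}"
  have "t \<in> insert [] ((\<lambda>(a, s, r). Node a s # r) ` (A \<times> ?S \<times> ?S))"
    if t: "t \<in> forests A" "nodes t \<le> Suc n" for t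
  proof (cases t)
    case (Cons y r)
    obtain a s where "y = Node a s" by (cases y)
    then have "a \<in> A" "s \<in> ?S" "r \<in> ?S" "t = Node a s # r"
      using Cons t by (simp_all add: nodes_Cons nodes_tree_Node del: nodes_tree.simps)
    then show ?thesis by (intro insertI2 image_eqI[of _ _ "(a, s, r)"]) simp_all
  qed simp
  then have "{t \<in> forests A. nodes t \<le> Suc n} \<subseteq> insert [] ((\<lambda>(a, s, r). Node a s # r) ` (A \<times> ?S \<times> ?S))"
    by blast
  then show ?case by (rule finite_subset) (use assms Suc in simp)
qed

lemma pieces_mono: "fle s t \<Longrightarrow> pieces n s \<subseteq> pieces n t"
  unfolding pieces_def piece_iff_fle using fle_trans by blast

lemma pieces_stabilise:
  assumes "finite A" and S: "\<And>k. S k \<in> forests A" "\<And>k. fle (S k) (S (Suc k))"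
  shows "\<exists>k. pieces n (S k) = pieces n (S (Suc k))"
proof (rule ccontr)
  assume "\<nexists>k. pieces n (S k) = pieces n (S (Suc k))"
  then have less: "pieces n (S k) \<subset> pieces n (S (Suc k))" for k using pieces_mono[OF S(2)] by blast
  have sub: "pieces n (S k) \<subseteq> {t \<in> forests A. nodes t \<le> n}" for k
    using fle_forests S(1) unfolding pieces_def piece_iff_fle by blast
  have fin: "finite (pieces n (S k))" for k
    using finite_subset[OF sub finite_bounded_forests[OF assms(1)]] .
  have "k \<le> card (pieces n (S k))" for k
  proof (induction k)
    case (Suc k)
    then show ?case using psubset_card_mono[OF fin less[of k]] by linarith
  qed simp
  moreover have "card (pieces n (S k)) \<le> card {t \<in> forests A. nodes t \<le> n}" for k
    using card_mono[OF finite_bounded_forests[OF assms(1)] sub] .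
  ultimately show False using not_less_eq_eq order_trans by blast
qed

context recognized_language
begin

lemma piecewise_testable_if_absorbing:
  assumes absorbing
  shows "piecewise_testable A L"
proof -
  interpret W: well_quasi_order fle "forests A" by (rule wqo_forests[OF finite_A])
  obtain T where T: "finite T" "T \<subseteq> forests A"
    "\<forall>s\<in>forests A. \<forall>t\<in>forests A. (\<forall>z\<in>T. fle z s \<longleftrightarrow> fle z t) \<longrightarrow> forest_class s = forest_class t"
    using W.tame_finite_test[OF tame_forests[OF assms]] by blast
  \<comment> \<open>The sum bounds the size of each test, so forests with equal
    \<open>pieces n\<close> pass the same tests.\<close>
  define n where "n = (\<Sum>z\<in>T. nodes z)"
  show ?thesis
    unfolding piecewise_testable_def
  proof (intro exI[of _ n] ballI impI)
    fix s t assume st: "s \<in> forests A" "t \<in> forests A" "pieces n s = pieces n t"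
    have "fle z s \<longleftrightarrow> fle z t" if "z \<in> T" for z
    proof -
      have "nodes z \<le> n" unfolding n_def by (rule member_le_sum) (use T(1) that in auto)
      then have "fle z u \<longleftrightarrow> z \<in> pieces n u" for u by (simp add: pieces_def piece_iff_fle)
      then show ?thesis using st(3) by simp
    qed
    then have "forest_class s = forest_class t" using T(3) st(1,2) by blast
    from mem_L_cong[OF this, of id_ctxt] show "s \<in> L \<longleftrightarrow> t \<in> L" by simp
  qed
qed

lemma absorbing_if_piecewise_testable:
  assumes "piecewise_testable A L"
  shows absorbing
  unfolding absorbing_def
proof (intro ballI impI)
  obtain n where n: "\<And>s t. s \<in> forests A \<Longrightarrow> t \<in> forests A \<Longrightarrow> pieces n s = pieces n t \<Longrightarrow> s \<in> L \<longleftrightarrow> t \<in> L"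
    using assms unfolding piecewise_testable_def by blast
  fix u e p t
  assume A: "u \<in> contexts A" "e \<in> contexts A" "p \<in> contexts A" "t \<in> forests A"
    and ue: "cle u e" and idem: "\<psi> (ctxt_comp e e) = \<psi> e"
  define pw where "pw k s = (plug e ^^ k) s" for k s
  have pw_simps: "pw 0 s = s" "pw (Suc k) s = plug e (pw k s)" for k s by (simp_all add: pw_def)
  have pw_shift: "pw k (plug e s) = pw (Suc k) s" for k s by (simp add: pw_def funpow_swap1)
  have pw_A: "pw k s \<in> forests A" if "s \<in> forests A" for k s
    using that A by (induction k) (simp_all add: pw_simps)
  have pw_mono: "fle (pw k s) (pw k s')" if "fle s s'" for k s s'
    using that by (induction k) (simp_all add: pw_simps fle_plug)
  have \<phi>_pw: "\<phi> (pw (Suc k) s) = \<phi> (plug e s)" if "s \<in> forests A" for k s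
  proof (induction k)
    case (Suc k)
    have "\<phi> (pw (Suc (Suc k)) s) = \<phi> (plug (ctxt_comp e e) (pw k s))" by (simp add: pw_simps plug_ctxt_comp)
    also have "\<dots> = \<phi> (plug e (pw k s))" using A pw_A that idem by (simp add: \<phi>_plug)
    finally show ?case using Suc by (simp add: pw_simps)
  qed (simp add: pw_simps)
  have class_pw: "plug p (plug v (pw (Suc k) s)) \<in> L \<longleftrightarrow> plug p (plug v (plug e s)) \<in> L"
    if "s \<in> forests A" "v \<in> contexts A" for k s v
  proof -
    have "forest_class (pw (Suc k) s) = forest_class (plug e s)"
      using that A pw_A \<phi>_pw by (intro forest_class_if_\<phi>_eq) simp_all
    from mem_L_cong[OF this, of "ctxt_comp p v"] show ?thesis using that A by (simp add: plug_ctxt_comp)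
  qed
  \<comment> \<open>The exponent \<open>Suc k\<close> guarantees at least one factor
    \<open>e\<close>: all positive powers of \<open>e\<close> act on \<open>t\<close> with the value
    of \<open>e\<close>, whereas exponent 0 would leave \<open>t\<close>.\<close>
  define S where "S k = plug p (pw (Suc k) t)" for k
  have S_A: "S k \<in> forests A" for k using A pw_A by (simp add: S_def)
  have S_mono: "fle (S k) (S (Suc k))" for k
    using fle_plug[OF cle_refl fle_plug_hole] by (simp add: S_def pw_simps)
  obtain k where k: "pieces n (S k) = pieces n (S (Suc k))"
    using pieces_stabilise[of A S, OF finite_A S_A S_mono] by blast
  have between: "s \<in> L \<longleftrightarrow> plug p (plug e t) \<in> L" if "fle (S k) s" "fle s (S (Suc k))" "s \<in> forests A" for s
  proof -
    have "pieces n s = pieces n (S k)" using pieces_mono[OF that(1)] pieces_mono[OF that(2)] k by blast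
    then have "s \<in> L \<longleftrightarrow> S k \<in> L" using n that(3) S_A by blast
    then show ?thesis using class_pw[of t id_ctxt k] A by (simp add: S_def)
  qed
  \<comment> \<open>Dropping \<open>u\<close> gives \<open>S k\<close>, enlarging it to
    \<open>e\<close> gives \<open>S (Suc k)\<close>; with the same small pieces at both ends, the
    forest in between has them too.\<close>
  have "fle (S k) (plug p (pw (Suc k) (plug u t)))"
    unfolding S_def by (intro fle_plug cle_refl pw_mono fle_plug_hole)
  moreover have "fle (plug p (pw (Suc k) (plug u t))) (S (Suc k))"
    unfolding S_def pw_shift[symmetric, of "Suc k"] by (intro fle_plug cle_refl pw_mono ue fle_refl)
  ultimately have "plug p (pw (Suc k) (plug u t)) \<in> L \<longleftrightarrow> plug p (plug e t) \<in> L"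
    using A pw_A by (intro between) simp_all
  then have 1: "plug p (plug e (plug u t)) \<in> L \<longleftrightarrow> plug p (plug e t) \<in> L"
    using class_pw[of "plug u t" id_ctxt k] A by simp
  have "fle (S k) (plug p (plug u (pw (Suc k) t)))"
    unfolding S_def by (intro fle_plug cle_refl fle_plug_hole)
  moreover have "fle (plug p (plug u (pw (Suc k) t))) (S (Suc k))"
    unfolding S_def pw_simps(2)[of "Suc k"] by (intro fle_plug cle_refl ue fle_refl)
  ultimately have "plug p (plug u (pw (Suc k) t)) \<in> L \<longleftrightarrow> plug p (plug e t) \<in> L"
    using A pw_A by (intro between) simp_all
  then have 2: "plug p (plug u (plug e t)) \<in> L \<longleftrightarrow> plug p (plug e t) \<in> L"
    using class_pw[of t u k] A by simp
  from 1 2 show "(plug p (plug e (plug u t)) \<in> L \<longleftrightarrow> plug p (plug e t) \<in> L) \<and>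
     (plug p (plug u (plug e t)) \<in> L \<longleftrightarrow> plug p (plug e t) \<in> L)" ..
qed

theorem piecewise_testable_iff_absorbing: "piecewise_testable A L \<longleftrightarrow> absorbing"
  using piecewise_testable_if_absorbing absorbing_if_piecewise_testable by blast

text \<open>
  The least relation with these closure properties consists of the images in \<open>V\<close> of the pairs of
  contexts in the piece order. Since \<open>absorbing_on\<close> is antitone, any closed relation may be tested
  in its place. Forests are represented by the contexts that map \<open>0\<close> to their value.
\<close>

definition piece_closed :: "('v \<Rightarrow> 'v \<Rightarrow> bool) \<Rightarrow> bool" where
  "piece_closed R \<longleftrightarrow> R \<one>\<^bsub>ver F\<^esub> \<one>\<^bsub>ver F\<^esub> \<and>
    (\<forall>p \<in> carrier (ver F). \<forall>q \<in> carrier (ver F). R p q \<longrightarrow>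
       (let s = act F p \<one>\<^bsub>hor F\<^esub>; t = act F q \<one>\<^bsub>hor F\<^esub> in R (inl F s) (inl F t) \<and> R (inr F s) (inr F t)) \<and>
       (\<forall>p' \<in> carrier (ver F). \<forall>q' \<in> carrier (ver F). R p' q' \<longrightarrow>
          R (p \<otimes>\<^bsub>ver F\<^esub> p') (q \<otimes>\<^bsub>ver F\<^esub> q'))) \<and>
    (\<forall>a\<in>A. R \<one>\<^bsub>ver F\<^esub> (\<psi> (letter_ctxt a)) \<and> R (\<psi> (letter_ctxt a)) (\<psi> (letter_ctxt a)))"

text \<open>The guards \<open>R p p\<close> and \<open>R t t\<close> are there because
  \<open>\<psi>\<close> need not be onto: a closed relation is reflexive on the image of
  \<open>\<psi>\<close>, and for the least one these are the only reflexive elements.\<close>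

definition absorbing_on :: "('v \<Rightarrow> 'v \<Rightarrow> bool) \<Rightarrow> bool" where
  "absorbing_on R \<longleftrightarrow> (\<forall>u \<in> carrier (ver F). \<forall>e \<in> carrier (ver F). R u e \<longrightarrow> e \<otimes>\<^bsub>ver F\<^esub> e = e \<longrightarrow>
    (\<forall>p \<in> carrier (ver F). R p p \<longrightarrow> (\<forall>t \<in> carrier (ver F). R t t \<longrightarrow>
      (let h = act F t \<one>\<^bsub>hor F\<^esub> in
       (act F p (act F e (act F u h)) \<in> X \<longleftrightarrow> act F p (act F e h) \<in> X) \<and>
       (act F p (act F u (act F e h)) \<in> X \<longleftrightarrow> act F p (act F e h) \<in> X)))))"

lemma piece_closed_cle:
  assumes R: "piece_closed R"
  shows "cle p q \<Longrightarrow> q \<in> contexts A \<Longrightarrow> R (\<psi> p) (\<psi> q)"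
proof -
  have one: "R \<one>\<^bsub>ver F\<^esub> \<one>\<^bsub>ver F\<^esub>" using R unfolding piece_closed_def by blast
  have mult: "R (\<psi> (ctxt_comp p p')) (\<psi> (ctxt_comp q q'))"
    if "R (\<psi> p) (\<psi> q)" "R (\<psi> p') (\<psi> q')" "p \<in> contexts A" "q \<in> contexts A" "p' \<in> contexts A" "q' \<in> contexts A"
    for p q p' q'
    using that R unfolding piece_closed_def by (simp add: \<psi>_comp)
  have letter: "R \<one>\<^bsub>ver F\<^esub> (\<psi> (letter_ctxt a))" "R (\<psi> (letter_ctxt a)) (\<psi> (letter_ctxt a))" if "a \<in> A" for a
    using that R unfolding piece_closed_def by blast+
  \<comment> \<open>Plugging in the empty forest turns a context into a forest; after composing with
    a letter, this leads from \<open>Hole ts []\<close> to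
    \<open>Hole [Node a ts] []\<close>.\<close>
  have plugs: "R (\<psi> (Hole (plug p []) [])) (\<psi> (Hole (plug q []) [])) \<and> R (\<psi> (Hole [] (plug p []))) (\<psi> (Hole [] (plug q [])))"
    if "R (\<psi> p) (\<psi> q)" "p \<in> contexts A" "q \<in> contexts A" for p q
    using that R unfolding piece_closed_def Let_def by (simp add: \<psi>_inl \<psi>_inr \<phi>_plug)
  have letter_A: "letter_ctxt a \<in> contexts A" if "a \<in> A" for a using that by (simp add: letter_ctxt_def)
  have forest: "R (\<psi> (Hole s [])) (\<psi> (Hole t []))" if "fle s t" "t \<in> forests A" for s t
    using that
  proof (induction rule: fle.induct)
    case Nil
    then show ?case using one by simp
  next
    case (del s ts s' r a)
    then have A: "s \<in> forests A" "s' \<in> forests A" "ts \<in> forests A" "r \<in> forests A" "a \<in> A"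
      using fle_forests by auto
    \<comment> \<open>Deletion of the root \<open>a\<close>: the letter is composed on the larger
      side only.\<close>
    have "R (\<psi> (ctxt_comp id_ctxt (Hole s []))) (\<psi> (ctxt_comp (letter_ctxt a) (Hole ts [])))"
      using del A letter by (intro mult letter_A) simp_all
    from conjunct1[OF plugs[OF this]] have "R (\<psi> (Hole s [])) (\<psi> (Hole [Node a ts] []))"
      using A by (simp add: letter_ctxt_def)
    then have "R (\<psi> (ctxt_comp (Hole s []) (Hole s' []))) (\<psi> (ctxt_comp (Hole [Node a ts] []) (Hole r [])))"
      using del A by (intro mult) simp_all
    then show ?case by simp
  next
    case (keep s ts s' r a)
    then have A: "s \<in> forests A" "s' \<in> forests A" "ts \<in> forests A" "r \<in> forests A" "a \<in> A"
      using fle_forests by auto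
    have "R (\<psi> (ctxt_comp (letter_ctxt a) (Hole s []))) (\<psi> (ctxt_comp (letter_ctxt a) (Hole ts [])))"
      using keep A letter by (intro mult letter_A) simp_all
    from conjunct1[OF plugs[OF this]] have "R (\<psi> (Hole [Node a s] [])) (\<psi> (Hole [Node a ts] []))"
      using A by (simp add: letter_ctxt_def)
    then have "R (\<psi> (ctxt_comp (Hole [Node a s] []) (Hole s' []))) (\<psi> (ctxt_comp (Hole [Node a ts] []) (Hole r [])))"
      using keep A by (intro mult) simp_all
    then show ?case by simp
  qed
  have hole: "R (\<psi> (Hole l r)) (\<psi> (Hole l' r'))"
    if "fle l l'" "fle r r'" "l' \<in> forests A" "r' \<in> forests A" for l l' r r'
  proof -
    have A: "l \<in> forests A" "r \<in> forests A" using that fle_forests by blast+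
    have "R (\<psi> (Hole [] r)) (\<psi> (Hole [] r'))"
      using conjunct2[OF plugs[OF forest[OF that(2,4)]]] A that by simp
    then have "R (\<psi> (ctxt_comp (Hole l []) (Hole [] r))) (\<psi> (ctxt_comp (Hole l' []) (Hole [] r')))"
      using forest that A by (intro mult) simp_all
    then show ?thesis by simp
  qed
  have Nest: "Nest l a c r = ctxt_comp (Hole l r) (ctxt_comp (letter_ctxt a) c)" for l a c and r :: "'a forest"
    by (cases c) (simp_all add: letter_ctxt_def)
  show "cle p q \<Longrightarrow> q \<in> contexts A \<Longrightarrow> R (\<psi> p) (\<psi> q)"
  proof (induction rule: cle.induct)
    case (Hole l l' r r')
    then show ?case using hole by simp
  next
    case (del l l' c c' r r' a)
    then have A: "l \<in> forests A" "r \<in> forests A" "c \<in> contexts A" "l' \<in> forests A" "r' \<in> forests A"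
      "c' \<in> contexts A" "a \<in> A" using fle_forests cle_contexts by auto
    have inner: "R (\<psi> (ctxt_comp id_ctxt c)) (\<psi> (ctxt_comp (letter_ctxt a) c'))"
      using A del letter by (intro mult letter_A) simp_all
    have "R (\<psi> (ctxt_comp (Hole l r) (ctxt_comp id_ctxt c)))
        (\<psi> (ctxt_comp (Hole l' r') (ctxt_comp (letter_ctxt a) c')))"
      by (rule mult[OF _ inner]) (use A del hole letter_A in simp_all)
    then show ?case by (simp only: Nest ctxt_comp_id)
  next
    case (keep l l' c c' r r' a)
    then have A: "l \<in> forests A" "r \<in> forests A" "c \<in> contexts A" "l' \<in> forests A" "r' \<in> forests A"
      "c' \<in> contexts A" "a \<in> A" using fle_forests cle_contexts by auto
    have inner: "R (\<psi> (ctxt_comp (letter_ctxt a) c)) (\<psi> (ctxt_comp (letter_ctxt a) c'))"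
      using A keep letter by (intro mult letter_A) simp_all
    have "R (\<psi> (ctxt_comp (Hole l r) (ctxt_comp (letter_ctxt a) c)))
        (\<psi> (ctxt_comp (Hole l' r') (ctxt_comp (letter_ctxt a) c')))"
      by (rule mult[OF _ inner]) (use A keep hole letter_A in simp_all)
    then show ?case by (simp only: Nest)
  qed
qed

lemma absorbing_iff: "absorbing \<longleftrightarrow> (\<exists>R. piece_closed R \<and> absorbing_on R)"
proof
  assume abs: absorbing
  define R where "R v w \<longleftrightarrow> (\<exists>p q. cle p q \<and> q \<in> contexts A \<and> v = \<psi> p \<and> w = \<psi> q)" for v w
  have RI: "R (\<psi> p) (\<psi> q)" if "cle p q" "q \<in> contexts A" for p q using that by (auto simp: R_def)
  have "piece_closed R"
    unfolding piece_closed_def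
  proof (intro conjI ballI impI)
    show "R \<one>\<^bsub>ver F\<^esub> \<one>\<^bsub>ver F\<^esub>" using RI[of id_ctxt id_ctxt] by simp
    show "R \<one>\<^bsub>ver F\<^esub> (\<psi> (letter_ctxt a))" "R (\<psi> (letter_ctxt a)) (\<psi> (letter_ctxt a))" if "a \<in> A" for a
      using RI[of id_ctxt "letter_ctxt a"] RI[of "letter_ctxt a" "letter_ctxt a"] that
      by (simp_all add: letter_ctxt_def)
    fix v w assume "R v w"
    then obtain p q where pq: "cle p q" "q \<in> contexts A" "v = \<psi> p" "w = \<psi> q" by (auto simp: R_def)
    have p: "p \<in> contexts A" using pq cle_contexts by blast
    have "fle (plug p []) (plug q [])" by (rule fle_plug[OF pq(1) fle_refl])
    then show "let s = act F v \<one>\<^bsub>hor F\<^esub>; t = act F w \<one>\<^bsub>hor F\<^esub> in R (inl F s) (inl F t) \<and> R (inr F s) (inr F t)"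
      using RI[of "Hole (plug p []) []" "Hole (plug q []) []"] RI[of "Hole [] (plug p [])" "Hole [] (plug q [])"]
        pq p by (simp add: Let_def \<psi>_inl \<psi>_inr \<phi>_plug cle.Hole)
    fix v' w' assume "R v' w'"
    then obtain p' q' where p'q': "cle p' q'" "q' \<in> contexts A" "v' = \<psi> p'" "w' = \<psi> q'" by (auto simp: R_def)
    then have "p' \<in> contexts A" using cle_contexts by blast
    then show "R (v \<otimes>\<^bsub>ver F\<^esub> v') (w \<otimes>\<^bsub>ver F\<^esub> w')"
      using RI[of "ctxt_comp p p'" "ctxt_comp q q'"] cle_comp[OF pq(1) p'q'(1)] pq p'q' p by (simp add: \<psi>_comp)
  qed
  moreover have "absorbing_on R"
    unfolding absorbing_on_def
  proof (intro ballI impI)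
    fix u e p t assume "R u e" and idem: "e \<otimes>\<^bsub>ver F\<^esub> e = e" and "R p p" "R t t"
    then obtain u' e' p' t' where c: "cle u' e'" "e' \<in> contexts A" "u = \<psi> u'" "e = \<psi> e'"
      "p' \<in> contexts A" "p = \<psi> p'" "t' \<in> contexts A" "t = \<psi> t'" unfolding R_def by metis
    have u': "u' \<in> contexts A" using c cle_contexts by blast
    have "(plug p' (plug e' (plug u' (plug t' []))) \<in> L \<longleftrightarrow> plug p' (plug e' (plug t' [])) \<in> L) \<and>
      (plug p' (plug u' (plug e' (plug t' []))) \<in> L \<longleftrightarrow> plug p' (plug e' (plug t' [])) \<in> L)"
    proof -
      have "\<psi> (ctxt_comp e' e') = \<psi> e'" using c idem by (simp add: \<psi>_comp)
      moreover have "plug t' [] \<in> forests A" using c by simp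
      ultimately show ?thesis using abs[unfolded absorbing_def] u' c by blast
    qed
    then show "let h = act F t \<one>\<^bsub>hor F\<^esub> in
       (act F p (act F e (act F u h)) \<in> X \<longleftrightarrow> act F p (act F e h) \<in> X) \<and>
       (act F p (act F u (act F e h)) \<in> X \<longleftrightarrow> act F p (act F e h) \<in> X)"
      using c u' by (simp add: L_def Let_def \<phi>_plug)
  qed
  ultimately show "\<exists>R. piece_closed R \<and> absorbing_on R" by blast
next
  assume "\<exists>R. piece_closed R \<and> absorbing_on R"
  then obtain R where R: "piece_closed R" "absorbing_on R" by blast
  show absorbing
    unfolding absorbing_def
  proof (intro ballI impI)
    fix u e p t
    assume A: "u \<in> contexts A" "e \<in> contexts A" "p \<in> contexts A" "t \<in> forests A"
      and ue: "cle u e" and idem: "\<psi> (ctxt_comp e e) = \<psi> e"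
    have "R (\<psi> u) (\<psi> e)" "R (\<psi> p) (\<psi> p)" "R (\<psi> (Hole t [])) (\<psi> (Hole t []))"
      using piece_closed_cle[OF R(1)] ue A by simp_all
    moreover have "\<psi> e \<otimes>\<^bsub>ver F\<^esub> \<psi> e = \<psi> e" using idem A by (simp add: \<psi>_comp)
    moreover have "\<psi> (Hole t []) \<in> carrier (ver F)" using A by simp
    ultimately have "let h = act F (\<psi> (Hole t [])) \<one>\<^bsub>hor F\<^esub> in
       (act F (\<psi> p) (act F (\<psi> e) (act F (\<psi> u) h)) \<in> X \<longleftrightarrow> act F (\<psi> p) (act F (\<psi> e) h) \<in> X) \<and>
       (act F (\<psi> p) (act F (\<psi> u) (act F (\<psi> e) h)) \<in> X \<longleftrightarrow> act F (\<psi> p) (act F (\<psi> e) h) \<in> X)"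
      using R(2) A \<psi>_closed unfolding absorbing_on_def by blast
    moreover have "act F (\<psi> (Hole t [])) \<one>\<^bsub>hor F\<^esub> = \<phi> t"
      using \<phi>_plug[of "Hole t []" "[]"] A by simp
    ultimately show "(plug p (plug e (plug u t)) \<in> L \<longleftrightarrow> plug p (plug e t) \<in> L) \<and>
     (plug p (plug u (plug e t)) \<in> L \<longleftrightarrow> plug p (plug e t) \<in> L)"
      using A by (simp add: L_def Let_def \<phi>_plug)
  qed
qed

end

section \<open>Closure properties of the recursive functions\<close>

text \<open>The values of a recursive function on lists that do not match its arity are junk.\<close>

definition rec_on :: "nat \<Rightarrow> (nat list \<Rightarrow> nat) \<Rightarrow> bool" where
  "rec_on n f \<longleftrightarrow> (\<exists>g. recursive n g \<and> (\<forall>xs. length xs = n \<longrightarrow> g xs = f xs))"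

lemma rec_onI: "recursive n g \<Longrightarrow> (\<And>xs. length xs = n \<Longrightarrow> g xs = f xs) \<Longrightarrow> rec_on n f"
  unfolding rec_on_def by blast

lemma rec_on_cong: "rec_on n f \<Longrightarrow> (\<And>xs. length xs = n \<Longrightarrow> f xs = g xs) \<Longrightarrow> rec_on n g"
  unfolding rec_on_def by (metis (no_types))

lemma rec_on_nth: "i < n \<Longrightarrow> rec_on n (\<lambda>xs. xs ! i)"
  by (rule rec_onI[OF proj]) simp_all

lemma rec_on_comp:
  assumes "rec_on (length gs) f" "\<And>g. g \<in> set gs \<Longrightarrow> rec_on n g"
  shows "rec_on n (\<lambda>xs. f (map (\<lambda>g. g xs) gs))"
proof -
  obtain f' where f': "recursive (length gs) f'" "\<And>xs. length xs = length gs \<Longrightarrow> f' xs = f xs"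
    using assms(1) unfolding rec_on_def by blast
  have "\<forall>g\<in>set gs. \<exists>g'. recursive n g' \<and> (\<forall>xs. length xs = n \<longrightarrow> g' xs = g xs)"
    using assms(2) unfolding rec_on_def by blast
  then obtain G where G: "\<And>g. g \<in> set gs \<Longrightarrow> recursive n (G g) \<and> (\<forall>xs. length xs = n \<longrightarrow> G g xs = g xs)"
    by metis
  have "recursive n (\<lambda>xs. f' (map (\<lambda>g. g xs) (map G gs)))"
    using f'(1) G by (intro recursive.comp) auto
  then show ?thesis
  proof (rule rec_onI)
    fix xs :: "nat list" assume "length xs = n"
    then have "map (\<lambda>g. g xs) (map G gs) = map (\<lambda>g. g xs) gs" using G by simp
    then show "f' (map (\<lambda>g. g xs) (map G gs)) = f (map (\<lambda>g. g xs) gs)" by (simp only: f'(2) length_map)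
  qed
qed

lemma rec_on_comp1:
  assumes "rec_on 1 (\<lambda>xs. H (hd xs))" "rec_on n f"
  shows "rec_on n (\<lambda>xs. H (f xs))"
  using rec_on_comp[of "[f]" "\<lambda>xs. H (hd xs)" n] assms by simp

lemma rec_on_Suc: "rec_on n f \<Longrightarrow> rec_on n (\<lambda>xs. Suc (f xs))"
  by (rule rec_on_comp1[of Suc]) (rule rec_onI[OF succ], simp)

lemma rec_on_const: "rec_on n (\<lambda>xs. c)"
proof (induction c)
  case 0
  show ?case by (rule rec_onI[OF zero]) simp
qed (rule rec_on_Suc)

lemma rec_on_tl: "rec_on n f \<Longrightarrow> rec_on (Suc n) (\<lambda>xs. f (tl xs))"
proof -
  assume "rec_on n f"
  then have "rec_on (Suc n) (\<lambda>xs. f (map (\<lambda>g. g xs) (map (\<lambda>i xs. xs ! Suc i) [0..<n])))"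
    by (intro rec_on_comp) (auto intro: rec_on_nth)
  then show ?thesis
  proof (rule rec_on_cong)
    fix xs :: "nat list" assume "length xs = Suc n"
    then have "map (\<lambda>g. g xs) (map (\<lambda>i xs. xs ! Suc i) [0..<n]) = tl xs"
      by (intro nth_equalityI) (auto simp: nth_tl nth_append)
    then show "f (map (\<lambda>g. g xs) (map (\<lambda>i xs. xs ! Suc i) [0..<n])) = f (tl xs)" by simp
  qed
qed

lemma rec_on_Cons:
  assumes "rec_on (Suc n) f" "rec_on n b"
  shows "rec_on n (\<lambda>xs. f (b xs # xs))"
proof -
  have "rec_on n (\<lambda>xs. f (map (\<lambda>g. g xs) (b # map (\<lambda>i xs. xs ! i) [0..<n])))"
    using assms by (intro rec_on_comp) (auto intro: rec_on_nth)
  then show ?thesis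
  proof (rule rec_on_cong)
    fix xs :: "nat list" assume "length xs = n"
    then have "map (\<lambda>g. g xs) (map (\<lambda>i xs. xs ! i) [0..<n]) = xs"
      by (intro nth_equalityI) auto
    then show "f (map (\<lambda>g. g xs) (b # map (\<lambda>i xs. xs ! i) [0..<n])) = f (b xs # xs)" by simp
  qed
qed

text \<open>Bound variables are handled like de Bruijn indices, each quantifier or recursion pushing
  its value onto the head of the list. Six positions suffice, since \<open>decide\<close> nests five
  quantifiers over the code.\<close>

lemma rec_on_hd0: "rec_on (Suc n) (\<lambda>xs. hd xs)"
  by (rule rec_on_cong[OF rec_on_nth[of 0]]) (auto simp: length_Suc_conv)

lemmas rec_on_hd1 = rec_on_tl[OF rec_on_hd0]
lemmas rec_on_hd2 = rec_on_tl[OF rec_on_hd1]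
lemmas rec_on_hd3 = rec_on_tl[OF rec_on_hd2]
lemmas rec_on_hd4 = rec_on_tl[OF rec_on_hd3]
lemmas rec_on_hd5 = rec_on_tl[OF rec_on_hd4]

text \<open>Primitive recursion supplies the accumulator as second argument; this inserts it as a
  dummy into a predicate that knows only the counter and the parameters.\<close>

lemma rec_on_skip: "rec_on (Suc n) f \<Longrightarrow> rec_on (Suc (Suc n)) (\<lambda>xs. f (hd xs # tl (tl xs)))"
proof -
  assume "rec_on (Suc n) f"
  have "rec_on (Suc (Suc n)) (\<lambda>xs. f (map (\<lambda>g. g xs) ((\<lambda>xs. xs ! 0) # map (\<lambda>i xs. xs ! Suc (Suc i)) [0..<n])))"
    using \<open>rec_on (Suc n) f\<close> by (intro rec_on_comp) (auto intro: rec_on_nth)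
  then show ?thesis
  proof (rule rec_on_cong)
    fix xs :: "nat list" assume xs: "length xs = Suc (Suc n)"
    then have "map (\<lambda>g. g xs) (map (\<lambda>i xs. xs ! Suc (Suc i)) [0..<n]) = tl (tl xs)"
      by (intro nth_equalityI) (auto simp: nth_tl nth_append)
    moreover have "xs ! 0 = hd xs" using xs by (cases xs) auto
    ultimately show "f (map (\<lambda>g. g xs) ((\<lambda>xs. xs ! 0) # map (\<lambda>i xs. xs ! Suc (Suc i)) [0..<n])) =
        f (hd xs # tl (tl xs))" by simp
  qed
qed

lemma rec_on_rec_nat:
  assumes "rec_on n f" "rec_on (Suc (Suc n)) (\<lambda>ys. g (hd ys) (hd (tl ys)) (tl (tl ys)))" "rec_on n b"
  shows "rec_on n (\<lambda>xs. rec_nat (f xs) (\<lambda>y r. g y r xs) (b xs))"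
proof -
  obtain f' where f': "recursive n f'" "\<And>xs. length xs = n \<Longrightarrow> f' xs = f xs"
    using assms(1) unfolding rec_on_def by blast
  obtain g' where g': "recursive (Suc (Suc n)) g'"
    "\<And>ys. length ys = Suc (Suc n) \<Longrightarrow> g' ys = g (hd ys) (hd (tl ys)) (tl (tl ys))"
    using assms(2) unfolding rec_on_def by blast
  have "rec_on (Suc n) (\<lambda>xs. rec_nat (f (tl xs)) (\<lambda>y r. g y r (tl xs)) (hd xs))"
  proof (rule rec_onI[OF prim_rec[OF f'(1) g'(1)]])
    fix xs :: "nat list" assume xs: "length xs = Suc n"
    have "rec_nat (f' (tl xs)) (\<lambda>y r. g' (y # r # tl xs)) k = rec_nat (f (tl xs)) (\<lambda>y r. g y r (tl xs)) k" for k
      using xs by (induction k) (simp_all add: f'(2) g'(2))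
    then show "rec_nat (f' (tl xs)) (\<lambda>y r. g' (y # r # tl xs)) (hd xs) =
      rec_nat (f (tl xs)) (\<lambda>y r. g y r (tl xs)) (hd xs)" .
  qed
  from rec_on_Cons[OF this assms(3)] show ?thesis by simp
qed

lemma rec_on_add:
  assumes "rec_on n f" "rec_on n g" shows "rec_on n (\<lambda>xs. f xs + g xs)"
proof -
  have "rec_on n (\<lambda>xs. rec_nat (g xs) (\<lambda>y r. Suc r) (f xs))"
    using assms by (intro rec_on_rec_nat rec_on_Suc rec_on_hd1)
  moreover have "rec_nat k (\<lambda>y r. Suc r) j = j + k" for j k by (induction j) simp_all
  ultimately show ?thesis by simp
qed

lemma rec_on_mult:
  assumes "rec_on n f" "rec_on n g" shows "rec_on n (\<lambda>xs. f xs * g xs)"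
proof -
  have "rec_on n (\<lambda>xs. rec_nat 0 (\<lambda>y r. r + g xs) (f xs))"
    using assms by (intro rec_on_rec_nat rec_on_add rec_on_hd1 rec_on_const rec_on_tl)
  moreover have "rec_nat 0 (\<lambda>y r. r + k) j = j * k" for j k :: nat by (induction j) simp_all
  ultimately show ?thesis by simp
qed

lemma rec_on_power:
  assumes "rec_on n f" "rec_on n g" shows "rec_on n (\<lambda>xs. f xs ^ g xs)"
proof -
  have "rec_on n (\<lambda>xs. rec_nat 1 (\<lambda>y r. r * f xs) (g xs))"
    using assms by (intro rec_on_rec_nat rec_on_mult rec_on_hd1 rec_on_const rec_on_tl)
  moreover have "rec_nat 1 (\<lambda>y r. r * k) j = k ^ j" for j k :: nat by (induction j) simp_all
  ultimately show ?thesis by simp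
qed

lemma rec_on_diff:
  assumes "rec_on n f" "rec_on n g" shows "rec_on n (\<lambda>xs. f xs - g xs)"
proof -
  have "rec_on m (\<lambda>xs. rec_nat 0 (\<lambda>y r. y) (h xs))" if "rec_on m h" for m h
    using that by (intro rec_on_rec_nat rec_on_hd0 rec_on_const)
  moreover have "rec_nat 0 (\<lambda>y r. y) j = j - 1" for j :: nat by (cases j) simp_all
  ultimately have pred: "rec_on m (\<lambda>xs. h xs - 1)" if "rec_on m h" for m h using that by simp
  have "rec_on n (\<lambda>xs. rec_nat (f xs) (\<lambda>y r. r - 1) (g xs))"
    using assms by (intro rec_on_rec_nat pred rec_on_hd1)
  moreover have "rec_nat k (\<lambda>y r. r - 1) j = k - j" for j k :: nat by (induction j) simp_all
  ultimately show ?thesis by simp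
qed

section \<open>Decidable predicates, bounded quantifiers and decoding\<close>

definition decidable :: "nat \<Rightarrow> (nat list \<Rightarrow> bool) \<Rightarrow> bool" where
  "decidable n P \<longleftrightarrow> rec_on n (\<lambda>xs. of_bool (P xs))"

lemma decidable_not: "decidable n P \<Longrightarrow> decidable n (\<lambda>xs. \<not> P xs)"
proof -
  assume "decidable n P"
  then have "rec_on n (\<lambda>xs. 1 - of_bool (P xs))"
    unfolding decidable_def by (intro rec_on_diff rec_on_const)
  moreover have "of_bool (\<not> b) = 1 - (of_bool b :: nat)" for b by simp
  ultimately show ?thesis by (simp only: decidable_def)
qed

lemma decidable_conj: "decidable n P \<Longrightarrow> decidable n Q \<Longrightarrow> decidable n (\<lambda>xs. P xs \<and> Q xs)"
  unfolding decidable_def of_bool_conj by (rule rec_on_mult)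

lemma decidable_imp: "decidable n P \<Longrightarrow> decidable n Q \<Longrightarrow> decidable n (\<lambda>xs. P xs \<longrightarrow> Q xs)"
  using decidable_not[OF decidable_conj[OF _ decidable_not]] by simp

lemma decidable_iff: "decidable n P \<Longrightarrow> decidable n Q \<Longrightarrow> decidable n (\<lambda>xs. P xs \<longleftrightarrow> Q xs)"
  unfolding iff_conv_conj_imp by (intro decidable_conj decidable_imp)

lemma decidable_le:
  assumes "rec_on n f" "rec_on n g" shows "decidable n (\<lambda>xs. f xs \<le> g xs)"
proof -
  have "rec_on n (\<lambda>xs. 1 - (f xs - g xs))" using assms by (intro rec_on_diff rec_on_const)
  moreover have "of_bool (j \<le> k) = 1 - (j - k)" for j k :: nat by auto
  ultimately show ?thesis by (simp add: decidable_def)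
qed

lemma decidable_eq: "rec_on n f \<Longrightarrow> rec_on n g \<Longrightarrow> decidable n (\<lambda>xs. f xs = g xs)"
  unfolding order_eq_iff by (intro decidable_conj decidable_le)

lemma decidable_ex:
  assumes "rec_on n b" "decidable (Suc n) (\<lambda>ys. P (hd ys) (tl ys))"
  shows "decidable n (\<lambda>xs. \<exists>y<b xs. P y xs)"
proof -
  have "rec_on (Suc (Suc n)) (\<lambda>zs. of_bool (P (hd zs) (tl (tl zs))))"
    using rec_on_skip[OF assms(2)[unfolded decidable_def]] by simp
  \<comment> \<open>The double subtraction truncates the sum to 0 or 1, so the accumulator remains a
    truth value.\<close>
  then have "rec_on n (\<lambda>xs. rec_nat 0 (\<lambda>y r. 1 - (1 - (r + of_bool (P y xs)))) (b xs))"
    using assms(1) by (intro rec_on_rec_nat rec_on_diff rec_on_add rec_on_hd1 rec_on_const)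
  moreover have "rec_nat 0 (\<lambda>y r. 1 - (1 - (r + of_bool (P y xs)))) k = (of_bool (\<exists>y<k. P y xs) :: nat)" for k xs
    by (induction k) (auto simp: less_Suc_eq)
  ultimately show ?thesis by (simp add: decidable_def)
qed

lemma decidable_all:
  assumes "rec_on n b" "decidable (Suc n) (\<lambda>ys. P (hd ys) (tl ys))"
  shows "decidable n (\<lambda>xs. \<forall>y<b xs. P y xs)"
  using decidable_not[OF decidable_ex[OF assms(1), of "\<lambda>y xs. \<not> P y xs"]] decidable_not[OF assms(2)]
  by simp

lemma rec_on_Least:
  assumes "decidable (Suc n) (\<lambda>ys. P (hd ys) (tl ys))" "\<And>xs. length xs = n \<Longrightarrow> \<exists>y. P y xs"
  shows "rec_on n (\<lambda>xs. LEAST y. P y xs)"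
proof -
  have "rec_on (Suc n) (\<lambda>ys. 1 - of_bool (P (hd ys) (tl ys)))"
    using assms(1) unfolding decidable_def by (intro rec_on_diff rec_on_const)
  then obtain g where g: "recursive (Suc n) g"
    "\<And>ys. length ys = Suc n \<Longrightarrow> g ys = 1 - of_bool (P (hd ys) (tl ys))"
    unfolding rec_on_def by blast
  then have g_iff: "g (y # xs) = 0 \<longleftrightarrow> P y xs" if "length xs = n" for y xs using that by simp
  have "recursive n (\<lambda>xs. LEAST y. g (y # xs) = 0)"
    using g(1) g_iff assms(2) by (intro minimise) auto
  then show ?thesis by (rule rec_onI) (simp add: g_iff)
qed

text \<open>Doubling removes the division hidden in \<open>triangle\<close>; the polynomial equation
  that remains lets both decoding functions be found by minimisation with a bounded
  quantifier.\<close>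

lemma prod_encode_eq_iff: "prod_encode (j, k) = c \<longleftrightarrow> (j + k) * Suc (j + k) + 2 * j = 2 * c"
proof -
  have "2 * triangle i = i * Suc i" for i by (induction i) simp_all
  from this[of "j + k"] show ?thesis unfolding prod_encode_def by auto
qed

lemma fst_prod_decode_eq_iff: "j = fst (prod_decode c) \<longleftrightarrow> (\<exists>k<Suc c. prod_encode (j, k) = c)"
proof
  assume "j = fst (prod_decode c)"
  then have c: "prod_encode (j, snd (prod_decode c)) = c" by simp
  moreover have "snd (prod_decode c) < Suc c" using le_prod_encode_2[of "snd (prod_decode c)" j] c by simp
  ultimately show "\<exists>k<Suc c. prod_encode (j, k) = c" by blast
qed auto

lemma snd_prod_decode_eq_iff: "k = snd (prod_decode c) \<longleftrightarrow> (\<exists>j<Suc c. prod_encode (j, k) = c)"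
proof
  assume "k = snd (prod_decode c)"
  then have c: "prod_encode (fst (prod_decode c), k) = c" by simp
  moreover have "fst (prod_decode c) < Suc c" using le_prod_encode_1[of "fst (prod_decode c)" k] c by simp
  ultimately show "\<exists>j<Suc c. prod_encode (j, k) = c" by blast
qed auto

lemma rec_on_fst_prod_decode:
  assumes "rec_on n f" shows "rec_on n (\<lambda>xs. fst (prod_decode (f xs)))"
proof -
  have "rec_on n (\<lambda>xs. LEAST j. \<exists>k<Suc (f xs). (j + k) * Suc (j + k) + 2 * j = 2 * f xs)"
  proof (rule rec_on_Least)
    show "decidable (Suc n) (\<lambda>ys. \<exists>k<Suc (f (tl ys)). (hd ys + k) * Suc (hd ys + k) + 2 * hd ys = 2 * f (tl ys))"
      by (intro decidable_ex decidable_eq rec_on_add rec_on_mult rec_on_Suc rec_on_const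
          rec_on_hd0 rec_on_hd1 assms rec_on_tl[OF assms] rec_on_tl[OF rec_on_tl[OF assms]])
    show "\<exists>j. \<exists>k<Suc (f xs). (j + k) * Suc (j + k) + 2 * j = 2 * f xs" for xs
      using fst_prod_decode_eq_iff[of _ "f xs"] unfolding prod_encode_eq_iff by blast
  qed
  moreover have "(LEAST j. \<exists>k<Suc c. (j + k) * Suc (j + k) + 2 * j = 2 * c) = fst (prod_decode c)" for c
    unfolding prod_encode_eq_iff[symmetric] fst_prod_decode_eq_iff[symmetric] by (rule Least_equality) simp_all
  ultimately show ?thesis by simp
qed

lemma rec_on_snd_prod_decode:
  assumes "rec_on n f" shows "rec_on n (\<lambda>xs. snd (prod_decode (f xs)))"
proof -
  have "rec_on n (\<lambda>xs. LEAST k. \<exists>j<Suc (f xs). (j + k) * Suc (j + k) + 2 * j = 2 * f xs)"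
  proof (rule rec_on_Least)
    show "decidable (Suc n) (\<lambda>ys. \<exists>j<Suc (f (tl ys)). (j + hd ys) * Suc (j + hd ys) + 2 * j = 2 * f (tl ys))"
      by (intro decidable_ex decidable_eq rec_on_add rec_on_mult rec_on_Suc rec_on_const
          rec_on_hd0 rec_on_hd1 assms rec_on_tl[OF assms] rec_on_tl[OF rec_on_tl[OF assms]])
    show "\<exists>k. \<exists>j<Suc (f xs). (j + k) * Suc (j + k) + 2 * j = 2 * f xs" for xs
      using snd_prod_decode_eq_iff[of _ "f xs"] unfolding prod_encode_eq_iff by blast
  qed
  moreover have "(LEAST k. \<exists>j<Suc c. (j + k) * Suc (j + k) + 2 * j = 2 * c) = snd (prod_decode c)" for c
    unfolding prod_encode_eq_iff[symmetric] snd_prod_decode_eq_iff[symmetric] by (rule Least_equality) simp_all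
  ultimately show ?thesis by simp
qed

text \<open>The code of a nonempty list is the successor of the pair of its head and the code of its
  tail, hence the subtractions. Past the end of a list the value is 0.\<close>

definition entry :: "nat \<Rightarrow> nat \<Rightarrow> nat" where
  "entry c i = fst (prod_decode (((\<lambda>c. snd (prod_decode (c - 1))) ^^ i) c - 1))"

lemma entry_list_encode: "i < length xs \<Longrightarrow> entry (list_encode xs) i = xs ! i"
proof (induction xs arbitrary: i)
  case (Cons x xs)
  then show ?case by (cases i) (simp_all add: entry_def funpow_Suc_right del: funpow.simps(2))
qed simp

lemma rec_on_entry:
  assumes "rec_on n f" "rec_on n g" shows "rec_on n (\<lambda>xs. entry (f xs) (g xs))"
proof -
  have "rec_on n (\<lambda>xs. fst (prod_decode (rec_nat (f xs) (\<lambda>y r. snd (prod_decode (r - 1))) (g xs) - 1)))"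
    using assms by (intro rec_on_fst_prod_decode rec_on_diff rec_on_rec_nat rec_on_snd_prod_decode
        rec_on_hd1 rec_on_const)
  moreover have "rec_nat c (\<lambda>y r. snd (prod_decode (r - 1))) i = ((\<lambda>c. snd (prod_decode (c - 1))) ^^ i) c" for c i
    by (induction i) simp_all
  ultimately show ?thesis by (simp add: entry_def)
qed

text \<open>Bit \<open>i\<close> of \<open>r\<close> is 1 iff the quotient by \<open>2 ^ i\<close>
  is odd; writing out quotient and remainder replaces division by bounded quantifiers.\<close>

lemma mem_set_decode_iff: "i \<in> set_decode r \<longleftrightarrow> (\<exists>q<Suc r. \<exists>s<2 ^ i. r = Suc (2 * q) * 2 ^ i + s)"
proof
  assume "i \<in> set_decode r"
  then have "odd (r div 2 ^ i)" by (simp add: set_decode_def)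
  then obtain q where q: "r div 2 ^ i = Suc (2 * q)" by (metis oddE Suc_eq_plus1)
  have "r = Suc (2 * q) * 2 ^ i + r mod 2 ^ i" using div_mult_mod_eq[of r "2 ^ i"] q by simp
  moreover have "q < Suc r" using q div_le_dividend[of r "2 ^ i"] by linarith
  ultimately show "\<exists>q<Suc r. \<exists>s<2 ^ i. r = Suc (2 * q) * 2 ^ i + s"
    using mod_less_divisor[of "2 ^ i" r] by (metis zero_less_numeral zero_less_power)
next
  assume "\<exists>q<Suc r. \<exists>s<2 ^ i. r = Suc (2 * q) * 2 ^ i + s"
  then obtain q s where s: "s < 2 ^ i" "r = s + 2 ^ i * Suc (2 * q)" by (metis add.commute mult.commute)
  then have "r div 2 ^ i = Suc (2 * q) + s div 2 ^ i" unfolding s(2) by (intro div_mult_self2) simp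
  then have "r div 2 ^ i = Suc (2 * q)" using s(1) by simp
  then show "i \<in> set_decode r" by (simp add: set_decode_def)
qed

lemma decidable_mem_set_decode:
  assumes "rec_on n f" "rec_on n g" shows "decidable n (\<lambda>xs. f xs \<in> set_decode (g xs))"
  unfolding mem_set_decode_iff
  by (intro decidable_ex decidable_eq rec_on_add rec_on_mult rec_on_Suc rec_on_power rec_on_const
      rec_on_hd0 rec_on_hd1 assms rec_on_tl[OF assms(1)] rec_on_tl[OF assms(2)]
      rec_on_tl[OF rec_on_tl[OF assms(1)]] rec_on_tl[OF rec_on_tl[OF assms(2)]])

lemma set_encode_less:
  assumes "S \<subseteq> {..<n}" shows "set_encode S < 2 ^ n"
proof -
  have "set_encode S \<le> (\<Sum>i<n. 2 ^ i)"
    unfolding set_encode_def using assms by (intro sum_mono2) auto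
  also have "\<dots> < 2 ^ n" by (induction n) simp_all
  finally show ?thesis .
qed

section \<open>The decision procedure\<close>

text \<open>
  The constants are positions in the list encoded by \<open>recognizer_code\<close>; a relation on \<open>{..<n}\<close> is
  coded by the set of its pairs \<open>(v, w)\<close>, written as \<open>v * n + w\<close>.
\<close>

definition vmult :: "nat \<Rightarrow> nat \<Rightarrow> nat \<Rightarrow> nat" where
  "vmult c v w = entry (entry (entry c 5) v) w"

definition vact :: "nat \<Rightarrow> nat \<Rightarrow> nat \<Rightarrow> nat" where
  "vact c v h = entry (entry (entry c 7) v) h"

definition related :: "nat \<Rightarrow> nat \<Rightarrow> nat \<Rightarrow> nat \<Rightarrow> bool" where
  "related r c v w \<longleftrightarrow> v * entry c 2 + w \<in> set_decode r"

definition accepting :: "nat \<Rightarrow> nat \<Rightarrow> bool" where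
  "accepting c h \<longleftrightarrow> entry (entry c 11) h = 1"

definition code_closed :: "nat \<Rightarrow> nat \<Rightarrow> bool" where
  "code_closed r c \<longleftrightarrow> related r c (entry c 6) (entry c 6) \<and>
    (\<forall>p<entry c 2. \<forall>q<entry c 2. related r c p q \<longrightarrow>
       (related r c (entry (entry c 8) (vact c p (entry c 4))) (entry (entry c 8) (vact c q (entry c 4))) \<and>
        related r c (entry (entry c 9) (vact c p (entry c 4))) (entry (entry c 9) (vact c q (entry c 4)))) \<and>
       (\<forall>p'<entry c 2. \<forall>q'<entry c 2. related r c p' q' \<longrightarrow> related r c (vmult c p p') (vmult c q q'))) \<and>
    (\<forall>a<entry c 0. related r c (entry c 6) (entry (entry c 10) a) \<and>
       related r c (entry (entry c 10) a) (entry (entry c 10) a))"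

definition code_absorbing :: "nat \<Rightarrow> nat \<Rightarrow> bool" where
  "code_absorbing r c \<longleftrightarrow> (\<forall>u<entry c 2. \<forall>e<entry c 2. related r c u e \<longrightarrow> vmult c e e = e \<longrightarrow>
    (\<forall>p<entry c 2. related r c p p \<longrightarrow> (\<forall>t<entry c 2. related r c t t \<longrightarrow>
       (accepting c (vact c p (vact c e (vact c u (vact c t (entry c 4))))) \<longleftrightarrow>
          accepting c (vact c p (vact c e (vact c t (entry c 4))))) \<and>
       (accepting c (vact c p (vact c u (vact c e (vact c t (entry c 4))))) \<longleftrightarrow>
          accepting c (vact c p (vact c e (vact c t (entry c 4))))))))"

definition decide :: "nat \<Rightarrow> bool" where
  "decide c \<longleftrightarrow> (\<exists>r < 2 ^ (entry c 2 * entry c 2). code_closed r c \<and> code_absorbing r c)"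

lemmas rec_on_hds = rec_on_hd0 rec_on_hd1 rec_on_hd2 rec_on_hd3 rec_on_hd4 rec_on_hd5

lemmas rec_on_ops = rec_on_entry rec_on_mult rec_on_add rec_on_power rec_on_const rec_on_hds

lemma rec_on_vmult: "rec_on n f \<Longrightarrow> rec_on n g \<Longrightarrow> rec_on n h \<Longrightarrow> rec_on n (\<lambda>xs. vmult (f xs) (g xs) (h xs))"
  and rec_on_vact: "rec_on n f \<Longrightarrow> rec_on n g \<Longrightarrow> rec_on n h \<Longrightarrow> rec_on n (\<lambda>xs. vact (f xs) (g xs) (h xs))"
  and decidable_accepting: "rec_on n f \<Longrightarrow> rec_on n g \<Longrightarrow> decidable n (\<lambda>xs. accepting (f xs) (g xs))"
  and decidable_related: "rec_on n k \<Longrightarrow> rec_on n f \<Longrightarrow> rec_on n g \<Longrightarrow> rec_on n h \<Longrightarrow>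
    decidable n (\<lambda>xs. related (k xs) (f xs) (g xs) (h xs))"
  unfolding vmult_def vact_def accepting_def related_def
  by (intro rec_on_entry decidable_eq decidable_mem_set_decode rec_on_add rec_on_mult rec_on_const; assumption)+

lemma decidable_decide: "decidable (Suc 0) (\<lambda>xs. decide (hd xs))"
  unfolding decide_def code_closed_def code_absorbing_def
  by (intro decidable_ex decidable_all decidable_conj decidable_imp decidable_iff decidable_eq
      decidable_related decidable_accepting rec_on_vmult rec_on_vact rec_on_ops)

section \<open>Correctness of the procedure on codes of recognisers\<close>

lemma entry_table: "i < n \<Longrightarrow> entry (table n f) i = f i"
  by (simp add: table_def entry_list_encode)

lemma entry_table2: "i < m \<Longrightarrow> j < n \<Longrightarrow> entry (entry (table2 m n f) i) j = f i j"
  by (simp add: table2_def entry_table)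

lemma pair_less_square:
  fixes v w n :: nat
  assumes "v < n" "w < n" shows "v * n + w < n * n"
proof -
  have "v * n + w < Suc v * n" using assms(2) by simp
  also have "\<dots> \<le> n * n" using assms(1) by (intro mult_right_mono) simp_all
  finally show ?thesis .
qed

text \<open>A property that inspects a relation only below \<open>n\<close> cannot tell it from its
  restriction, whose pairs are coded by numbers below \<open>n * n\<close>; their characteristic
  bits form a number within the search bound.\<close>

lemma ex_related_iff:
  assumes c: "entry c 2 = n"
    and local: "\<And>R R'. (\<And>v w. v < n \<Longrightarrow> w < n \<Longrightarrow> R v w \<longleftrightarrow> R' v w) \<Longrightarrow> P R \<longleftrightarrow> P R'"
  shows "(\<exists>r < 2 ^ (n * n). P (related r c)) \<longleftrightarrow> (\<exists>R. P R)"
proof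
  assume "\<exists>R. P R"
  then obtain R where R: "P R" ..
  define S where "S = {v * n + w | v w. v < n \<and> w < n \<and> R v w}"
  have S: "S \<subseteq> {..<n * n}" using pair_less_square by (auto simp: S_def)
  then have "finite S" using finite_subset by blast
  have "v * n + w \<in> S \<longleftrightarrow> R v w" if "v < n" "w < n" for v w
  proof
    assume "v * n + w \<in> S"
    then obtain v' w' where eq: "v * n + w = v' * n + w'" and "w' < n" "R v' w'" by (auto simp: S_def)
    have "(v * n + w) div n = (v' * n + w') div n" "(v * n + w) mod n = (v' * n + w') mod n"
      by (simp_all only: eq)
    then have "v = v'" "w = w'" using \<open>w < n\<close> \<open>w' < n\<close> by simp_all
    then show "R v w" using \<open>R v' w'\<close> by simp
  qed (use that in \<open>auto simp: S_def\<close>)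
  then have "P (related (set_encode S) c) \<longleftrightarrow> P R"
    using c \<open>finite S\<close> by (intro local) (simp add: related_def)
  then show "\<exists>r < 2 ^ (n * n). P (related r c)" using R set_encode_less[OF S] by blast
qed blast

lemma decide_recognizer_code:
  fixes F :: "(nat, nat) forest_algebra"
  assumes "carrier (hor F) = {..<m}" "carrier (ver F) = {..<n}"
    and "forest_algebra_morphism (free_forest_algebra {..<k}) F \<phi> \<psi>" "X \<subseteq> carrier (hor F)"
  shows "decide (recognizer_code k m n F \<psi> X) \<longleftrightarrow>
    piecewise_testable {..<k} {t \<in> forests {..<k}. \<phi> t \<in> X}"
proof -
  interpret forest_algebra_morphism "free_forest_algebra {..<k}" F \<phi> \<psi> by fact
  interpret recognized_language "{..<k}" F \<phi> \<psi> X
    by unfold_locales (simp_all add: assms(1,2))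
  define c where "c = recognizer_code k m n F \<psi> X"
  note in_hor = assms(1)[THEN eqset_imp_iff, unfolded lessThan_iff]
  note in_ver = assms(2)[THEN eqset_imp_iff, unfolded lessThan_iff]
  have entries: "entry c 0 = k" "entry c 2 = n" "entry c 4 = \<one>\<^bsub>hor F\<^esub>" "entry c 6 = \<one>\<^bsub>ver F\<^esub>"
    by (simp_all add: c_def recognizer_code_def entry_list_encode nth_Cons' del: list_encode.simps)
  have tables: "entry c 5 = table2 n n (\<lambda>v w. v \<otimes>\<^bsub>ver F\<^esub> w)" "entry c 7 = table2 n m (act F)"
    "entry c 8 = table m (inl F)" "entry c 9 = table m (inr F)"
    "entry c 10 = table k (\<lambda>a. \<psi> (letter_ctxt a))" "entry c 11 = table m (\<lambda>h. if h \<in> X then 1 else 0)"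
    by (simp_all add: c_def recognizer_code_def entry_list_encode nth_Cons' del: list_encode.simps)
  have vmult: "vmult c v w = v \<otimes>\<^bsub>ver F\<^esub> w" if "v < n" "w < n" for v w
    using that by (simp add: vmult_def tables entry_table2)
  have vact: "vact c v h = act F v h" if "v < n" "h < m" for v h
    using that by (simp add: vact_def tables entry_table2)
  have act_less: "act F v h < m" if "v < n" "h < m" for v h
    using target.act_closed[of v h] that by (simp add: in_hor in_ver)
  have mult_less: "v \<otimes>\<^bsub>ver F\<^esub> w < n" if "v < n" "w < n" for v w
    using V.m_closed[of v w] that by (simp add: in_ver)
  have one_less: "\<one>\<^bsub>hor F\<^esub> < m" "\<one>\<^bsub>ver F\<^esub> < n"
    using H.one_closed V.one_closed by (simp_all add: in_hor in_ver)
  have in_less: "inl F h < n" "inr F h < n" if "h < m" for h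
    using target.inl_closed[of h] target.inr_closed[of h] that by (simp_all add: in_hor in_ver)
  have letter_less: "\<psi> (letter_ctxt a) < n" if "a < k" for a
    using \<psi>_closed[of "letter_ctxt a"] that by (simp add: letter_ctxt_def in_ver)
  have entry_simps: "entry (entry c 8) h = inl F h" "entry (entry c 9) h = inr F h"
    "accepting c h \<longleftrightarrow> h \<in> X" if "h < m" for h
    using that by (simp_all add: tables entry_table accepting_def)
  have letter: "entry (entry c 10) a = \<psi> (letter_ctxt a)" if "a < k" for a
    using that by (simp add: tables entry_table)
  note simps = entries vmult vact act_less mult_less one_less in_less letter_less entry_simps letter
  \<comment> \<open>Table lookups agree with the operations only for arguments in range; the
    congruence rules make the bounds of the quantifiers available to the rewriting.\<close>
  have closed: "code_closed r c \<longleftrightarrow> piece_closed (related r c)" for r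
    unfolding code_closed_def piece_closed_def Let_def assms(2)
    by (simp add: simps Ball_def cong: conj_cong imp_cong)
  have absorbing: "code_absorbing r c \<longleftrightarrow> absorbing_on (related r c)" for r
    unfolding code_absorbing_def absorbing_on_def Let_def assms(2)
    by (simp add: simps Ball_def cong: conj_cong imp_cong)
  have "decide c \<longleftrightarrow> (\<exists>r < 2 ^ (n * n). piece_closed (related r c) \<and> absorbing_on (related r c))"
    unfolding decide_def entries closed absorbing ..
  also have "\<dots> \<longleftrightarrow> (\<exists>R. piece_closed R \<and> absorbing_on R)"
  proof (rule ex_related_iff[OF entries(2)])
    fix R R' :: "nat \<Rightarrow> nat \<Rightarrow> bool"
    assume eq: "\<And>v w. v < n \<Longrightarrow> w < n \<Longrightarrow> R v w \<longleftrightarrow> R' v w"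
    have "piece_closed R \<longleftrightarrow> piece_closed R'"
      unfolding piece_closed_def Let_def assms(2) by (simp add: simps eq Ball_def cong: conj_cong imp_cong)
    moreover have "absorbing_on R \<longleftrightarrow> absorbing_on R'"
      unfolding absorbing_on_def Let_def assms(2) by (simp add: simps eq Ball_def cong: conj_cong imp_cong)
    ultimately show "(piece_closed R \<and> absorbing_on R) \<longleftrightarrow> (piece_closed R' \<and> absorbing_on R')" by simp
  qed
  also have "\<dots> \<longleftrightarrow> piecewise_testable {..<k} L"
    unfolding piecewise_testable_iff_absorbing absorbing_iff ..
  finally show ?thesis unfolding c_def L_def .
qed

theorem corollary5:
  shows "\<exists>d. recursive 1 d \<and>
    (\<forall>(k :: nat) (m :: nat) (n :: nat) (F :: (nat, nat) forest_algebra) \<phi> \<psi> X.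
       carrier (hor F) = {..<m} \<longrightarrow> carrier (ver F) = {..<n} \<longrightarrow>
       forest_algebra_morphism (free_forest_algebra {..<k}) F \<phi> \<psi> \<longrightarrow>
       X \<subseteq> carrier (hor F) \<longrightarrow>
       d [recognizer_code k m n F \<psi> X] =
         (if piecewise_testable {..<k} {t \<in> forests {..<k}. \<phi> t \<in> X} then 1 else 0))"
proof -
  obtain d where d: "recursive 1 d" "\<And>xs. length xs = 1 \<Longrightarrow> d xs = of_bool (decide (hd xs))"
    using decidable_decide unfolding decidable_def rec_on_def One_nat_def by blast
  then show ?thesis by (intro exI[of _ d]) (auto simp: decide_recognizer_code)
qed

end
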